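(* If $\mathcal{T}$ is a $T_1$ second countable semigroup topology on the symmetric inverse monoid $I_{\mathbb N}$, then there exists a waning function $f:\omega+1\to\omega+1$ such that either $\mathcal{T}=\mathcal{T}_f$ or $\mathcal{T}^{-1}=\mathcal{T}_f$. Conversely, if $f$ and $g$ are distinct waning functions, then $\mathcal{T}_f$ and $\mathcal{T}_g$ are distinct Polish semigroup topologies on $I_{\mathbb N}$.
   Context: $\mathbb N=\omega=\{0,1,2,\dots\}$; $\omega+1=\omega\cup\{\omega\}$ with $\omega$ the largest element. Functions are written on the right of their arguments. $I_{\mathbb N}$ is the symmetric inverse monoid: all bijections between subsets of $\mathbb N$ (including the empty map $\varnothing$), viewed as subsets of $\mathbb N\times\mathbb N$, with multiplication the composition of binary relations ($fg$ means first $f$, then $g$). A topology on $I_{\mathbb N}$ is a semigroup topology if multiplication $I_{\mathbb N}\times I_{\mathbb N}\to I_{\mathbb N}$ is (jointly) continuous; it is a Polish semigroup topology if moreover it is Polish (separable and completely metrizable). For a topology $\mathcal T$ on $I_{\mathbb N}$, $\mathcal T^{-1}=\{U^{-1}:U\in\mathcal T\}$, where $U^{-1}=\{g^{-1}:g\in U\}$. $\mathcal I_2$ is the topology on $I_{\mathbb N}$ with subbasis consisting of all sets $\{h\in I_{\mathbb N}:(x,y)\in h\}$ and $\{h\in I_{\mathbb N}:x\notin\operatorname{dom}(h)\}$, $x,y\in\mathbb N$. For any function $f:\omega+1\to\omega+1$, $\mathcal T_f$ is the least topology on $I_{\mathbb N}$ containing $\mathcal I_2$ and all sets $$U_{f,n,X}=\{g\in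 I_{\mathbb N}: |\operatorname{im}(g)\setminus X|\ge n \text{ and } |X\cap\operatorname{im}(g)|\le (n)f\},$$ where $n\in\mathbb N$ and $X\subset\mathbb N$ is finite. A non-increasing function $f:\omega+1\to\omega+1$ is waning if either $f$ is constant with value $\omega$, or there exists $i\in\omega$ with $(i)f\in\omega$, and $(j+1)f<(j)f$ for all $j\in\omega$ such that $0\ne(j)f\in\omega$. *)

theory Defs
  imports "HOL-Analysis.Analysis" "HOL-Library.Extended_Nat"
begin

text \<open>
  The ordinal \<open>\<omega> + 1\<close> is the type \<^typ>\<open>enat\<close>, with \<open>\<infinity>\<close> as its largest element \<open>\<omega>\<close>.
  Partial bijections are sets of pairs. Functions act on the right: \<open>(x, y) \<in> g\<close> means that
  \<open>g\<close> sends \<open>x\<close> to \<open>y\<close>, and \<open>f O g\<close> is first \<open>f\<close>, then \<open>g\<close>.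
\<close>

definition sym_inv_monoid :: "(nat \<times> nat) set set"
  where "sym_inv_monoid = {g. single_valued g \<and> single_valued (g\<inverse>)}"

definition semigroup_topology :: "(nat \<times> nat) set topology \<Rightarrow> bool"
  where "semigroup_topology T \<longleftrightarrow>
    topspace T = sym_inv_monoid \<and>
    continuous_map (prod_topology T T) T (\<lambda>(f, g). f O g)"

definition polish_semigroup_topology :: "(nat \<times> nat) set topology \<Rightarrow> bool"
  where "polish_semigroup_topology T \<longleftrightarrow>
    semigroup_topology T \<and> separable_space T \<and> completely_metrizable_space T"

definition inv_topology :: "(nat \<times> nat) set topology \<Rightarrow> (nat \<times> nat) set topology"
  where "inv_topology T = topology (\<lambda>V. \<exists>U. openin T U \<and> V = converse ` U)"

lemma openin_inv_topology:
  "openin (inv_topology T) V \<longleftrightarrow> (\<exists>U. openin T U \<and> V = converse ` U)"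
proof -
  have "istopology (\<lambda>V. \<exists>U. openin T U \<and> V = converse ` U)"
    unfolding istopology_def
  proof (intro conjI allI impI)
    fix S S' :: "(nat \<times> nat) set set"
    assume "\<exists>U. openin T U \<and> S = converse ` U" "\<exists>U. openin T U \<and> S' = converse ` U"
    then obtain U U' where "openin T U" "S = converse ` U" "openin T U'" "S' = converse ` U'"
      by blast
    moreover have "converse ` U \<inter> converse ` U' = converse ` (U \<inter> U')"
      by (auto simp: image_iff)
    ultimately show "\<exists>W. openin T W \<and> S \<inter> S' = converse ` W"
      by (metis openin_Int)
  next
    fix K :: "(nat \<times> nat) set set set"
    assume "\<forall>S\<in>K. \<exists>U. openin T U \<and> S = converse ` U"
    then obtain u where u: "\<And>S. S \<in> K \<Longrightarrow> openin T (u S)" "\<And>S. S \<in> K \<Longrightarrow> S = converse ` u S"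
      by metis
    have "\<Union>K = converse ` (\<Union>S\<in>K. u S)"
      using u(2) by (simp add: image_UN)
    then show "\<exists>W. openin T W \<and> \<Union>K = converse ` W"
      using u(1) by (metis (no_types, lifting) imageE openin_Union)
  qed
  then show ?thesis
    by (simp add: inv_topology_def topology_inverse')
qed

definition topology_I2 :: "(nat \<times> nat) set topology"
  where "topology_I2 = topology_generated_by
    ({{h \<in> sym_inv_monoid. (x, y) \<in> h} | x y. True} \<union>
     {{h \<in> sym_inv_monoid. x \<notin> Domain h} | x. True})"

text \<open>
  The set \<open>Range g - X\<close> may be infinite, and then \<^const>\<open>card\<close> is \<open>0\<close>, so this case
  is listed separately.
\<close>

definition U_set :: "(enat \<Rightarrow> enat) \<Rightarrow> nat \<Rightarrow> nat set \<Rightarrow> (nat \<times> nat) set set"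
  where "U_set f n X = {g \<in> sym_inv_monoid.
    (infinite (Range g - X) \<or> n \<le> card (Range g - X)) \<and>
    enat (card (X \<inter> Range g)) \<le> f (enat n)}"

definition topology_f :: "(enat \<Rightarrow> enat) \<Rightarrow> (nat \<times> nat) set topology"
  where "topology_f f = topology_generated_by
    ({U. openin topology_I2 U} \<union> {U_set f n X | n X. finite X})"

definition waning :: "(enat \<Rightarrow> enat) \<Rightarrow> bool"
  where "waning f \<longleftrightarrow> antimono f \<and>
    (f = (\<lambda>_. \<infinity>) \<or>
     (\<exists>i::nat. f (enat i) \<noteq> \<infinity>) \<and>
     (\<forall>j::nat. f (enat j) \<noteq> 0 \<and> f (enat j) \<noteq> \<infinity> \<longrightarrow> f (enat (j + 1)) < f (enat j)))"

lemma topspace_topology_I2: "topspace topology_I2 = sym_inv_monoid"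
  unfolding topology_I2_def topology_generated_by_topspace by (auto simp: Domain_iff) blast

lemma topspace_topology_f: "topspace (topology_f f) = sym_inv_monoid"
proof -
  have "\<Union>{U. openin topology_I2 U} = sym_inv_monoid"
    by (metis topspace_def topspace_topology_I2)
  then show ?thesis
    unfolding topology_f_def topology_generated_by_topspace by (auto simp: U_set_def)
qed

end

theory Submission
  imports Defs
begin

text \<open>
  For waning \<open>f\<close>, a point \<open>h\<close> of rank \<open>r\<close> has in \<open>\<T>\<^sub>f\<close> the neighbourhoods of all \<open>g\<close> that agree
  with \<open>h\<close> on \<open>{..<k}\<close> and have at most \<open>(r)f\<close> image points below \<open>k\<close> outside the image of \<open>h\<close>.
  Waning means that losing \<open>j\<close> points of rank is paid for by a gain of at least \<open>j\<close> in \<open>f\<close> (unless \<open>f\<close> has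
  reached \<open>0\<close>), and this makes multiplication continuous. Recording the finite restrictions of \<open>g\<close>
  together with the stages at which the bound is exceeded embeds \<open>\<T>\<^sub>f\<close> as a closed subspace of a
  countable product of discrete spaces, so it is Polish.

  Conversely, let \<open>\<T>\<close> be a \<open>T\<^sub>1\<close> second countable semigroup topology. Then \<open>\<T>\<close> or
  its inverse contains \<open>\<I>\<^sub>2\<close>: otherwise two nets of singletons \<open>{(a, y)}\<close> and \<open>{(x, b)}\<close> tend to the empty
  map, and matching \<open>y\<close> with \<open>x\<close> puts \<open>{(a, b)}\<close> in all neighbourhoods of the empty map. By automatic
  continuity of the symmetric group, \<open>\<T>\<close> is contained in \<open>\<T>\<^sub>0\<close>, the topology of the constant \<open>0\<close>.
  Between \<open>\<I>\<^sub>2\<close> and \<open>\<T>\<^sub>0\<close> only one thing is left open: how many new points near the origin an element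
  close to a given \<open>h\<close> of finite rank may have in its image. By homogeneity this number depends only
  on the rank of \<open>h\<close>, and it is the function \<open>f\<close>.
\<close>

section \<open>Neighbourhoods in \<open>\<T>\<^sub>f\<close>\<close>

text \<open>A topology containing \<open>\<I>\<^sub>2\<close> controls a map at points near the
  origin, but a pair \<open>(x, y)\<close> with \<open>x\<close> far away and \<open>y\<close> near
  the origin escapes it; this is the only freedom that separates the topologies in question. Two
  obstacles shape the classification. First, if a set bounding the number of image points in some
  \<open>X\<close> is not open, this yields new image points only at one bad limit, and the number
  \<open>k\<close> of image points which that limit already has in \<open>X\<close> is not under
  control; jumps of rank have to be chained to make up for this. Second, an element with the right
  new image points may have them at the wrong places of the domain. Multiplication by factors near
  the identity repairs this, and the inclusion in \<open>\<T>\<^sub>0\<close> is what certifies that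
  the factors are near the identity. That inclusion is first a statement about permutations near the
  identity, and a dilation extends it to all partial bijections. Inversion is not assumed to be
  continuous, so a small permutation is required to have a small inverse as well.\<close>

abbreviation SIM :: "(nat \<times> nat) set set" ("\<I>") where "\<I> \<equiv> sym_inv_monoid"

lemma simD1: "g \<in> \<I> \<Longrightarrow> (x, y) \<in> g \<Longrightarrow> (x, z) \<in> g \<Longrightarrow> y = z"
  unfolding sym_inv_monoid_def single_valued_def by blast

lemma simD2: "g \<in> \<I> \<Longrightarrow> (x, z) \<in> g \<Longrightarrow> (y, z) \<in> g \<Longrightarrow> x = y"
  unfolding sym_inv_monoid_def single_valued_def by blast

lemma simI:
  "(\<And>x y z. (x, y) \<in> g \<Longrightarrow> (x, z) \<in> g \<Longrightarrow> y = z) \<Longrightarrow>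
   (\<And>x y z. (x, z) \<in> g \<Longrightarrow> (y, z) \<in> g \<Longrightarrow> x = y) \<Longrightarrow> g \<in> \<I>"
  unfolding sym_inv_monoid_def single_valued_def by blast

lemma sim_comp: "g \<in> \<I> \<Longrightarrow> h \<in> \<I> \<Longrightarrow> g O h \<in> \<I>"
  by (rule simI) (blast dest: simD1 simD2)+

lemma sim_subset: "g \<in> \<I> \<Longrightarrow> h \<subseteq> g \<Longrightarrow> h \<in> \<I>"
  by (rule simI) (blast dest: simD1 simD2)+

lemma sim_converse: "g \<in> \<I> \<Longrightarrow> g\<inverse> \<in> \<I>"
  by (rule simI) (blast dest: simD1 simD2)+

lemma sim_Id [simp]: "Id \<in> \<I>"
  by (rule simI) auto

lemma sim_empty [simp]: "{} \<in> \<I>"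
  by (rule simI) auto

lemma sim_singleton [simp]: "{(x, y)} \<in> \<I>"
  by (rule simI) auto

lemma finite_preimage_sim:
  assumes "g \<in> \<I>" "finite S" shows "finite (g\<inverse> `` S)"
proof -
  have "finite (g\<inverse> `` {y})" for y
  proof (cases "y \<in> Range g")
    case True
    then obtain x where "(x, y) \<in> g" by blast
    then have "g\<inverse> `` {y} = {x}" using simD2[OF assms(1)] by blast
    then show ?thesis by simp
  next
    case False
    then have "g\<inverse> `` {y} = {}" by blast
    then show ?thesis by simp
  qed
  moreover have "g\<inverse> `` S = (\<Union>y\<in>S. g\<inverse> `` {y})" by blast
  ultimately show ?thesis using assms(2) by simp
qed

section \<open>Rank and basic neighbourhoods\<close>

definition rank :: "(nat \<times> nat) set \<Rightarrow> enat"
  where "rank g = (if finite (Range g) then enat (card (Range g)) else \<infinity>)"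

lemma card_le_rank:
  assumes "S \<subseteq> Range g" "finite S" shows "enat (card S) \<le> rank g"
  using assms by (auto simp: rank_def card_mono)

definition agree :: "(nat \<times> nat) set \<Rightarrow> nat \<Rightarrow> (nat \<times> nat) set set"
  where "agree h k = {g \<in> \<I>. \<forall>x<k. \<forall>y. (x, y) \<in> g \<longleftrightarrow> (x, y) \<in> h}"

text \<open>
  Here \<open>f \<infinity>\<close> matters although \<^const>\<open>topology_f\<close> ignores it: monotonicity forces \<open>f \<infinity> = 0\<close> for every
  waning \<open>f\<close> other than the constant \<open>\<infinity>\<close>, which is the right bound at points of infinite rank.
\<close>
definition nbhd :: "(enat \<Rightarrow> enat) \<Rightarrow> (nat \<times> nat) set \<Rightarrow> nat \<Rightarrow> (nat \<times> nat) set set"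
  where "nbhd f h k = {g \<in> agree h k. enat (card ({..<k} \<inter> Range g - Range h)) \<le> f (rank h)}"

lemma agree_iff: "g \<in> agree h k \<Longrightarrow> x < k \<Longrightarrow> (x, y) \<in> g \<longleftrightarrow> (x, y) \<in> h"
  unfolding agree_def by blast

lemma agreeI:
  "g \<in> \<I> \<Longrightarrow> (\<And>x y. x < k \<Longrightarrow> (x, y) \<in> g \<longleftrightarrow> (x, y) \<in> h) \<Longrightarrow> g \<in> agree h k"
  unfolding agree_def by blast

lemma agree_sim: "g \<in> agree h k \<Longrightarrow> g \<in> \<I>"
  by (simp add: agree_def)

lemma agree_antimono: "k \<le> k' \<Longrightarrow> agree h k' \<subseteq> agree h k"
  by (auto simp: agree_def)

lemma agree_refl: "h \<in> \<I> \<Longrightarrow> h \<in> agree h k"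
  by (simp add: agree_def)

lemma nbhd_subset_agree: "nbhd f h k \<subseteq> agree h k"
  by (auto simp: nbhd_def)

lemma nbhd_antimono: assumes "k \<le> k'" shows "nbhd f h k' \<subseteq> nbhd f h k"
proof
  fix g assume g: "g \<in> nbhd f h k'"
  have "card ({..<k} \<inter> Range g - Range h) \<le> card ({..<k'} \<inter> Range g - Range h)"
    using assms by (intro card_mono) auto
  then have "enat (card ({..<k} \<inter> Range g - Range h)) \<le> f (rank h)"
    using g unfolding nbhd_def by (metis (mono_tags, lifting) enat_ord_simps(1) mem_Collect_eq order_trans)
  then show "g \<in> nbhd f h k"
    using g agree_antimono[OF assms] by (auto simp: nbhd_def)
qed

text \<open>It suffices that \<open>k\<close> exceeds one chosen preimage of each point of
  \<open>S\<close>. Lying in the image is thus stable under approximation in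
  \<open>\<I>\<^sub>2\<close>; missing from the image is not.\<close>

lemma agree_Range:
  assumes "finite S" "S \<subseteq> Range h"
  shows "\<exists>k. \<forall>g \<in> agree h k. S \<subseteq> Range g"
proof -
  have "\<forall>y\<in>S. \<exists>x. (x, y) \<in> h" using assms by blast
  then obtain p where p: "\<And>y. y \<in> S \<Longrightarrow> (p y, y) \<in> h" by metis
  obtain k where "p ` S \<subseteq> {..<k}" using assms(1) finite_nat_iff_bounded by blast
  then have "S \<subseteq> Range g" if "g \<in> agree h k" for g
    using p agree_iff[OF that] by (meson Range.intros image_subset_iff lessThan_iff subsetI)
  then show ?thesis by blast
qed

text \<open>For shrinking families a neighbourhood condition survives finite intersections, by
  taking the larger index, and unions, so checking the generators is enough. Used for both
  \<open>topology_I2\<close> and \<open>topology_f\<close>.\<close>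

lemma openin_topology_generated_by_imp:
  assumes V: "openin (topology_generated_by S) V"
    and S: "\<And>W h. W \<in> S \<Longrightarrow> h \<in> W \<Longrightarrow> \<exists>k. N h k \<subseteq> W"
    and N: "\<And>h k k'. k \<le> k' \<Longrightarrow> N h k' \<subseteq> N h (k::nat)"
  shows "h \<in> V \<Longrightarrow> \<exists>k. N h k \<subseteq> V"
proof -
  have "generate_topology_on S V" using V by (simp add: openin_topology_generated_by_iff)
  then show "h \<in> V \<Longrightarrow> \<exists>k. N h k \<subseteq> V"
  proof (induction)
    case (Int A B)
    then obtain k k' where "N h k \<subseteq> A" "N h k' \<subseteq> B" by blast
    then have "N h (max k k') \<subseteq> A \<inter> B"
      using N[of k "max k k'" h] N[of k' "max k k'" h] by auto
    then show ?case by blast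
  qed (use S in blast)+
qed

lemma openin_I2_pair: "openin topology_I2 {h \<in> \<I>. (x, y) \<in> h}"
  unfolding topology_I2_def by (rule topology_generated_by_Basis) blast

lemma openin_I2_dom: "openin topology_I2 {h \<in> \<I>. x \<notin> Domain h}"
  unfolding topology_I2_def by (rule topology_generated_by_Basis) blast

text \<open>\<open>agree h k\<close> is a finite intersection of sets from the two families, one for
  each \<open>x < k\<close>, according to whether \<open>h\<close> is defined at \<open>x\<close>.
  \<open>T\<close> is left open because the same argument is applied later to an unknown semigroup
  topology.\<close>

lemma openin_agree:
  assumes pair: "\<And>x y. openin T {h \<in> \<I>. (x, y) \<in> h}"
    and dom: "\<And>x. openin T {h \<in> \<I>. x \<notin> Domain h}" and h: "h \<in> \<I>" and T: "topspace T = \<I>"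
  shows "openin T (agree h k)"
proof (induction k)
  case 0
  have "agree h 0 = topspace T" by (auto simp: agree_def T)
  then show ?case by simp
next
  case (Suc k)
  show ?case
  proof (cases "\<exists>y. (k, y) \<in> h")
    case True
    then obtain y where y: "(k, y) \<in> h" by blast
    have "agree h (Suc k) = agree h k \<inter> {g \<in> \<I>. (k, y) \<in> g}" (is "?l = ?r")
    proof
      show "?r \<subseteq> ?l"
      proof
        fix g assume g: "g \<in> ?r"
        show "g \<in> ?l"
        proof (rule agreeI)
          show "g \<in> \<I>" using g by blast
          fix x z assume "x < Suc k"
          then consider "x < k" | "x = k" by linarith
          then show "(x, z) \<in> g \<longleftrightarrow> (x, z) \<in> h"
          proof cases
            case 1
            then show ?thesis using g agree_iff by blast
          next
            case 2
            then show ?thesis using g y simD1[OF h, of k] simD1[of g k] by blast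
          qed
        qed
      qed
      show "?l \<subseteq> ?r" using y by (auto simp: agree_def)
    qed
    then show ?thesis using Suc pair by auto
  next
    case False
    then have "agree h (Suc k) = agree h k \<inter> {g \<in> \<I>. k \<notin> Domain g}"
      by (auto simp: agree_def less_Suc_eq)
    then show ?thesis using Suc dom by auto
  qed
qed

lemma openin_I2_iff:
  "openin topology_I2 V \<longleftrightarrow> V \<subseteq> \<I> \<and> (\<forall>h\<in>V. \<exists>k. agree h k \<subseteq> V)"
proof (intro iffI conjI ballI)
  assume V: "openin topology_I2 V"
  then show "V \<subseteq> \<I>" using openin_subset topspace_topology_I2 by blast
  fix h assume h: "h \<in> V"
  show "\<exists>k. agree h k \<subseteq> V"
  proof (rule openin_topology_generated_by_imp[OF V[unfolded topology_I2_def] _ _ h])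
    fix W and h :: "(nat \<times> nat) set"
    assume W: "W \<in> {{h \<in> \<I>. (x, y) \<in> h} |x y. True} \<union> {{h \<in> \<I>. x \<notin> Domain h} |x. True}" "h \<in> W"
    from W consider x y where "W = {h \<in> \<I>. (x, y) \<in> h}" | x where "W = {h \<in> \<I>. x \<notin> Domain h}"
      by blast
    then show "\<exists>k. agree h k \<subseteq> W"
    proof cases
      case 1
      then have "agree h (Suc x) \<subseteq> W" using W(2) by (auto simp: agree_def)
      then show ?thesis by blast
    next
      case 2
      then have "agree h (Suc x) \<subseteq> W" using W(2) by (fastforce simp: agree_def)
      then show ?thesis by blast
    qed
  qed (rule agree_antimono)
next
  assume V: "V \<subseteq> \<I> \<and> (\<forall>h\<in>V. \<exists>k. agree h k \<subseteq> V)"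
  have "\<exists>W. openin topology_I2 W \<and> h \<in> W \<and> W \<subseteq> V" if h: "h \<in> V" for h
  proof -
    obtain k where "agree h k \<subseteq> V" using V h by blast
    moreover have "h \<in> \<I>" using V h by blast
    ultimately show ?thesis
      by (intro exI[of _ "agree h k"] conjI openin_agree[OF openin_I2_pair openin_I2_dom _ topspace_topology_I2] agree_refl)
  qed
  then show "openin topology_I2 V" using openin_subopen[of topology_I2 V] by metis
qed

text \<open>A nonzero value at \<open>e\<close> forces all earlier values to be nonzero. If
  \<open>f (enat n)\<close> is finite, every step from \<open>n\<close> on is then a strict drop,
  and the drops add up.\<close>

lemma waning_gap:
  assumes f: "waning f" and e: "enat (n + k) \<le> e"
  shows "f e = 0 \<or> enat k + f e \<le> f (enat n)"
proof -
  have anti: "\<And>a b. a \<le> b \<Longrightarrow> f b \<le> f a" using f by (simp add: waning_def antimono_def)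
  have *: "f (enat (n + k)) = 0 \<or> enat k + f (enat (n + k)) \<le> f (enat n)" for n k
  proof (induction k)
    case 0
    show ?case by (simp flip: zero_enat_def)
  next
    case (Suc k)
    show ?case
    proof (cases "f (enat (n + Suc k)) = 0 \<or> f (enat n) = \<infinity>")
      case False
      have le: "f (enat (n + Suc k)) \<le> f (enat (n + k))" "f (enat (n + k)) \<le> f (enat n)"
        using anti by auto
      have "f (enat (n + k)) \<noteq> 0" using le False by auto
      moreover have "f (enat (n + k)) \<noteq> \<infinity>" using le(2) False by (metis enat_ord_simps(5))
      moreover have "f \<noteq> (\<lambda>_. \<infinity>)" using False by auto
      ultimately have "f (enat (n + k + 1)) < f (enat (n + k))"
        using f unfolding waning_def by blast
      then have "f (enat (n + Suc k)) + 1 \<le> f (enat (n + k))"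
        by (simp add: ileI1 flip: eSuc_plus_1)
      moreover have "enat k + f (enat (n + k)) \<le> f (enat n)"
        using Suc \<open>f (enat (n + k)) \<noteq> 0\<close> by blast
      moreover have "f (enat (n + k)) \<noteq> \<infinity>" by fact
      ultimately show ?thesis using False le
        by (cases "f (enat n)"; cases "f (enat (n + k))"; cases "f (enat (n + Suc k))") (auto simp: one_enat_def)
    qed auto
  qed
  show ?thesis
  proof (cases e)
    case (enat m)
    then obtain j where j: "m = n + k + j" using e le_Suc_ex by auto
    have "enat k + f e \<le> enat (k + j) + f e" by (intro add_right_mono) simp
    then show ?thesis
      using *[of n "k + j"] unfolding enat j by (metis add.assoc order_trans)
  next
    case infinity
    show ?thesis
    proof (cases "f = (\<lambda>_. \<infinity>)")
      case False
      then obtain i where i: "f (enat i) \<noteq> \<infinity>" using f unfolding waning_def by blast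
      then obtain m where m: "f (enat i) = enat m" by auto
      \<comment> \<open>From the value \<open>m\<close> there cannot be \<open>m + 1\<close> strict
        drops, so zero has been reached.\<close>
      have "f (enat (i + Suc m)) = 0"
        using *[of i "Suc m"] unfolding m by (cases "f (enat (i + Suc m))") auto
      then have "f e = 0" using anti[of "enat (i + Suc m)" e] infinity by simp
      then show ?thesis by blast
    qed auto
  qed
qed

lemma waning_infinity:
  assumes "waning f" shows "f = (\<lambda>_. \<infinity>) \<or> f \<infinity> = 0 \<and> (\<exists>n. f (enat n) = 0)"
proof (cases "f = (\<lambda>_. \<infinity>)")
  case False
  then obtain i where i: "f (enat i) \<noteq> \<infinity>" using assms unfolding waning_def by blast
  then obtain m where m: "f (enat i) = enat m" by auto
  have "f (enat (i + Suc m)) = 0"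
    using waning_gap[OF assms, of i "Suc m" "enat (i + Suc m)"] unfolding m by (cases "f (enat (i + Suc m))") auto
  moreover have "f \<infinity> \<le> f (enat (i + Suc m))"
    using assms by (simp add: waning_def antimono_def)
  ultimately show ?thesis by auto
qed auto

lemma waning_antimono: "waning f \<Longrightarrow> a \<le> b \<Longrightarrow> f b \<le> f a"
  by (simp add: waning_def antimono_def)

text \<open>The \<open>n\<close> points of \<open>S\<close> and the points of \<open>X\<close> hit
  by \<open>h\<close> are disjoint parts of \<open>Range h\<close>, so the rank is at least the sum
  of their numbers. By \<open>waning_gap\<close> the old points of \<open>X\<close> and the
  permitted new ones together stay within \<open>f (enat n)\<close>; if no new ones are permitted,
  the bound satisfied by \<open>h\<close> itself suffices.\<close>

lemma nbhd_U_set: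
  assumes f: "waning f" and X: "finite X" and h: "h \<in> U_set f n X"
  shows "\<exists>k. nbhd f h k \<subseteq> U_set f n X"
proof -
  have hI: "h \<in> \<I>" and hn: "infinite (Range h - X) \<or> n \<le> card (Range h - X)"
    and hX: "enat (card (X \<inter> Range h)) \<le> f (enat n)"
    using h by (auto simp: U_set_def)
  obtain S where S: "S \<subseteq> Range h - X" "finite S" "card S = n"
    using hn infinite_arbitrarily_large obtain_subset_with_card_n by metis
  have fin: "finite (S \<union> (X \<inter> Range h))" using S X by simp
  then obtain k1 where k1: "\<And>g. g \<in> agree h k1 \<Longrightarrow> S \<union> (X \<inter> Range h) \<subseteq> Range g"
    using agree_Range[of "S \<union> (X \<inter> Range h)" h] S by blast
  obtain k2 where k2: "X \<subseteq> {..<k2}" using X finite_nat_iff_bounded by blast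
  define k where "k = max k1 k2"
  have "card (S \<union> (X \<inter> Range h)) = n + card (X \<inter> Range h)"
    using S X by (subst card_Un_disjoint) auto
  then have "enat (n + card (X \<inter> Range h)) \<le> rank h"
    using card_le_rank[of "S \<union> (X \<inter> Range h)" h] S fin by auto
  then have gap: "f (rank h) = 0 \<or> enat (card (X \<inter> Range h)) + f (rank h) \<le> f (enat n)"
    using waning_gap[OF f] by blast
  then have gap: "enat (card (X \<inter> Range h)) + f (rank h) \<le> f (enat n)"
    using hX by auto
  have "g \<in> U_set f n X" if g: "g \<in> nbhd f h k" for g
  proof -
    have gk: "g \<in> agree h k1" and gI: "g \<in> \<I>"
      using g agree_antimono[of k1 k h] by (auto simp: nbhd_def k_def agree_def)
    have "S \<subseteq> Range g - X"
      using k1[OF gk] S by blast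
    then have big: "infinite (Range g - X) \<or> n \<le> card (Range g - X)"
      using S card_mono by blast
    have "card (X \<inter> Range g) \<le> card (X \<inter> Range h) + card ({..<k} \<inter> Range g - Range h)"
    proof -
      have "X \<inter> Range g \<subseteq> (X \<inter> Range h) \<union> ({..<k} \<inter> Range g - Range h)"
        using k2 by (auto simp: k_def)
      then have "card (X \<inter> Range g) \<le> card ((X \<inter> Range h) \<union> ({..<k} \<inter> Range g - Range h))"
        using X by (intro card_mono) auto
      then show ?thesis using card_Un_le le_trans by blast
    qed
    then have "enat (card (X \<inter> Range g)) \<le> enat (card (X \<inter> Range h)) + enat (card ({..<k} \<inter> Range g - Range h))"
      by simp
    also have "\<dots> \<le> enat (card (X \<inter> Range h)) + f (rank h)"
      using g by (intro add_left_mono) (simp add: nbhd_def)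
    also note gap
    finally show ?thesis using big gI by (auto simp: U_set_def)
  qed
  then show ?thesis by blast
qed

lemma openin_topology_f_I2: "openin topology_I2 V \<Longrightarrow> openin (topology_f f) V"
  unfolding topology_f_def by (rule topology_generated_by_Basis) blast

lemma openin_topology_f_U_set: "finite X \<Longrightarrow> openin (topology_f f) (U_set f n X)"
  unfolding topology_f_def by (rule topology_generated_by_Basis) blast

text \<open>With \<open>X\<close> the points below \<open>k\<close> that \<open>h\<close> misses,
  the count in \<open>U_set\<close> is zero at \<open>h\<close> and is the number of new points at
  any other \<open>g\<close>. The index \<open>n\<close> must not exceed the rank and must give a
  bound no larger than that of \<open>h\<close>: the rank itself if it is finite, a zero of
  \<open>f\<close> otherwise. For constant \<open>\<infinity>\<close> there is no bound to
  enforce.\<close>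

lemma nbhd_contains_open:
  assumes f: "waning f" and hI: "h \<in> \<I>"
  shows "\<exists>W. openin (topology_f f) W \<and> h \<in> W \<and> W \<subseteq> nbhd f h k"
proof -
  have opA: "openin (topology_f f) (agree h k)"
    using openin_agree[OF openin_I2_pair openin_I2_dom hI topspace_topology_I2] openin_topology_f_I2 by blast
  let ?X = "{..<k} - Range h"
  have *: ?thesis if n: "enat n \<le> rank h" "f (enat n) \<le> f (rank h)" for n
  proof -
    have "h \<in> U_set f n ?X"
    proof -
      have "Range h - ?X = Range h" by blast
      moreover have "?X \<inter> Range h = {}" by blast
      ultimately show ?thesis using n hI by (auto simp: U_set_def rank_def simp flip: zero_enat_def split: if_splits)
    qed
    moreover have "agree h k \<inter> U_set f n ?X \<subseteq> nbhd f h k"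
    proof
      fix g assume g: "g \<in> agree h k \<inter> U_set f n ?X"
      moreover have "?X \<inter> Range g = {..<k} \<inter> Range g - Range h" by blast
      ultimately show "g \<in> nbhd f h k"
        using n by (auto simp: nbhd_def U_set_def)
    qed
    ultimately show ?thesis
      using opA openin_topology_f_U_set[of ?X f n] agree_refl[OF hI]
      by (intro exI[of _ "agree h k \<inter> U_set f n ?X"]) auto
  qed
  show ?thesis
  proof (cases "rank h")
    case (enat r)
    then show ?thesis using *[of r] by simp
  next
    case infinity
    consider "f = (\<lambda>_. \<infinity>)" | n where "f (enat n) = 0" using waning_infinity[OF f] by blast
    then show ?thesis
    proof cases
      case 1
      then have "nbhd f h k = agree h k" by (simp add: nbhd_def)
      then show ?thesis using opA agree_refl[OF hI] by auto
    next
      case (2 n)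
      then show ?thesis using *[of n] infinity by simp
    qed
  qed
qed

lemma openin_topology_f:
  assumes f: "waning f"
  shows "openin (topology_f f) V \<longleftrightarrow> V \<subseteq> \<I> \<and> (\<forall>h\<in>V. \<exists>k. nbhd f h k \<subseteq> V)"
proof (intro iffI conjI ballI)
  assume V: "openin (topology_f f) V"
  then show "V \<subseteq> \<I>" using openin_subset topspace_topology_f by blast
  fix h assume h: "h \<in> V"
  show "\<exists>k. nbhd f h k \<subseteq> V"
  proof (rule openin_topology_generated_by_imp[OF V[unfolded topology_f_def] _ _ h])
    fix W and h :: "(nat \<times> nat) set"
    assume W: "W \<in> {U. openin topology_I2 U} \<union> {U_set f n X |n X. finite X}" "h \<in> W"
    then consider "openin topology_I2 W" | n X where "W = U_set f n X" "finite X" by blast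
    then show "\<exists>k. nbhd f h k \<subseteq> W"
    proof cases
      case 1
      then obtain k where "agree h k \<subseteq> W" using W(2) unfolding openin_I2_iff by blast
      then show ?thesis using nbhd_subset_agree by blast
    next
      case 2
      then show ?thesis using nbhd_U_set[OF f] W(2) by blast
    qed
  qed (rule nbhd_antimono)
next
  assume V: "V \<subseteq> \<I> \<and> (\<forall>h\<in>V. \<exists>k. nbhd f h k \<subseteq> V)"
  have "\<exists>W. openin (topology_f f) W \<and> h \<in> W \<and> W \<subseteq> V" if h: "h \<in> V" for h
    using V h nbhd_contains_open[OF f, of h] by (meson order_trans subsetD)
  then show "openin (topology_f f) V" using openin_subopen[of "topology_f f" V] by metis
qed

section \<open>The topologies \<open>\<T>\<^sub>f\<close> are distinct Polish semigroup topologies\<close>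

lemma semigroup_topology_iff:
  "semigroup_topology T \<longleftrightarrow> topspace T = \<I> \<and>
    (\<forall>U f g. openin T U \<longrightarrow> f \<in> \<I> \<longrightarrow> g \<in> \<I> \<longrightarrow> f O g \<in> U \<longrightarrow>
      (\<exists>A B. openin T A \<and> openin T B \<and> f \<in> A \<and> g \<in> B \<and> (\<forall>a\<in>A. \<forall>b\<in>B. a O b \<in> U)))"
  (is "_ \<longleftrightarrow> _ \<and> ?R")
proof -
  have "continuous_map (prod_topology T T) T (\<lambda>(f, g). f O g) \<longleftrightarrow> ?R" if T: "topspace T = \<I>"
  proof
    assume L: "continuous_map (prod_topology T T) T (\<lambda>(f, g). f O g)"
    show ?R
    proof (intro allI impI)
      fix U f g assume *: "openin T U" "f \<in> \<I>" "g \<in> \<I>" "f O g \<in> U"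
      have "openin (prod_topology T T) {p \<in> topspace (prod_topology T T). (\<lambda>(f, g). f O g) p \<in> U}"
        using L *(1) openin_continuous_map_preimage by blast
      moreover have "(f, g) \<in> {p \<in> topspace (prod_topology T T). (\<lambda>(f, g). f O g) p \<in> U}"
        using * T by simp
      ultimately obtain A B where "openin T A" "openin T B" "f \<in> A" "g \<in> B"
          "A \<times> B \<subseteq> {p \<in> topspace (prod_topology T T). (\<lambda>(f, g). f O g) p \<in> U}"
        unfolding openin_prod_topology_alt by meson
      moreover from this(5) have "\<forall>a\<in>A. \<forall>b\<in>B. a O b \<in> U" by auto
      ultimately show "\<exists>A B. openin T A \<and> openin T B \<and> f \<in> A \<and> g \<in> B \<and> (\<forall>a\<in>A. \<forall>b\<in>B. a O b \<in> U)"
        by meson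
    qed
  next
    assume R: ?R
    show "continuous_map (prod_topology T T) T (\<lambda>(f, g). f O g)"
      unfolding continuous_map_def
    proof (intro conjI allI impI)
      show "(\<lambda>(f, g). f O g) \<in> topspace (prod_topology T T) \<rightarrow> topspace T"
        using T sim_comp by auto
      fix U assume U: "openin T U"
      show "openin (prod_topology T T) {p \<in> topspace (prod_topology T T). (\<lambda>(f, g). f O g) p \<in> U}"
        unfolding openin_prod_topology_alt
      proof (intro allI impI)
        fix f g assume "(f, g) \<in> {p \<in> topspace (prod_topology T T). (\<lambda>(f, g). f O g) p \<in> U}"
        then have "f \<in> \<I>" "g \<in> \<I>" "f O g \<in> U" using T by auto
        then obtain A B where "openin T A" "openin T B" "f \<in> A" "g \<in> B" "\<forall>a\<in>A. \<forall>b\<in>B. a O b \<in> U"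
          using R U by meson
        moreover from this have "A \<subseteq> topspace T" "B \<subseteq> topspace T" by (simp_all add: openin_subset)
        moreover from calculation have "A \<times> B \<subseteq> {p \<in> topspace (prod_topology T T). (\<lambda>(f, g). f O g) p \<in> U}"
          by auto
        ultimately show "\<exists>A B. openin T A \<and> openin T B \<and> f \<in> A \<and> g \<in> B \<and>
            A \<times> B \<subseteq> {p \<in> topspace (prod_topology T T). (\<lambda>(f, g). f O g) p \<in> U}"
          by meson
      qed
    qed
  qed
  then show ?thesis unfolding semigroup_topology_def by (intro conj_cong refl)
qed

section \<open>Joint continuity of multiplication\<close>

lemma card_Image_sim:
  assumes "k \<in> \<I>" "finite A" shows "finite (k `` A)" "card (k `` A) \<le> card A"
proof -
  have eq: "k `` A = (\<lambda>x. THE y. (x, y) \<in> k) ` (A \<inter> Domain k)"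
  proof (intro equalityI subsetI)
    fix y assume "y \<in> k `` A"
    then obtain x where x: "x \<in> A" "(x, y) \<in> k" by blast
    then have "(THE y. (x, y) \<in> k) = y" using simD1[OF assms(1)] by blast
    then show "y \<in> (\<lambda>x. THE y. (x, y) \<in> k) ` (A \<inter> Domain k)" using x by blast
  next
    fix y assume "y \<in> (\<lambda>x. THE y. (x, y) \<in> k) ` (A \<inter> Domain k)"
    then obtain x where x: "x \<in> A" "x \<in> Domain k" "y = (THE y. (x, y) \<in> k)" by blast
    then obtain z where z: "(x, z) \<in> k" by blast
    then have "y = z" using x simD1[OF assms(1)] by blast
    then show "y \<in> k `` A" using x z by blast
  qed
  show "finite (k `` A)" using assms(2) eq by simp
  have "card (k `` A) \<le> card (A \<inter> Domain k)" unfolding eq using assms(2) by (intro card_image_le) simp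
  also have "\<dots> \<le> card A" using assms(2) by (intro card_mono) auto
  finally show "card (k `` A) \<le> card A" .
qed

lemma rank_comp_le:
  assumes "k \<in> \<I>" shows "rank (h O k) \<le> rank h"
proof -
  have "Range (h O k) = k `` Range h" by blast
  then show ?thesis using card_Image_sim[OF assms, of "Range h"] by (auto simp: rank_def)
qed

text \<open>If \<open>f (rank k) = 0\<close>, a nearby \<open>k'\<close> hits no new points below
  \<open>n\<close>, so a new point of the product comes through \<open>k\<close> from a new point of
  \<open>h'\<close>, and rank cannot grow under composition. Otherwise a new point of the product is
  either in \<open>Range k\<close> but lost in \<open>h O k\<close>, or new for \<open>k'\<close>;
  the drop of rank from \<open>k\<close> to \<open>h O k\<close> raises the bound by at least the
  number of lost points.\<close>

lemma nbhd_comp: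
  assumes f: "waning f" and h: "h \<in> \<I>" and k: "k \<in> \<I>"
  shows "\<exists>n. \<forall>h'\<in>nbhd f h n. \<forall>k'\<in>nbhd f k n. h' O k' \<in> nbhd f (h O k) m"
proof -
  \<comment> \<open>Below \<open>n\<close> lie all relevant intermediate points: the values of
    \<open>h\<close> at points below \<open>m\<close> and the preimages under \<open>k\<close> of
    points below \<open>m\<close>.\<close>
  have "finite (h `` {..<m} \<union> k\<inverse> `` {..<m} \<union> {..<m})"
    using card_Image_sim[OF h] finite_preimage_sim[OF k] by simp
  then obtain n where n: "h `` {..<m} \<union> k\<inverse> `` {..<m} \<union> {..<m} \<subseteq> {..<n}"
    using finite_nat_iff_bounded by metis
  have mn: "m \<le> n" using n by (metis Un_subset_iff lessThan_subset_iff)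
  have "h' O k' \<in> nbhd f (h O k) m" if h': "h' \<in> nbhd f h n" and k': "k' \<in> nbhd f k n" for h' k'
  proof -
    have ah: "h' \<in> agree h n" and ak: "k' \<in> agree k n" using h' k' by (auto simp: nbhd_def)
    have I: "h' \<in> \<I>" "k' \<in> \<I>" using ah ak by (auto simp: agree_def)
    have "h' O k' \<in> agree (h O k) m"
    proof (rule agreeI)
      fix x y assume x: "x < m"
      have "(x, z) \<in> h' \<longleftrightarrow> (x, z) \<in> h" for z using agree_iff[OF ah] x mn by simp
      moreover have "(z, y) \<in> k' \<longleftrightarrow> (z, y) \<in> k" if "(x, z) \<in> h" for z
        using agree_iff[OF ak] that x n by blast
      ultimately show "(x, y) \<in> h' O k' \<longleftrightarrow> (x, y) \<in> h O k" by blast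
    qed (use I sim_comp in blast)
    moreover
    let ?E = "{..<m} \<inter> Range (h' O k') - Range (h O k)"
    have "enat (card ?E) \<le> f (rank (h O k))"
    proof (cases "f (rank k) = 0")
      case True
      let ?F = "{..<n} \<inter> Range h' - Range h"
      have "enat (card ({..<n} \<inter> Range k' - Range k)) = 0"
        using k' True by (simp add: nbhd_def)
      then have "{..<n} \<inter> Range k' - Range k = {}" by (simp add: zero_enat_def)
      then have sub: "{..<n} \<inter> Range k' \<subseteq> Range k" by blast
      have "?E \<subseteq> k `` ?F"
      proof
        fix y assume y: "y \<in> ?E"
        then obtain x z where xz: "(x, z) \<in> h'" "(z, y) \<in> k'" by blast
        have "y \<in> Range k" using y sub mn xz by auto
        then obtain w where w: "(w, y) \<in> k" by blast
        then have wn: "w < n" using y n by blast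
        then have "w = z" using agree_iff[OF ak wn] w xz(2) simD2[OF I(2)] by blast
        then show "y \<in> k `` ?F" using w wn xz y by blast
      qed
      then have "card ?E \<le> card ?F"
        using card_Image_sim[OF k, of ?F] card_mono[of "k `` ?F" ?E] by (meson finite_Diff finite_Int finite_lessThan le_trans)
      then have "enat (card ?E) \<le> enat (card ?F)" by simp
      also have "\<dots> \<le> f (rank h)" using h' by (simp add: nbhd_def)
      also have "\<dots> \<le> f (rank (h O k))" using waning_antimono[OF f rank_comp_le[OF k]] .
      finally show ?thesis .
    next
      case False
      show ?thesis
      proof (cases "f = (\<lambda>_. \<infinity>)")
        case fin: False
        then have "rank k \<noteq> \<infinity>" using waning_infinity[OF f] False by metis
        then have fk: "finite (Range k)" and rk: "rank k = enat (card (Range k))"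
          by (auto simp: rank_def split: if_splits)
        have sub: "Range (h O k) \<subseteq> Range k" by blast
        then have fhk: "finite (Range (h O k))" using fk finite_subset by blast
        have c: "card (Range k - Range (h O k)) = card (Range k) - card (Range (h O k))"
          using card_Diff_subset fhk sub by blast
        have "card (Range (h O k)) \<le> card (Range k)" using card_mono fk sub by blast
        then have gap: "enat (card (Range k - Range (h O k))) + f (rank k) \<le> f (rank (h O k))"
          using waning_gap[OF f, of "card (Range (h O k))" "card (Range k - Range (h O k))" "rank k"] False rk c fhk
          by (simp add: rank_def)
        have "?E \<subseteq> (Range k - Range (h O k)) \<union> ({..<n} \<inter> Range k' - Range k)"
          using mn by auto
        then have "card ?E \<le> card ((Range k - Range (h O k)) \<union> ({..<n} \<inter> Range k' - Range k))"
          using fk by (intro card_mono) auto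
        also have "\<dots> \<le> card (Range k - Range (h O k)) + card ({..<n} \<inter> Range k' - Range k)"
          by (rule card_Un_le)
        finally have "enat (card ?E) \<le> enat (card (Range k - Range (h O k))) + enat (card ({..<n} \<inter> Range k' - Range k))"
          by simp
        also have "\<dots> \<le> enat (card (Range k - Range (h O k))) + f (rank k)"
          using k' by (intro add_left_mono) (simp add: nbhd_def)
        finally show ?thesis using gap by order
      qed simp
    qed
    ultimately show ?thesis by (simp add: nbhd_def)
  qed
  then show ?thesis by blast
qed

lemma semigroup_topology_f:
  assumes f: "waning f" shows "semigroup_topology (topology_f f)"
  unfolding semigroup_topology_iff
proof (intro conjI allI impI)
  show "topspace (topology_f f) = \<I>" by (rule topspace_topology_f)
  fix U h k assume U: "openin (topology_f f) U" and h: "h \<in> \<I>" and k: "k \<in> \<I>" and hk: "h O k \<in> U"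
  obtain m where "nbhd f (h O k) m \<subseteq> U" using U hk openin_topology_f[OF f] by blast
  then obtain n where n: "\<forall>h'\<in>nbhd f h n. \<forall>k'\<in>nbhd f k n. h' O k' \<in> U"
    using nbhd_comp[OF f h k] by blast
  then show "\<exists>A B. openin (topology_f f) A \<and> openin (topology_f f) B \<and> h \<in> A \<and> k \<in> B \<and> (\<forall>a\<in>A. \<forall>b\<in>B. a O b \<in> U)"
    using nbhd_contains_open[OF f h, of n] nbhd_contains_open[OF f k, of n] by (meson subsetD)
qed

section \<open>A closed embedding into a product of discrete spaces\<close>

definition cut :: "(nat \<times> nat) set \<Rightarrow> nat \<Rightarrow> (nat \<times> nat) set"
  where "cut g k = {(x, y) \<in> g. x < k}"

lemma cut_subset: "cut g k \<subseteq> g"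
  by (auto simp: cut_def)

lemma cut_mono: "k \<le> k' \<Longrightarrow> cut g k \<subseteq> cut g k'"
  by (auto simp: cut_def)

lemma cut_agree: "g \<in> agree h k \<Longrightarrow> j \<le> k \<Longrightarrow> cut g j = cut h j"
  by (auto simp: cut_def agree_def)

lemma finite_cut: "g \<in> \<I> \<Longrightarrow> finite (Range (cut g k))"
proof -
  assume "g \<in> \<I>"
  moreover have "Range (cut g k) = g `` {..<k}" by (auto simp: cut_def)
  ultimately show ?thesis using card_Image_sim(1)[of g "{..<k}"] by simp
qed

lemma Range_cut_ex:
  assumes "finite S" "S \<subseteq> Range g" shows "\<exists>k. \<forall>j\<ge>k. S \<subseteq> Range (cut g j)"
proof -
  have "\<forall>y\<in>S. \<exists>x. (x, y) \<in> g" using assms by blast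
  then obtain p where p: "\<And>y. y \<in> S \<Longrightarrow> (p y, y) \<in> g" by metis
  obtain k where k: "p ` S \<subseteq> {..<k}" using assms(1) finite_nat_iff_bounded by blast
  have "S \<subseteq> Range (cut g j)" if "j \<ge> k" for j
  proof
    fix y assume y: "y \<in> S"
    then have "p y < j" using k that by fastforce
    then show "y \<in> Range (cut g j)" using p[OF y] by (auto simp: cut_def)
  qed
  then show ?thesis by blast
qed

definition overfull :: "(enat \<Rightarrow> enat) \<Rightarrow> nat \<Rightarrow> (nat \<times> nat) set \<Rightarrow> (nat \<times> nat) set \<Rightarrow> bool"
  where "overfull f l p q \<longleftrightarrow> \<not> enat (card ({..<l} \<inter> Range q - Range p)) \<le> f (rank p)"

text \<open>
  The bound on image points below \<open>l\<close> survives limits in \<open>\<I>\<^sub>2\<close>, its violation need not. Coding the set of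
  stages at which a violation is visible prevents violations from escaping to infinity, so that the
  image of the coding is closed.
\<close>
definition code :: "(enat \<Rightarrow> enat) \<Rightarrow> (nat \<times> nat) set \<Rightarrow> nat \<times> nat \<Rightarrow> (nat \<times> nat) set \<times> nat set"
  where "code f g = (\<lambda>(k, l). (cut g k, {u. overfull f l (cut g k) (cut g u)}))"

lemma overfull_mono: "q \<subseteq> q' \<Longrightarrow> overfull f l p q \<Longrightarrow> overfull f l p q'"
proof -
  assume "q \<subseteq> q'"
  then have "card ({..<l} \<inter> Range q - Range p) \<le> card ({..<l} \<inter> Range q' - Range p)"
    by (intro card_mono) auto
  then show "overfull f l p q \<Longrightarrow> overfull f l p q'"
    unfolding overfull_def by (meson enat_ord_simps(1) order_trans)
qed

text \<open>Only finitely many image points lie below \<open>l\<close>, so a single cut of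
  \<open>g\<close> already shows them all.\<close>

lemma not_overfull_iff: "(\<forall>u. \<not> overfull f l p (cut g u)) \<longleftrightarrow> \<not> overfull f l p g"
proof
  assume *: "\<forall>u. \<not> overfull f l p (cut g u)"
  obtain k where k: "{..<l} \<inter> Range g \<subseteq> Range (cut g k)"
    using Range_cut_ex[of "{..<l} \<inter> Range g" g] by auto
  then have "{..<l} \<inter> Range g = {..<l} \<inter> Range (cut g k)"
    using cut_subset[of g k] by auto
  then show "\<not> overfull f l p g" using * unfolding overfull_def by metis
qed (use overfull_mono cut_subset in blast)

text \<open>A violation seen in \<open>h\<close> at stage \<open>u\<close> is seen in
  \<open>g\<close> at the same stage, because both agree up to there, and monotonicity settles the
  later stages. If none is seen, \<open>g\<close> cannot violate the bound either: the image points
  of \<open>h\<close> outside its cut are paid for by \<open>waning_gap\<close>, and the further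
  ones are bounded by \<open>nbhd\<close>.\<close>

lemma code_nbhd:
  assumes f: "waning f" and h: "h \<in> \<I>"
  shows "\<exists>m. \<forall>g\<in>nbhd f h m. code f g (k, l) = code f h (k, l)"
proof (cases "\<exists>u. overfull f l (cut h k) (cut h u)")
  case True
  then obtain u where u: "overfull f l (cut h k) (cut h u)" by blast
  have "code f g (k, l) = code f h (k, l)" if "g \<in> nbhd f h (max k u)" for g
  proof -
    have g: "g \<in> agree h (max k u)" using that by (simp add: nbhd_def)
    have c: "cut g j = cut h j" if "j \<le> max k u" for j using cut_agree[OF g that] .
    have "overfull f l (cut h k) (cut g v) \<longleftrightarrow> overfull f l (cut h k) (cut h v)" for v
    proof (cases "v \<le> u")
      case False
      then have "overfull f l (cut h k) (cut h v)" "overfull f l (cut h k) (cut g v)"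
        using overfull_mono[OF cut_mono[of u v] u] overfull_mono[OF cut_mono[of u v g], of f l "cut h k"] u c[of u] by auto
      then show ?thesis by simp
    qed (use c in simp)
    then show ?thesis using c[of k] by (simp add: code_def)
  qed
  then show ?thesis by blast
next
  case False
  define p where "p = cut h k"
  have nb: "\<not> overfull f l p h" using False not_overfull_iff p_def by blast
  have "code f g (k, l) = code f h (k, l)" if g: "g \<in> nbhd f h (max k l)" for g
  proof -
    have c: "cut g k = p" using g by (auto simp: nbhd_def p_def intro!: cut_agree)
    let ?A = "{..<l} \<inter> Range h - Range p" and ?B = "{..<max k l} \<inter> Range g - Range h"
    have fin: "finite (Range p)" using finite_cut[OF h] by (simp add: p_def)
    have "card (Range p \<union> ?A) = card (Range p) + card ?A"
      using fin by (intro card_Un_disjoint) auto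
    moreover have "Range p \<subseteq> Range h" using cut_subset[of h k] by (auto simp: p_def)
    ultimately have "enat (card (Range p) + card ?A) \<le> rank h"
      using card_le_rank[of "Range p \<union> ?A" h] fin by auto
    then have "f (rank h) = 0 \<or> enat (card ?A) + f (rank h) \<le> f (rank p)"
      using waning_gap[OF f, of "card (Range p)" "card ?A" "rank h"] fin by (simp add: rank_def)
    then have gap: "enat (card ?A) + f (rank h) \<le> f (rank p)"
      using nb by (auto simp: overfull_def)
    have "{..<l} \<inter> Range g - Range p \<subseteq> ?A \<union> ?B" by auto
    then have "card ({..<l} \<inter> Range g - Range p) \<le> card (?A \<union> ?B)" by (intro card_mono) auto
    also have "\<dots> \<le> card ?A + card ?B" by (rule card_Un_le)
    finally have "enat (card ({..<l} \<inter> Range g - Range p)) \<le> enat (card ?A) + enat (card ?B)" by simp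
    also have "\<dots> \<le> enat (card ?A) + f (rank h)" using g by (intro add_left_mono) (simp add: nbhd_def)
    also note gap
    finally have "\<not> overfull f l p g" by (simp add: overfull_def)
    then have "\<not> overfull f l p (cut g u)" for u using not_overfull_iff by blast
    then show ?thesis using False c by (simp add: code_def p_def)
  qed
  then show ?thesis by blast
qed

text \<open>One coordinate suffices: the cut of \<open>h\<close> is taken so long that it shows all
  image points of \<open>h\<close> below \<open>m\<close> and that its bound is no larger than that
  of \<open>h\<close>. The finite set \<open>S\<close> guarantees the latter; at infinite rank and
  for nonconstant \<open>f\<close> it consists of \<open>n\<close> points with
  \<open>f (enat n) = 0\<close>.\<close>

lemma nbhd_code:
  assumes f: "waning f" and h: "h \<in> \<I>"
  shows "\<exists>k l. \<forall>g\<in>\<I>. code f g (k, l) = code f h (k, l) \<longrightarrow> g \<in> nbhd f h m"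
proof -
  have "\<exists>S. finite S \<and> S \<subseteq> Range h \<and> (\<forall>p. p \<subseteq> h \<longrightarrow> S \<subseteq> Range p \<longrightarrow> f (rank p) \<le> f (rank h))"
  proof (cases "finite (Range h)")
    case True
    have "rank p = rank h" if "p \<subseteq> h" "Range h \<subseteq> Range p" for p
    proof -
      have "Range p = Range h" using Range_mono[OF that(1)] that(2) by (rule subset_antisym)
      then show ?thesis by (simp add: rank_def)
    qed
    then have "\<forall>p. p \<subseteq> h \<longrightarrow> Range h \<subseteq> Range p \<longrightarrow> f (rank p) \<le> f (rank h)"
      by (intro allI impI eq_refl arg_cong[of _ _ f])
    then have "finite (Range h) \<and> Range h \<subseteq> Range h \<and> (\<forall>p. p \<subseteq> h \<longrightarrow> Range h \<subseteq> Range p \<longrightarrow> f (rank p) \<le> f (rank h))"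
      using True by simp
    then show ?thesis by (rule exI)
  next
    case False
    then have inf: "rank h = \<infinity>" by (simp add: rank_def)
    show ?thesis
    proof (cases "f = (\<lambda>_. \<infinity>)")
      case True
      then show ?thesis by (intro exI[of _ "{}"]) auto
    next
      case nc: False
      then obtain n where n: "f (enat n) = 0" using waning_infinity[OF f] by blast
      obtain S where S: "finite S" "card S = n" "S \<subseteq> Range h"
        using False infinite_arbitrarily_large by blast
      have "f (rank p) \<le> f (rank h)" if "S \<subseteq> Range p" for p
        using waning_antimono[OF f card_le_rank[OF that S(1)]] S n by simp
      then show ?thesis using S by blast
    qed
  qed
  then obtain S where S: "finite S" "S \<subseteq> Range h" "\<And>p. p \<subseteq> h \<Longrightarrow> S \<subseteq> Range p \<Longrightarrow> f (rank p) \<le> f (rank h)"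
    by blast
  obtain k0 where k0: "\<And>j. j \<ge> k0 \<Longrightarrow> S \<union> ({..<m} \<inter> Range h) \<subseteq> Range (cut h j)"
    using Range_cut_ex[of "S \<union> ({..<m} \<inter> Range h)" h] S by auto
  define k where "k = max k0 m"
  have sub: "S \<union> ({..<m} \<inter> Range h) \<subseteq> Range (cut h k)" using k0 by (simp add: k_def)
  have "{..<m} \<inter> Range h - Range (cut h k) = {}" using sub by blast
  then have "\<not> overfull f m (cut h k) h" by (simp only: overfull_def card.empty zero_enat_def[symmetric] zero_le not_not)
  then have nb: "\<not> overfull f m (cut h k) (cut h u)" for u using not_overfull_iff by blast
  have "g \<in> nbhd f h m" if g: "g \<in> \<I>" and eq: "code f g (k, m) = code f h (k, m)" for g
  proof -
    have c: "cut g k = cut h k" and "\<not> overfull f m (cut h k) (cut g u)" for u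
      using eq nb by (auto simp: code_def)
    then have ngb: "\<not> overfull f m (cut h k) g" using not_overfull_iff by blast
    have "g \<in> agree h k"
    proof (rule agreeI[OF g])
      fix x y assume "x < k"
      moreover have "(x, y) \<in> cut g k \<longleftrightarrow> (x, y) \<in> cut h k" using c by simp
      ultimately show "(x, y) \<in> g \<longleftrightarrow> (x, y) \<in> h" by (simp add: cut_def)
    qed
    then have "g \<in> agree h m" using agree_antimono[of m k h] by (auto simp: k_def)
    moreover have "card ({..<m} \<inter> Range g - Range h) \<le> card ({..<m} \<inter> Range g - Range (cut h k))"
      using cut_subset[of h k] by (intro card_mono) auto
    then have "enat (card ({..<m} \<inter> Range g - Range h)) \<le> f (rank (cut h k))"
      using ngb unfolding overfull_def by (meson enat_ord_simps(1) order_trans)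
    then have "enat (card ({..<m} \<inter> Range g - Range h)) \<le> f (rank h)"
      using S(3)[OF cut_subset[of h k]] sub by (meson Un_subset_iff order_trans)
    ultimately show ?thesis by (simp add: nbhd_def)
  qed
  then show ?thesis by blast
qed

abbreviation code_space :: "(nat \<times> nat \<Rightarrow> (nat \<times> nat) set \<times> nat set) topology"
  where "code_space \<equiv> product_topology (\<lambda>_. discrete_topology UNIV) UNIV"

lemma openin_code_space_cylinder:
  assumes "finite J" shows "openin code_space {G. \<forall>j\<in>J. G j = F j}"
  using assms
proof (induction J)
  case empty
  have "openin code_space (topspace code_space)" by blast
  then show ?case by simp
next
  case (insert j J)
  have "openin code_space {G \<in> topspace code_space. G j \<in> {F j}}"
    by (rule openin_continuous_map_preimage[OF continuous_map_product_coordinates]) auto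
  then have "openin code_space {G. G j = F j}" by simp
  then have "openin code_space ({G. G j = F j} \<inter> {G. \<forall>j\<in>J. G j = F j})"
    using insert by blast
  moreover have "{G. G j = F j} \<inter> {G. \<forall>j\<in>J. G j = F j} = {G. \<forall>j\<in>insert j J. G j = F j}" by auto
  ultimately show ?case by simp
qed

text \<open>A limit \<open>F\<close> of codes agrees with a genuine code on any finite set of
  coordinates, and each requirement on \<open>F\<close> (consistent cuts, injectivity, correct sets
  of stages) involves at most two coordinates.\<close>

lemma closedin_code_image: "closedin code_space (code f ` \<I>)"
proof -
  have "F \<in> code f ` \<I>" if F: "F \<in> code_space closure_of (code f ` \<I>)" for F
  proof -
    have ap: "\<exists>g\<in>\<I>. \<forall>j\<in>J. code f g j = F j" if J: "finite J" for J
    proof -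
      have "\<exists>g\<in>\<I>. code f g \<in> W" if "F \<in> W" "openin code_space W" for W
      proof -
        have "\<exists>y. y \<in> code f ` \<I> \<and> y \<in> W" using F that unfolding in_closure_of by simp
        then show ?thesis by auto
      qed
      from this[OF _ openin_code_space_cylinder[OF J, of F]]
      obtain g where "g \<in> \<I>" "code f g \<in> {G. \<forall>j\<in>J. G j = F j}" by auto
      then show ?thesis by auto
    qed
    \<comment> \<open>The cut does not depend on the second index, hence the arbitrary
      \<open>0\<close>. In the same way the coordinate \<open>(u, 0)\<close> supplies the cut at
      stage \<open>u\<close> below.\<close>
    define g where "g = (\<Union>k. fst (F (k, 0)))"
    have mem: "(x, y) \<in> fst (F (k, l)) \<longleftrightarrow> x < k \<and> (x, y) \<in> g" for x y k l
    proof
      assume xy: "(x, y) \<in> fst (F (k, l))"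
      obtain g' where g': "g' \<in> \<I>" "\<forall>j\<in>{(k, l), (k, 0)}. code f g' j = F j"
        using ap[of "{(k, l), (k, 0)}"] by auto
      then have "fst (F (k, l)) = cut g' k" "fst (F (k, 0)) = cut g' k"
        by (auto simp: code_def prod_eq_iff)
      then show "x < k \<and> (x, y) \<in> g" using xy by (auto simp: g_def cut_def)
    next
      assume xy: "x < k \<and> (x, y) \<in> g"
      then obtain k' where k': "(x, y) \<in> fst (F (k', 0))" by (auto simp: g_def)
      obtain g' where g': "g' \<in> \<I>" "\<forall>j\<in>{(k, l), (k', 0)}. code f g' j = F j"
        using ap[of "{(k, l), (k', 0)}"] by auto
      then have "fst (F (k, l)) = cut g' k" "fst (F (k', 0)) = cut g' k'"
        by (auto simp: code_def prod_eq_iff)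
      then show "(x, y) \<in> fst (F (k, l))" using xy k' by (auto simp: cut_def)
    qed
    then have fst: "fst (F (k, l)) = cut g k" for k l
      by (auto simp: cut_def)
    have "g \<in> \<I>"
    proof (rule simI)
      fix x y z assume "(x, y) \<in> g" "(x, z) \<in> g"
      then have "(x, y) \<in> fst (F (Suc x, 0))" "(x, z) \<in> fst (F (Suc x, 0))" by (auto simp: mem)
      moreover obtain g' where g': "g' \<in> \<I>" "\<forall>j\<in>{(Suc x, 0)}. code f g' j = F j"
        using ap[of "{(Suc x, 0)}"] by auto
      then have "fst (F (Suc x, 0)) = cut g' (Suc x)" by (auto simp: code_def prod_eq_iff)
      ultimately show "y = z" using simD1[OF g'(1)] by (auto simp: cut_def)
    next
      fix x y z assume xy: "(x, z) \<in> g" "(y, z) \<in> g"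
      define k where "k = Suc (max x y)"
      have "(x, z) \<in> fst (F (k, 0))" "(y, z) \<in> fst (F (k, 0))" using xy by (auto simp: mem k_def)
      moreover obtain g' where g': "g' \<in> \<I>" "\<forall>j\<in>{(k, 0)}. code f g' j = F j"
        using ap[of "{(k, 0)}"] by auto
      then have "fst (F (k, 0)) = cut g' k" by (auto simp: code_def prod_eq_iff)
      ultimately show "x = y" using simD2[OF g'(1)] by (auto simp: cut_def)
    qed
    moreover have "code f g (k, l) = F (k, l)" for k l
    proof -
      have "u \<in> snd (F (k, l)) \<longleftrightarrow> overfull f l (cut g k) (cut g u)" for u
      proof -
        obtain g' where g': "g' \<in> \<I>" "\<forall>j\<in>{(k, l), (u, 0)}. code f g' j = F j"
          using ap[of "{(k, l), (u, 0)}"] by auto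
        then have "fst (F (k, l)) = cut g' k" "fst (F (u, 0)) = cut g' u"
          "snd (F (k, l)) = {u. overfull f l (cut g' k) (cut g' u)}"
          by (auto simp: code_def prod_eq_iff)
        then show ?thesis using fst by simp
      qed
      then show ?thesis using fst[of k l] by (auto simp: code_def prod_eq_iff)
    qed
    then have "code f g = F" by auto
    ultimately show ?thesis by blast
  qed
  then show ?thesis by (subst closure_of_subset_eq[symmetric]) auto
qed

lemma embedding_code:
  assumes f: "waning f" shows "embedding_map (topology_f f) code_space (code f)"
  unfolding embedding_map_def homeomorphic_eq_everything_map
proof -
  let ?Y = "subtopology code_space (code f ` topspace (topology_f f))"
  have cont: "continuous_map (topology_f f) code_space (code f)"
    unfolding continuous_map_componentwise_UNIV
  proof
    fix j :: "nat \<times> nat"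
    obtain k l where j: "j = (k, l)" by fastforce
    show "continuous_map (topology_f f) (discrete_topology UNIV) (\<lambda>g. code f g j)"
      unfolding continuous_map_def j
    proof (intro conjI allI impI)
      fix U :: "((nat \<times> nat) set \<times> nat set) set"
      show "openin (topology_f f) {g \<in> topspace (topology_f f). code f g (k, l) \<in> U}"
        unfolding openin_topology_f[OF f] topspace_topology_f
      proof (intro conjI ballI)
        fix h assume "h \<in> {g \<in> \<I>. code f g (k, l) \<in> U}"
        then have h: "h \<in> \<I>" "code f h (k, l) \<in> U" by auto
        obtain m where "\<forall>g\<in>nbhd f h m. code f g (k, l) = code f h (k, l)"
          using code_nbhd[OF f h(1)] by blast
        then have "nbhd f h m \<subseteq> {g \<in> \<I>. code f g (k, l) \<in> U}"
          using h(2) by (auto simp: nbhd_def dest: agree_sim)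
        then show "\<exists>m. nbhd f h m \<subseteq> {g \<in> \<I>. code f g (k, l) \<in> U}"
          by blast
      qed blast
    qed auto
  qed
  have inj: "inj_on (code f) (topspace (topology_f f))"
  proof (rule inj_onI)
    fix g h assume "code f g = code f h"
    then have "cut g k = cut h k" for k by (metis (mono_tags, lifting) case_prod_conv code_def prod.inject)
    then have "(x, y) \<in> g \<longleftrightarrow> (x, y) \<in> h" for x y
      unfolding cut_def by (smt (verit, best) case_prod_conv lessI mem_Collect_eq)
    then show "g = h" by auto
  qed
  have "open_map (topology_f f) ?Y (code f)"
    unfolding open_map_def
  proof (intro allI impI)
    fix V assume V: "openin (topology_f f) V"
    then have VI: "V \<subseteq> \<I>" using openin_topology_f[OF f] by blast
    have "\<exists>W. openin ?Y W \<and> F \<in> W \<and> W \<subseteq> code f ` V" if "F \<in> code f ` V" for F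
    proof -
      from that obtain h where h: "h \<in> V" "F = code f h" by blast
      obtain m where m: "nbhd f h m \<subseteq> V" using V h openin_topology_f[OF f] by blast
      obtain k l where kl: "\<forall>g\<in>\<I>. code f g (k, l) = code f h (k, l) \<longrightarrow> g \<in> nbhd f h m"
        using nbhd_code[OF f] h VI by blast
      let ?W = "{G. \<forall>j\<in>{(k, l)}. G j = F j} \<inter> code f ` \<I>"
      have "openin ?Y ?W"
        using openin_code_space_cylinder[of "{(k, l)}" F] unfolding topspace_topology_f openin_subtopology by blast
      moreover have "?W \<subseteq> code f ` V" using kl m h by auto
      moreover have "F \<in> ?W" using h VI by auto
      ultimately show ?thesis by blast
    qed
    then show "openin ?Y (code f ` V)" using openin_subopen[of ?Y "code f ` V"] by metis
  qed
  then show "continuous_map (topology_f f) ?Y (code f) \<and> open_map (topology_f f) ?Y (code f) \<and>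
      closed_map (topology_f f) ?Y (code f) \<and> code f ` topspace (topology_f f) = topspace ?Y \<and>
      inj_on (code f) (topspace (topology_f f))"
    using cont inj homeomorphic_eq_everything_map[of "topology_f f" ?Y "code f"]
      bijective_open_imp_homeomorphic_map[of "topology_f f" ?Y "code f"]
    by (simp add: continuous_map_in_subtopology)
qed

lemma completely_metrizable_topology_f:
  assumes f: "waning f" shows "completely_metrizable_space (topology_f f)"
proof -
  have "completely_metrizable_space code_space"
    by (simp add: completely_metrizable_space_product_topology completely_metrizable_space_discrete_topology)
  then have "completely_metrizable_space (subtopology code_space (code f ` \<I>))"
    using completely_metrizable_space_closedin closedin_code_image by blast
  then show ?thesis
    using embedding_map_imp_homeomorphic_space[OF embedding_code[OF f]]
      homeomorphic_completely_metrizable_space topspace_topology_f by metis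
qed

text \<open>A restriction of \<open>h\<close> has no image points outside \<open>Range h\<close>, so
  it satisfies every bound; hence the countably many finite partial bijections are dense.\<close>

lemma separable_topology_f:
  assumes f: "waning f" shows "separable_space (topology_f f)"
proof -
  let ?C = "{g \<in> \<I>. finite g}"
  have "countable {g :: (nat \<times> nat) set. finite g}" by (rule countable_Collect_finite)
  then have "countable ?C" by (rule countable_subset[rotated]) auto
  moreover have "topology_f f closure_of ?C = topspace (topology_f f)"
  proof
    show "topspace (topology_f f) \<subseteq> topology_f f closure_of ?C"
    proof
      fix h assume "h \<in> topspace (topology_f f)"
      then have h: "h \<in> \<I>" by (simp add: topspace_topology_f)
      have "\<exists>g. g \<in> ?C \<and> g \<in> V" if V: "h \<in> V" "openin (topology_f f) V" for V
      proof -
        obtain k where k: "nbhd f h k \<subseteq> V" using V openin_topology_f[OF f] by blast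
        have cI: "cut h k \<in> \<I>" using sim_subset[OF h cut_subset] .
        have "{..<k} \<inter> Range (cut h k) - Range h = {}" using cut_subset[of h k] by auto
        then have "enat (card ({..<k} \<inter> Range (cut h k) - Range h)) \<le> f (rank h)"
          by (simp only: card.empty zero_enat_def[symmetric] zero_le)
        moreover have "cut h k \<in> agree h k" using cI by (intro agreeI) (auto simp: cut_def)
        ultimately have "cut h k \<in> V" using k by (auto simp: nbhd_def)
        moreover have "finite (cut h k)"
        proof (rule finite_subset)
          show "cut h k \<subseteq> {..<k} \<times> Range (cut h k)" by (auto simp: cut_def)
        qed (simp add: finite_cut[OF h])
        ultimately show ?thesis using cI by blast
      qed
      then show "h \<in> topology_f f closure_of ?C"
        unfolding in_closure_of using h by (simp add: topspace_topology_f)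
    qed
  qed (rule closure_of_subset_topspace)
  ultimately show ?thesis unfolding separable_space_def
    by (metis (no_types, lifting) mem_Collect_eq subsetI topspace_topology_f)
qed

text \<open>Since \<open>g (enat n)\<close> is at least \<open>m + 1\<close>, an element of rank
  \<open>n\<close> with image above \<open>m\<close> is approximated in \<open>topology_f g\<close>
  by extensions that hit all of \<open>{..m}\<close>. The set \<open>U_set f n {..m}\<close>
  contains the element but none of these extensions.\<close>

lemma topology_f_noteq:
  assumes f: "waning f" and g: "waning g" and n: "f (enat n) < g (enat n)"
  shows "topology_f f \<noteq> topology_f g"
proof
  assume eq: "topology_f f = topology_f g"
  obtain m where m: "f (enat n) = enat m" using n by (metis enat_ord_simps(6) not_enat_eq)
  define h where "h = (\<lambda>i. (i, m + 1 + i)) ` {..<n}"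
  have hI: "h \<in> \<I>" by (rule simI) (auto simp: h_def)
  have Rh: "Range h = (\<lambda>i. m + 1 + i) ` {..<n}" unfolding h_def Range_snd by force
  have crd: "card (Range h) = n" unfolding Rh by (simp add: card_image inj_on_def)
  have Xh: "{..m} \<inter> Range h = {}" and Rh': "Range h - {..m} = Range h" using Rh by auto
  have "h \<in> U_set f n {..m}"
    using hI Xh Rh' crd by (simp add: U_set_def flip: zero_enat_def)
  moreover have "openin (topology_f g) (U_set f n {..m})"
    using openin_topology_f_U_set[of "{..m}" f n] eq by simp
  ultimately obtain k where k: "nbhd g h k \<subseteq> U_set f n {..m}"
    using openin_topology_f[OF g] by blast
  \<comment> \<open>The new pairs start at \<open>n + k\<close>: beyond the domain
    \<open>{..<n}\<close> of \<open>h\<close>, and not below \<open>k\<close>, so that agreement up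
    to \<open>k\<close> is not disturbed.\<close>
  define h' where "h' = h \<union> (\<lambda>i. (n + k + i, i)) ` {..m}"
  have h'I: "h' \<in> \<I>" by (rule simI) (auto simp: h'_def h_def)
  have Rh'': "Range h' = Range h \<union> {..m}" unfolding h'_def Range_Un_eq unfolding Range_snd by force
  have "h' \<in> agree h k" using h'I by (intro agreeI) (auto simp: h'_def)
  moreover have "enat (card ({..<k} \<inter> Range h' - Range h)) \<le> g (rank h)"
  proof -
    have "card ({..<k} \<inter> Range h' - Range h) \<le> card {..m}"
      using Rh'' by (intro card_mono) auto
    then have "enat (card ({..<k} \<inter> Range h' - Range h)) \<le> enat (Suc m)" by simp
    also have "\<dots> \<le> g (enat n)" using n m by (simp add: Suc_ile_eq)
    also have "enat n = rank h" using crd Rh by (simp add: rank_def)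
    finally show ?thesis .
  qed
  ultimately have "h' \<in> U_set f n {..m}" using k by (auto simp: nbhd_def)
  moreover have "{..m} \<inter> Range h' = {..m}" using Rh'' by auto
  ultimately show False by (simp add: U_set_def m)
qed

text \<open>By \<open>waning_infinity\<close> the value at infinity is determined by the finite
  ones.\<close>

lemma waning_eqI:
  assumes f: "waning f" and g: "waning g" and eq: "\<And>n. f (enat n) = g (enat n)"
  shows "f = g"
proof
  fix e show "f e = g e"
  proof (cases e)
    case infinity
    then show ?thesis
      using waning_infinity[OF f] waning_infinity[OF g] eq by (metis infinity_ne_i0)
  qed (simp add: eq)
qed

lemma topology_f_inj:
  assumes f: "waning f" and g: "waning g" and "f \<noteq> g" shows "topology_f f \<noteq> topology_f g"
proof -
  obtain n where "f (enat n) \<noteq> g (enat n)" using waning_eqI[OF f g] assms(3) by blast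
  then consider "f (enat n) < g (enat n)" | "g (enat n) < f (enat n)" by fastforce
  then show ?thesis using topology_f_noteq[OF f g] topology_f_noteq[OF g f] by cases auto
qed

lemma polish_topology_f: "waning f \<Longrightarrow> polish_semigroup_topology (topology_f f)"
  unfolding polish_semigroup_topology_def
  using semigroup_topology_f separable_topology_f completely_metrizable_topology_f by blast

section \<open>Automatic continuity of the symmetric group\<close>

definition sym_on :: "nat set \<Rightarrow> (nat \<Rightarrow> nat) set"
  where "sym_on D = {p. bij p \<and> (\<forall>x. x \<notin> D \<longrightarrow> p x = x)}"

lemma sym_on_bij: "p \<in> sym_on D \<Longrightarrow> bij p"
  by (simp add: sym_on_def)

lemma sym_on_outside: "p \<in> sym_on D \<Longrightarrow> x \<notin> D \<Longrightarrow> p x = x"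
  by (simp add: sym_on_def)

lemma sym_on_inside:
  assumes "p \<in> sym_on D" "x \<in> D" shows "p x \<in> D"
proof (rule ccontr)
  assume "p x \<notin> D"
  then have "p (p x) = p x" using assms by (simp add: sym_on_def)
  moreover have "inj p" using assms by (simp add: sym_on_def bij_def)
  ultimately have "p x = x" by (rule injD[rotated])
  then show False using \<open>p x \<notin> D\<close> assms by simp
qed

lemma sym_on_inv:
  assumes "p \<in> sym_on D" shows "inv p \<in> sym_on D"
  unfolding sym_on_def
proof (intro CollectI conjI allI impI)
  show "bij (inv p)" using assms sym_on_bij bij_imp_bij_inv by blast
  fix x assume "x \<notin> D"
  then have "p x = x" using assms sym_on_outside by blast
  then show "inv p x = x" using sym_on_bij[OF assms] by (metis bij_inv_eq_iff)
qed

lemma sym_on_comp: "p \<in> sym_on D \<Longrightarrow> q \<in> sym_on D \<Longrightarrow> p \<circ> q \<in> sym_on D"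
  by (auto simp: sym_on_def bij_comp)

lemma sym_onI_inverse:
  assumes "\<And>x. q (p x) = x" "\<And>x. p (q x) = x" "\<And>x. x \<notin> D \<Longrightarrow> p x = x"
  shows "p \<in> sym_on D"
proof -
  have "bij p" by (rule bij_betw_byWitness[where f'=q]) (use assms in auto)
  then show ?thesis using assms by (simp add: sym_on_def)
qed

lemma bij_betw_infinite_nat:
  assumes "infinite (A :: nat set)" "infinite (B :: nat set)" shows "\<exists>h. bij_betw h A B"
  using bij_betw_trans[OF to_nat_on_infinite[of A] bij_betw_from_nat_into[of B]] assms by auto

lemma bij_extend:
  fixes f :: "nat \<Rightarrow> nat"
  assumes "bij_betw f A B" "infinite (- A)" "infinite (- B :: nat set)"
  shows "\<exists>p. bij p \<and> (\<forall>x\<in>A. p x = f x) \<and> p ` A = B"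
proof -
  obtain g where g: "bij_betw g (- A) (- B)" using bij_betw_infinite_nat[OF assms(2,3)] by blast
  define p where "p = (\<lambda>x. if x \<in> A then f x else g x)"
  have "bij_betw p A B" using assms(1) by (subst bij_betw_cong[of _ _ f]) (auto simp: p_def)
  moreover have "bij_betw p (- A) (- B)" using g by (subst bij_betw_cong[of _ _ g]) (auto simp: p_def)
  ultimately have "bij_betw p (A \<union> - A) (B \<union> - B)" by (intro bij_betw_combine) auto
  then have "bij p" by simp
  moreover have "p ` A = B" using \<open>bij_betw p A B\<close> by (simp add: bij_betw_def)
  ultimately show ?thesis by (intro exI[of _ p]) (auto simp: p_def)
qed

lemma infinite_inj:
  assumes "infinite A" shows "\<exists>e :: nat \<Rightarrow> 'a. inj e \<and> range e \<subseteq> A"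
  using infinite_countable_subset[OF assms] by simp

lemma infinite_inj_coinfinite:
  assumes "infinite (Q :: nat set)"
  shows "\<exists>e :: nat \<Rightarrow> nat. inj e \<and> range e \<subseteq> Q \<and> infinite (Q - range e)"
proof -
  obtain e :: "nat \<Rightarrow> nat" where e: "inj e" "range e \<subseteq> Q" using infinite_inj[OF assms] by blast
  have "(\<lambda>n. e (2 * n + 1)) ` UNIV \<subseteq> Q - range (\<lambda>n. e (2 * n))"
  proof (clarify, intro DiffI)
    fix n :: nat
    show "e (2 * n + 1) \<in> Q" using e(2) by blast
    show "e (2 * n + 1) \<notin> range (\<lambda>n. e (2 * n))"
    proof
      assume "e (2 * n + 1) \<in> range (\<lambda>n. e (2 * n))"
      then obtain k where "e (2 * n + 1) = e (2 * k)" by blast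
      then have "2 * n + 1 = 2 * k" using e(1) by (rule injD[rotated])
      then show False by presburger
    qed
  qed
  moreover have "inj (\<lambda>n. e (2 * n + 1))" using e(1) by (auto intro!: injI dest!: injD)
  then have "infinite ((\<lambda>n. e (2 * n + 1)) ` UNIV)" using finite_imageD by blast
  ultimately have "infinite (Q - range (\<lambda>n. e (2 * n)))" using finite_subset by blast
  moreover have "inj (\<lambda>n. e (2 * n))" using e(1) by (auto intro!: injI dest!: injD)
  ultimately show ?thesis using e(2) by (intro exI[of _ "\<lambda>n. e (2 * n)"]) auto
qed

lemma infinite_fibre: "infinite {x. fst (prod_decode x) = i}"
proof -
  have "range (\<lambda>j. prod_encode (i, j)) \<subseteq> {x. fst (prod_decode x) = i}" by auto
  moreover have "inj (\<lambda>j. prod_encode (i, j))" by (rule injI) simp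
  then have "infinite (range (\<lambda>j. prod_encode (i, j)))" using finite_imageD by blast
  ultimately show ?thesis using finite_subset by blast
qed

lemma glue_sym_on:
  assumes "\<And>i. p i \<in> sym_on {x. \<iota> x = i}" shows "bij (\<lambda>x. p (\<iota> x) x)"
proof (rule bij_betw_byWitness[where f'="\<lambda>x. inv (p (\<iota> x)) x"])
  have b: "bij (p i)" for i using assms sym_on_bij by blast
  have i1: "\<iota> (p (\<iota> x) x) = \<iota> x" for x using sym_on_inside[OF assms, of x "\<iota> x"] by simp
  have i2: "\<iota> (inv (p (\<iota> x)) x) = \<iota> x" for x using sym_on_inside[OF sym_on_inv[OF assms], of x "\<iota> x"] by simp
  show "\<forall>x\<in>UNIV. inv (p (\<iota> (p (\<iota> x) x))) (p (\<iota> x) x) = x"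
    using b i1 by (simp add: bij_is_inj)
  show "\<forall>x\<in>UNIV. p (\<iota> (inv (p (\<iota> x)) x)) (inv (p (\<iota> x)) x) = x"
    using b i2 by (simp add: bij_is_surj surj_f_inv_f)
qed auto

text \<open>\<open>d1\<close> collects the points \<open>M\<close> of \<open>D\<close> bound for
  \<open>R\<close> inside \<open>Q\<close>. Then everything bound for \<open>R\<close> lies in
  \<open>D'\<close>, and \<open>d2\<close> puts it in place; what remains moves only points of
  \<open>D\<close>. The infinitely many points of \<open>Q\<close> that \<open>h\<close> sends to
  \<open>D\<close> leave room to complete the partial maps to permutations.\<close>

lemma sym_on_product_aux:
  assumes h: "h \<in> sym_on (D \<union> D')" and inf: "infinite {x \<in> D \<inter> D'. h x \<in> D}"
  shows "\<exists>d1\<in>sym_on D. \<exists>d2\<in>sym_on D'. \<exists>d3\<in>sym_on D. h = d3 \<circ> d2 \<circ> d1"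
proof -
  define R Q M where "R = D' - D" and "Q = D \<inter> D'" and "M = {x \<in> D. h x \<in> R}"
  have bh: "bij h" using h sym_on_bij by blast
  have hDD: "h x \<in> D \<union> D'" if "x \<in> D \<union> D'" for x using sym_on_inside[OF h that] .
  have sub: "{x \<in> D \<inter> D'. h x \<in> D} \<subseteq> D - M" "{x \<in> D \<inter> D'. h x \<in> D} \<subseteq> Q"
    by (auto simp: M_def R_def Q_def)
  have DM: "infinite (D - M)" and Qi: "infinite Q" using inf sub finite_subset by blast+
  \<comment> \<open>An infinite part of \<open>Q\<close> is kept out of the range of
    \<open>e\<close>. It makes both complements infinite, that of the image of \<open>M\<close> in
    \<open>D\<close> and that of \<open>M2\<close> in \<open>D'\<close>.\<close>
  obtain e :: "nat \<Rightarrow> nat" where e: "inj e" "range e \<subseteq> Q" "infinite (Q - range e)"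
    using infinite_inj_coinfinite[OF Qi] by blast
  have "Q - range e \<subseteq> D - e ` M" by (auto simp: Q_def)
  then have "infinite (D - e ` M)" using e(3) finite_subset by blast
  then obtain b where b: "bij_betw b (D - M) (D - e ` M)" using bij_betw_infinite_nat DM by blast
  define d1 where "d1 x = (if x \<in> M then e x else if x \<in> D then b x else x)" for x
  have MD: "M \<subseteq> D" by (auto simp: M_def)
  have eM: "e ` M \<subseteq> D" using e(2) by (auto simp: Q_def)
  have "bij_betw d1 M (e ` M)" using e(1)
    by (subst bij_betw_cong[of _ _ e]) (auto simp: d1_def bij_betw_def inj_on_def inj_def)
  moreover have "bij_betw d1 (D - M) (D - e ` M)"
    using b by (subst bij_betw_cong[of _ _ b]) (auto simp: d1_def)
  moreover have "bij_betw d1 (- D) (- D)"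
    using MD by (subst bij_betw_cong[of _ _ id]) (auto simp: d1_def)
  ultimately have "bij_betw d1 (M \<union> (D - M) \<union> - D) (e ` M \<union> (D - e ` M) \<union> - D)"
    using eM MD by (intro bij_betw_combine) auto
  moreover have "M \<union> (D - M) \<union> - D = UNIV" "e ` M \<union> (D - e ` M) \<union> - D = UNIV" using MD eM by auto
  ultimately have bd1: "bij d1" by simp
  then have d1: "d1 \<in> sym_on D" using MD by (auto simp: sym_on_def d1_def)
  define h' where "h' = h \<circ> inv d1"
  have bh': "bij h'" unfolding h'_def using bh bd1 bij_imp_bij_inv bij_comp by blast
  have h': "h' \<in> sym_on (D \<union> D')"
  proof -
    have "inv d1 \<in> sym_on (D \<union> D')" using sym_on_inv[OF d1] by (simp add: sym_on_def)
    then show ?thesis unfolding h'_def using h sym_on_comp by blast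
  qed
  have notR: "h' x \<in> D" if x: "x \<in> D - e ` M" for x
  proof -
    have y: "inv d1 x \<in> D" using sym_on_inside[OF sym_on_inv[OF d1]] x by blast
    have "inv d1 x \<notin> M"
    proof
      assume *: "inv d1 x \<in> M"
      then have "d1 (inv d1 x) \<in> e ` M" by (simp add: d1_def)
      then show False using x bd1 by (simp add: bij_is_surj surj_f_inv_f)
    qed
    then show ?thesis using y hDD[of "inv d1 x"] by (auto simp: M_def R_def h'_def)
  qed
  define M2 where "M2 = {x \<in> D'. h' x \<in> R}"
  have "Q - range e \<subseteq> D' - M2"
    using notR by (auto simp: M2_def R_def Q_def)
  then have "infinite (D' - M2)" using e(3) finite_subset by blast
  then obtain c where c: "bij_betw c (D' - M2) Q" using bij_betw_infinite_nat Qi by blast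
  have M2R: "h' ` M2 = R"
  proof
    show "R \<subseteq> h' ` M2"
    proof
      fix y assume y: "y \<in> R"
      obtain x where x: "y = h' x" using bh' by (metis bij_pointE)
      have "x \<in> D \<union> D'" using y x sym_on_outside[OF h', of x] unfolding R_def by (metis DiffD1 UnI2)
      moreover have "x \<notin> D - D'"
      proof
        assume "x \<in> D - D'"
        then have "x \<in> D - e ` M" using e(2) by (auto simp: Q_def)
        then show False using notR y x by (auto simp: R_def)
      qed
      ultimately show "y \<in> h' ` M2" using y x by (auto simp: M2_def)
    qed
  qed (auto simp: M2_def)
  define d2 where "d2 x = (if x \<in> M2 then h' x else if x \<in> D' then c x else x)" for x
  have M2D: "M2 \<subseteq> D'" by (auto simp: M2_def)
  have "bij_betw d2 M2 R" using bh' M2R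
    by (subst bij_betw_cong[of _ _ h']) (auto simp: d2_def bij_betw_def inj_on_def inj_def)
  moreover have "bij_betw d2 (D' - M2) Q"
    using c by (subst bij_betw_cong[of _ _ c]) (auto simp: d2_def)
  moreover have "bij_betw d2 (- D') (- D')"
    using M2D by (subst bij_betw_cong[of _ _ id]) (auto simp: d2_def)
  ultimately have "bij_betw d2 (M2 \<union> (D' - M2) \<union> - D') (R \<union> Q \<union> - D')"
    by (intro bij_betw_combine) (auto simp: R_def Q_def)
  moreover have "M2 \<union> (D' - M2) \<union> - D' = UNIV" "R \<union> Q \<union> - D' = UNIV" using M2D by (auto simp: R_def Q_def)
  ultimately have bd2: "bij d2" by simp
  then have d2: "d2 \<in> sym_on D'" using M2D by (auto simp: sym_on_def d2_def)
  define d3 where "d3 = h' \<circ> inv d2"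
  have "d3 x = x" if x: "x \<notin> D" for x
  proof (cases "x \<in> D'")
    case True
    then have "x \<in> R" using x by (simp add: R_def)
    then obtain y where y: "y \<in> M2" "h' y = x" using M2R by blast
    then have "inv d2 x = y" using bd2 by (metis bij_inv_eq_iff d2_def)
    then show ?thesis using y by (simp add: d3_def)
  next
    case False
    then have "inv d2 x = x" using sym_on_outside[OF sym_on_inv[OF d2]] by blast
    then show ?thesis using h' False x by (simp add: d3_def sym_on_outside)
  qed
  moreover have "bij d3" unfolding d3_def using bh' bd2 bij_imp_bij_inv bij_comp by blast
  ultimately have d3: "d3 \<in> sym_on D" by (simp add: sym_on_def)
  have "d3 \<circ> d2 \<circ> d1 = h"
    using bd1 bd2 by (auto simp: d3_def h'_def fun_eq_iff bij_is_inj)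
  then show ?thesis using d1 d2 d3 by blast
qed

text \<open>\<open>h\<close> sends infinitely many points of \<open>D \<inter> D'\<close> to
  \<open>D\<close> or infinitely many to \<open>D'\<close>, and the two cases are symmetric.\<close>

lemma sym_on_product:
  assumes h: "h \<in> sym_on (D \<union> D')" and inf: "infinite (D \<inter> D')"
  shows "\<exists>a\<in>sym_on D \<union> sym_on D'. \<exists>b\<in>sym_on D \<union> sym_on D'. \<exists>c\<in>sym_on D \<union> sym_on D'. h = a \<circ> b \<circ> c"
proof -
  have "D \<inter> D' \<subseteq> {x \<in> D \<inter> D'. h x \<in> D} \<union> {x \<in> D' \<inter> D. h x \<in> D'}"
    using sym_on_inside[OF h] by blast
  then consider "infinite {x \<in> D \<inter> D'. h x \<in> D}" | "infinite {x \<in> D' \<inter> D. h x \<in> D'}"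
    using inf by (meson finite_Un finite_subset)
  then show ?thesis
  proof cases
    case 1
    then show ?thesis using sym_on_product_aux[OF h] by blast
  next
    case 2
    have "h \<in> sym_on (D' \<union> D)" using h by (simp add: Un_commute)
    then show ?thesis using sym_on_product_aux[of h D' D] 2 by blast
  qed
qed

text \<open>These are the branches of the binary tree: \<open>Y a\<close> codes the finite initial
  segments of \<open>a\<close>, and two sequences that differ at \<open>i\<close> share only
  segments of length at most \<open>i\<close>.\<close>

lemma almost_disjoint_family:
  "\<exists>Y :: (nat \<Rightarrow> bool) \<Rightarrow> nat set. (\<forall>a. infinite (Y a)) \<and> (\<forall>a b. a \<noteq> b \<longrightarrow> finite (Y a \<inter> Y b))"
proof -
  define Y where "Y a = range (\<lambda>n. to_nat (map a [0..<n]))" for a :: "nat \<Rightarrow> bool"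
  have "infinite (Y a)" for a
  proof -
    have "inj (\<lambda>n. to_nat (map a [0..<n]))"
    proof (rule injI)
      fix m n assume "to_nat (map a [0..<m]) = to_nat (map a [0..<n])"
      then have "map a [0..<m] = map a [0..<n]" by simp
      then have "length (map a [0..<m]) = length (map a [0..<n])" by metis
      then show "m = n" by simp
    qed
    then show ?thesis unfolding Y_def using finite_imageD by blast
  qed
  moreover have "finite (Y a \<inter> Y b)" if "a \<noteq> b" for a b
  proof -
    from that obtain i where i: "a i \<noteq> b i" by blast
    have "Y a \<inter> Y b \<subseteq> (\<lambda>n. to_nat (map a [0..<n])) ` {..i}"
    proof
      fix x assume "x \<in> Y a \<inter> Y b"
      then obtain m n where mn: "x = to_nat (map a [0..<m])" "x = to_nat (map b [0..<n])"
        unfolding Y_def by blast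
      then have eq: "map a [0..<m] = map b [0..<n]" by simp
      then have "length (map a [0..<m]) = length (map b [0..<n])" by metis
      then have "m = n" by simp
      have "m \<le> i"
      proof (rule ccontr)
        assume "\<not> m \<le> i"
        then have "map a [0..<m] ! i = a i" "map b [0..<n] ! i = b i" using \<open>m = n\<close> by auto
        then show False using eq i by simp
      qed
      then show "x \<in> (\<lambda>n. to_nat (map a [0..<n])) ` {..i}" using mn(1) by blast
    qed
    then show ?thesis using finite_subset by blast
  qed
  ultimately show ?thesis by blast
qed

lemma uncountable_nat_bool: "uncountable (UNIV :: (nat \<Rightarrow> bool) set)"
proof
  assume "countable (UNIV :: (nat \<Rightarrow> bool) set)"
  then obtain e :: "nat \<Rightarrow> nat \<Rightarrow> bool" where "range e = UNIV"
    using uncountable_def by blast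
  then obtain n where "e n = (\<lambda>k. \<not> e k k)" by (metis UNIV_I image_iff)
  then show False by metis
qed

lemma countable_cover_pigeonhole:
  fixes k :: "(nat \<Rightarrow> bool) \<Rightarrow> 'a"
  assumes "countable C" "\<And>a. k a \<in> \<Union>C"
  shows "\<exists>a b c. a \<noteq> b \<and> c \<in> C \<and> k a \<in> c \<and> k b \<in> c"
proof (rule ccontr)
  assume no: "\<not> ?thesis"
  obtain c where c: "\<And>a. c a \<in> C \<and> k a \<in> c a" using assms(2) unfolding Union_iff by metis
  have "inj c" using no c by (metis injI)
  then have "countable (UNIV :: (nat \<Rightarrow> bool) set)"
    using c assms(1) by (metis countable_image_inj_on countable_subset image_subsetI)
  then show False using uncountable_nat_bool by blast
qed

text \<open>
  The sets in \<open>\<E>\<close> play the role of neighbourhoods of the identity for a second countable group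
  topology; \<open>cover\<close> is the only trace of second countability.
\<close>
locale small_symmetric_sets =
  fixes \<E> :: "(nat \<Rightarrow> nat) set set"
  assumes bij: "E \<in> \<E> \<Longrightarrow> p \<in> E \<Longrightarrow> bij p"
    and id: "E \<in> \<E> \<Longrightarrow> id \<in> E"
    and inv: "E \<in> \<E> \<Longrightarrow> p \<in> E \<Longrightarrow> inv p \<in> E"
    and comp: "E \<in> \<E> \<Longrightarrow> \<exists>E'\<in>\<E>. \<forall>p\<in>E'. \<forall>q\<in>E'. p \<circ> q \<in> E"
    and cover: "E \<in> \<E> \<Longrightarrow> \<exists>C :: (nat \<Rightarrow> nat) set set. countable C \<and> (\<forall>p. bij p \<longrightarrow> p \<in> \<Union>C) \<and>
      (\<forall>c\<in>C. \<forall>p\<in>c. bij p) \<and> (\<forall>c\<in>C. \<forall>p\<in>c. \<forall>q\<in>c. q \<circ> inv p \<in> E)"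
begin

lemma comp3:
  assumes "E \<in> \<E>" shows "\<exists>E'\<in>\<E>. E' \<subseteq> E \<and> (\<forall>p\<in>E'. \<forall>q\<in>E'. \<forall>r\<in>E'. p \<circ> q \<circ> r \<in> E)"
proof -
  obtain E1 where E1: "E1 \<in> \<E>" "\<And>p q. p \<in> E1 \<Longrightarrow> q \<in> E1 \<Longrightarrow> p \<circ> q \<in> E" using comp[OF assms] by blast
  obtain E2 where E2: "E2 \<in> \<E>" "\<And>p q. p \<in> E2 \<Longrightarrow> q \<in> E2 \<Longrightarrow> p \<circ> q \<in> E1" using comp[OF E1(1)] by blast
  have 1: "p \<in> E1" if "p \<in> E2" for p using E2(2)[OF that id[OF E2(1)]] by simp
  have 2: "p \<in> E" if "p \<in> E2" for p using E1(2)[OF 1[OF that] id[OF E1(1)]] by simp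
  have 3: "p \<circ> q \<circ> r \<in> E" if "p \<in> E2" "q \<in> E2" "r \<in> E2" for p q r
    using E1(2)[OF E2(2)[OF that(1,2)] 1[OF that(3)]] .
  show ?thesis using E2(1) 2 3 by (intro bexI[of _ E2] conjI subsetI ballI)
qed

lemma coverE:
  assumes "E \<in> \<E>"
  obtains C :: "(nat \<Rightarrow> nat) set set" where "countable C" "\<And>p. bij p \<Longrightarrow> p \<in> \<Union>C" "\<And>c p. c \<in> C \<Longrightarrow> p \<in> c \<Longrightarrow> bij p"
    "\<And>c p q. c \<in> C \<Longrightarrow> p \<in> c \<Longrightarrow> q \<in> c \<Longrightarrow> q \<circ> inv p \<in> E"
proof -
  show ?thesis
  proof (rule exE[OF cover[OF assms]], elim conjE)
    fix C :: "(nat \<Rightarrow> nat) set set"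
    assume C: "countable C" "\<forall>p. bij p \<longrightarrow> p \<in> \<Union>C" "\<forall>c\<in>C. \<forall>p\<in>c. bij p"
      "\<forall>c\<in>C. \<forall>p\<in>c. \<forall>q\<in>c. q \<circ> inv p \<in> E"
    show thesis
    proof (rule that[OF C(1)])
      show "p \<in> \<Union>C" if "bij p" for p using C(2)[rule_format, OF that] .
      show "bij p" if "c \<in> C" "p \<in> c" for c p using bspec[OF bspec[OF C(3) that(1)] that(2)] .
      show "q \<circ> inv p \<in> E" if "c \<in> C" "p \<in> c" "q \<in> c" for c p q
        using bspec[OF bspec[OF bspec[OF C(4) that(1)] that(2)] that(3)] .
    qed
  qed
qed

text \<open>
  Diagonal argument: if the \<open>n\<close>-th set of the cover misses some permutation of the \<open>n\<close>-th block of a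
  partition, then gluing these permutations gives a permutation that no set of the cover contains.
\<close>
lemma full_on:
  assumes E: "E \<in> \<E>"
  shows "\<exists>A. infinite A \<and> (\<forall>p\<in>sym_on A. \<exists>q\<in>E. \<forall>x\<in>A. q x = p x)"
proof -
  obtain C :: "(nat \<Rightarrow> nat) set set" where C: "countable C" "\<And>p. bij p \<Longrightarrow> p \<in> \<Union>C" "\<And>c p q. c \<in> C \<Longrightarrow> p \<in> c \<Longrightarrow> q \<in> c \<Longrightarrow> q \<circ> inv p \<in> E"
      and bC: "\<And>c p. c \<in> C \<Longrightarrow> p \<in> c \<Longrightarrow> bij p"
    by (rule coverE[OF E], rule that, assumption+)
  define \<iota> where "\<iota> x = fst (prod_decode x)" for x
  define A where "A i = {x. \<iota> x = i}" for i
  define m where "m c = to_nat_on C c" for c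
  have m_inj: "c = d" if "c \<in> C" "d \<in> C" "m c = m d" for c d
    using that C(1) by (simp add: m_def)
  show ?thesis
  proof (cases "\<exists>c\<in>C. \<forall>p\<in>sym_on (A (m c)). \<exists>q\<in>c. \<forall>x\<in>A (m c). q x = p x")
    case True
    then obtain c where c: "c \<in> C" "\<And>p. p \<in> sym_on (A (m c)) \<Longrightarrow> \<exists>q\<in>c. \<forall>x\<in>A (m c). q x = p x"
      by blast
    \<comment> \<open>The cover set \<open>c\<close> may miss the identity. Dividing by a member
      \<open>b\<close> that is trivial on the block moves what \<open>c\<close> does there into
      \<open>E\<close>.\<close>
    have "id \<in> sym_on (A (m c))" by (simp add: sym_on_def)
    then obtain b where b: "b \<in> c" "\<forall>x\<in>A (m c). b x = x" using c(2)[of id] unfolding id_apply by blast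
    have bb: "bij b" using bC[OF c(1) b(1)] .
    have "\<exists>q\<in>E. \<forall>x\<in>A (m c). q x = p x" if p: "p \<in> sym_on (A (m c))" for p
    proof -
      obtain q where q: "q \<in> c" "\<forall>x\<in>A (m c). q x = p x" using c(2)[OF p] by blast
      have "inv b x = x" if "x \<in> A (m c)" for x using b(2) bb that by (metis bij_inv_eq_iff)
      then show ?thesis using C(3)[OF c(1) b(1) q(1)] q(2) by (intro bexI[of _ "q \<circ> inv b"]) auto
    qed
    moreover have "infinite (A (m c))" using infinite_fibre by (simp add: A_def \<iota>_def)
    ultimately show ?thesis by blast
  next
    case False
    have "\<exists>p. p \<in> sym_on (A (m c)) \<and> (\<forall>q\<in>c. \<exists>x\<in>A (m c). q x \<noteq> p x)" if c: "c \<in> C" for c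
    proof (rule ccontr)
      assume "\<not> (\<exists>p. p \<in> sym_on (A (m c)) \<and> (\<forall>q\<in>c. \<exists>x\<in>A (m c). q x \<noteq> p x))"
      then have "\<forall>p\<in>sym_on (A (m c)). \<exists>q\<in>c. \<forall>x\<in>A (m c). q x = p x" by blast
      then show False using False c by blast
    qed
    then obtain P where P: "\<And>c. c \<in> C \<Longrightarrow> P c \<in> sym_on (A (m c))"
        "\<And>c q. c \<in> C \<Longrightarrow> q \<in> c \<Longrightarrow> \<exists>x\<in>A (m c). q x \<noteq> P c x" by metis
    define p where "p i = (if \<exists>c\<in>C. m c = i then P (THE c. c \<in> C \<and> m c = i) else (\<lambda>x. x))" for i
    have pm: "p (m c) = P c" if "c \<in> C" for c
    proof -
      have "(THE d. d \<in> C \<and> m d = m c) = c"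
        by (rule the_equality) (use that m_inj in blast)+
      then show ?thesis using that by (auto simp: p_def)
    qed
    have "p i \<in> sym_on (A i)" for i
    proof (cases "\<exists>c\<in>C. m c = i")
      case True
      then show ?thesis using pm P(1) by metis
    qed (simp add: p_def sym_on_def flip: id_def)
    then have "bij (\<lambda>x. p (\<iota> x) x)" by (intro glue_sym_on) (simp add: A_def)
    then obtain c where c: "c \<in> C" "(\<lambda>x. p (\<iota> x) x) \<in> c" using C(2) by blast
    obtain x where "x \<in> A (m c)" "p (\<iota> x) x \<noteq> P c x" using P(2)[OF c] by blast
    then show ?thesis using pm[OF c(1)] by (simp add: A_def)
  qed
qed

text \<open>\<open>A\<close> contains countably many copies of the grid of integers by naturals, and
  \<open>\<sigma> 1 a\<close> shifts exactly the copies selected by \<open>a\<close>. By the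
  pigeonhole principle two different selections share a set of the cover; a quotient of the two lies
  in \<open>E\<close> and shifts a copy on which they differ. Its effect on the other copies is left
  open.\<close>

lemma shift_in:
  assumes E: "E \<in> \<E>" and A: "infinite A"
  shows "\<exists>x \<psi>. x \<in> E \<and> x \<in> sym_on A \<and> inj \<psi> \<and> range \<psi> \<subseteq> A \<and> (\<forall>z j. x (\<psi> (z :: int, j :: nat)) = \<psi> (z + 1, j))"
proof -
  obtain C :: "(nat \<Rightarrow> nat) set set" where C: "countable C" "\<And>p. bij p \<Longrightarrow> p \<in> \<Union>C" "\<And>c p q. c \<in> C \<Longrightarrow> p \<in> c \<Longrightarrow> q \<in> c \<Longrightarrow> q \<circ> inv p \<in> E"
    by (rule coverE[OF E], rule that, assumption+)
  obtain e :: "nat \<Rightarrow> nat" where e: "inj e" "range e \<subseteq> A" using infinite_inj[OF A] by blast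
  define \<phi> where "\<phi> t = e (to_nat t)" for t :: "nat \<times> int \<times> nat"
  have "inj \<phi>" unfolding \<phi>_def using injD[OF e(1)] by (intro injI) (metis to_nat_split)
  then have \<phi>: "inj \<phi>" "range \<phi> \<subseteq> A" using e(2) by (auto simp: \<phi>_def)
  define \<sigma> where "\<sigma> d a x = (if x \<in> range \<phi> then
      (case inv \<phi> x of (n, z, j) \<Rightarrow> \<phi> (n, (if a n then z + d else z), j)) else x)"
    for d :: int and a :: "nat \<Rightarrow> bool" and x
  have \<sigma>\<phi>: "\<sigma> d a (\<phi> (n, z, j)) = \<phi> (n, (if a n then z + d else z), j)" for d a n z j
    using \<phi>(1) by (simp add: \<sigma>_def)
  have inv\<sigma>: "\<sigma> d a (\<sigma> (- d) a x) = x" for d a x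
  proof (cases "x \<in> range \<phi>")
    case True
    then obtain n z j where "x = \<phi> (n, z, j)" by auto
    then show ?thesis by (simp add: \<sigma>\<phi>)
  qed (simp add: \<sigma>_def)
  have \<sigma>A: "\<sigma> d a \<in> sym_on A" for d a
    by (rule sym_onI_inverse[of "\<sigma> (- d) a"]) (use inv\<sigma>[of "- d"] inv\<sigma>[of d] \<phi> in \<open>auto simp: \<sigma>_def\<close>)
  have inv_eq: "inv (\<sigma> 1 a) = \<sigma> (- 1) a" for a
    using inv\<sigma>[of 1 a] inv\<sigma>[of "- 1" a] by (intro inv_equality) auto
  have "\<sigma> 1 a \<in> \<Union>C" for a using C(2)[OF sym_on_bij[OF \<sigma>A]] .
  then obtain a b c where abc: "a \<noteq> b" "c \<in> C" "\<sigma> 1 a \<in> c" "\<sigma> 1 b \<in> c"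
    using countable_cover_pigeonhole[OF C(1), of "\<sigma> 1"] by metis
  have *: ?thesis if n: "b n" "\<not> a n" and "\<sigma> 1 a \<in> c" "\<sigma> 1 b \<in> c" for a b n
  proof -
    let ?x = "\<sigma> 1 b \<circ> inv (\<sigma> 1 a)" and ?\<psi> = "\<lambda>(z, j). \<phi> (n, z, j)"
    have "?x \<in> E" using C(3) abc(2) that by blast
    moreover have "?x \<in> sym_on A" using \<sigma>A sym_on_inv sym_on_comp by blast
    moreover have "inj ?\<psi>"
    proof (rule injI)
      fix s t assume "?\<psi> s = ?\<psi> t"
      then have "\<phi> (n, s) = \<phi> (n, t)" by (simp add: case_prod_beta)
      then show "s = t" using injD[OF \<phi>(1)] by blast
    qed
    moreover have "range ?\<psi> \<subseteq> A" using \<phi>(2) by (auto simp: image_subset_iff)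
    moreover have "\<forall>z j. ?x (?\<psi> (z, j)) = ?\<psi> (z + 1, j)"
      using n by (simp add: inv_eq \<sigma>\<phi>)
    ultimately show ?thesis by (intro exI[of _ ?x] exI[of _ ?\<psi>] conjI)
  qed
  obtain n where "a n \<noteq> b n" using abc(1) by blast
  then show ?thesis using *[of b n a] *[of a n b] abc by blast
qed

text \<open>
  Let \<open>x\<close> be the shift \<open>(z, j) \<mapsto> (z + 1, j)\<close> and let \<open>y\<close> act as \<open>g\<close> on each level \<open>z \<ge> 0\<close>. The commutator
  of \<open>y\<close> and \<open>x\<close> cancels on all levels but \<open>0\<close>, where it is \<open>g\<close>. As \<open>x\<close> is trivial off \<open>A\<close>, the commutator
  does not see how an element of \<open>E\<close> that extends \<open>y\<close> behaves off \<open>A\<close>.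
\<close>
lemma sym_on_infinite:
  assumes E: "E \<in> \<E>" shows "\<exists>D. infinite D \<and> sym_on D \<subseteq> E"
proof -
  obtain E1 where E1: "E1 \<in> \<E>" "\<And>p q. p \<in> E1 \<Longrightarrow> q \<in> E1 \<Longrightarrow> p \<circ> q \<in> E" using comp[OF E] by blast
  obtain E2 where E2: "E2 \<in> \<E>" "\<And>p q. p \<in> E2 \<Longrightarrow> q \<in> E2 \<Longrightarrow> p \<circ> q \<in> E1" using comp[OF E1(1)] by blast
  obtain A where A: "infinite A" "\<And>p. p \<in> sym_on A \<Longrightarrow> \<exists>q\<in>E2. \<forall>x\<in>A. q x = p x"
    using full_on[OF E2(1)] by blast
  obtain x and \<psi> :: "int \<times> nat \<Rightarrow> nat" where x: "x \<in> E2" "x \<in> sym_on A" "inj \<psi>" "range \<psi> \<subseteq> A"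
      "\<And>z j. x (\<psi> (z, j)) = \<psi> (z + 1, j)"
    using shift_in[OF E2(1) A(1)] by blast
  define D where "D = (\<lambda>j. \<psi> (0, j)) ` UNIV"
  have "inj (\<lambda>j. \<psi> (0, j))" using x(3) by (auto simp: inj_def)
  then have "infinite D" unfolding D_def using finite_imageD by blast
  moreover have "g \<in> E" if g: "g \<in> sym_on D" for g
  proof -
    \<comment> \<open>\<open>\<gamma> g\<close> is \<open>g\<close> read in the coordinate
      \<open>j\<close> of level 0, and \<open>Y \<delta>\<close> below lets a map of coordinates act
      on all levels \<open>z \<ge> 0\<close> at once.\<close>
    define \<gamma> where "\<gamma> g j = snd (inv \<psi> (g (\<psi> (0, j))))" for g :: "nat \<Rightarrow> nat" and j
    have \<gamma>: "g (\<psi> (0, j)) = \<psi> (0, \<gamma> g j)" if "g \<in> sym_on D" for g j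
    proof -
      have "g (\<psi> (0, j)) \<in> D" using sym_on_inside[OF that] by (auto simp: D_def)
      then show ?thesis using x(3) by (auto simp: D_def \<gamma>_def)
    qed
    have \<gamma>inv: "\<gamma> g (\<gamma> h j) = j" if "g \<in> sym_on D" "h \<in> sym_on D" "\<And>x. g (h x) = x" for g h j
    proof -
      have "\<psi> (0, \<gamma> g (\<gamma> h j)) = \<psi> (0, j)" using \<gamma> that by metis
      then show ?thesis using x(3) by (auto simp: inj_def)
    qed
    have bg: "bij g" and ig: "inv g \<in> sym_on D" using g sym_on_bij sym_on_inv by blast+
    have gi: "\<gamma> g (\<gamma> (inv g) j) = j" "\<gamma> (inv g) (\<gamma> g j) = j" for j
      using \<gamma>inv[OF g ig] \<gamma>inv[OF ig g] bg by (simp_all add: bij_is_inj bij_is_surj surj_f_inv_f)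
    define Y where "Y \<delta> a = (if a \<in> range \<psi> then (case inv \<psi> a of (z, j) \<Rightarrow> \<psi> (z, if z \<ge> 0 then \<delta> j else j)) else a)"
      for \<delta> :: "nat \<Rightarrow> nat" and a
    have Y\<psi>: "Y \<delta> (\<psi> (z, j)) = \<psi> (z, if z \<ge> 0 then \<delta> j else j)" for \<delta> z j
      using x(3) by (simp add: Y_def)
    have YY: "Y \<delta> (Y \<delta>' a) = a" if "\<And>j. \<delta> (\<delta>' j) = j" for \<delta> \<delta>' a
    proof (cases "a \<in> range \<psi>")
      case True
      then obtain z j where "a = \<psi> (z, j)" by auto
      then show ?thesis using that by (simp add: Y\<psi>)
    qed (simp add: Y_def)
    define y where "y = Y (\<gamma> g)"
    have yA: "y \<in> sym_on A" unfolding y_def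
    proof (rule sym_onI_inverse[of "Y (\<gamma> (inv g))"])
      show "Y (\<gamma> (inv g)) (Y (\<gamma> g) a) = a" for a by (rule YY) (rule gi)
      show "Y (\<gamma> g) (Y (\<gamma> (inv g)) a) = a" for a by (rule YY) (rule gi)
      show "Y (\<gamma> g) a = a" if "a \<notin> A" for a using that x(4) by (auto simp: Y_def)
    qed
    have iy: "inv y = Y (\<gamma> (inv g))" unfolding y_def
      by (rule inv_equality) (auto intro!: YY simp: gi)
    obtain y' where y': "y' \<in> E2" "\<And>a. a \<in> A \<Longrightarrow> y' a = y a" using A(2)[OF yA] by blast
    have by': "bij y'" using bij[OF E2(1) y'(1)] .
    have byy: "bij y" and bx: "bij x" using yA x(2) sym_on_bij by auto
    have iy'A: "inv y' a = inv y a" if a: "a \<in> A" for a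
    proof -
      have "inv y a \<in> A" using sym_on_inside[OF sym_on_inv[OF yA] a] .
      then have "y' (inv y a) = a" using y'(2) byy by (simp add: bij_is_surj surj_f_inv_f)
      then show ?thesis using by' by (metis bij_inv_eq_iff)
    qed
    have "g = (y' \<circ> x) \<circ> (inv y' \<circ> inv x)"
    proof
      fix a
      show "g a = ((y' \<circ> x) \<circ> (inv y' \<circ> inv x)) a"
      proof (cases "a \<in> A")
        case False
        have "a \<notin> D" using False x(4) by (auto simp: D_def)
        then have "g a = a" using sym_on_outside[OF g] by blast
        have "inv y' a \<notin> A"
        proof
          assume *: "inv y' a \<in> A"
          then have "y' (inv y' a) \<in> A" using y'(2) sym_on_inside[OF yA] by simp
          then show False using False by' by (simp add: bij_is_surj surj_f_inv_f)
        qed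
        then have "x (inv y' a) = inv y' a" using x(2) sym_on_outside by blast
        moreover have "inv x a = a" using sym_on_outside[OF sym_on_inv[OF x(2)]] False by blast
        ultimately show ?thesis using \<open>g a = a\<close> by' by (simp add: bij_is_surj surj_f_inv_f)
      next
        case True
        have ixA: "inv x a \<in> A" using sym_on_inside[OF sym_on_inv[OF x(2)] True] .
        have "inv y (inv x a) \<in> A" using sym_on_inside[OF sym_on_inv[OF yA] ixA] .
        then have "x (inv y (inv x a)) \<in> A" using sym_on_inside[OF x(2)] by blast
        then have eq: "((y' \<circ> x) \<circ> (inv y' \<circ> inv x)) a = y (x (inv y (inv x a)))"
          using y'(2) iy'A[OF ixA] by simp
        show ?thesis
        proof (cases "a \<in> range \<psi>")
          case True
          then obtain z j where a: "a = \<psi> (z, j)" by auto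
          have "x (\<psi> (z - 1, j)) = a" using x(5) a by simp
          then have ix: "inv x a = \<psi> (z - 1, j)" using bx by (metis bij_inv_eq_iff)
          consider "z \<ge> 1" | "z = 0" | "z < 0" by linarith
          then show ?thesis
          proof cases
            case 1
            have "a \<notin> D" using a injD[OF x(3), of "(z, j)"] 1 by (auto simp: D_def)
            then have "g a = a" using sym_on_outside[OF g] by blast
            then show ?thesis unfolding eq ix iy using 1 a by (simp add: y_def Y\<psi> x(5) gi)
          next
            case 2
            then show ?thesis unfolding eq ix iy using a \<gamma>[OF g] by (simp add: y_def Y\<psi> x(5))
          next
            case 3
            have "a \<notin> D" using a injD[OF x(3), of "(z, j)"] 3 by (auto simp: D_def)
            then have "g a = a" using sym_on_outside[OF g] by blast
            then show ?thesis unfolding eq ix iy using 3 a by (simp add: y_def Y\<psi> x(5))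
          qed
        next
          case False
          have n1: "inv x a \<notin> range \<psi>"
          proof
            assume "inv x a \<in> range \<psi>"
            then obtain z j where "inv x a = \<psi> (z, j)" by auto
            then have "x (\<psi> (z, j)) = a" using bx by (metis bij_inv_eq_iff)
            then show False using False x(5) by (metis rangeI)
          qed
          have "a \<notin> D" using False by (auto simp: D_def)
          then have "g a = a" using sym_on_outside[OF g] by blast
          moreover have "inv y (inv x a) = inv x a" unfolding iy using n1 by (simp add: Y_def)
          moreover have "x (inv x a) = a" using bx by (simp add: bij_is_surj surj_f_inv_f)
          moreover have "y a = a" using False by (simp add: y_def Y_def)
          ultimately show ?thesis unfolding eq by simp
        qed
      qed
    qed
    moreover have "(y' \<circ> x) \<circ> (inv y' \<circ> inv x) \<in> E"
      using E1(2)[OF E2(2)[OF y'(1) x(1)] E2(2)[OF inv[OF E2(1) y'(1)] inv[OF E2(1) x(1)]]] .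
    ultimately show ?thesis by simp
  qed
  ultimately show ?thesis by blast
qed

text \<open>
  An uncountable almost disjoint family yields \<open>g \<in> E\<close> such that \<open>D\<close> and \<open>D' = g ` D\<close> have infinite
  intersection and cofinite union; then the permutations of \<open>D \<union> D'\<close> are products of three
  permutations of \<open>D\<close> or \<open>D'\<close>.
\<close>
lemma contains_stabilizer:
  assumes E: "E \<in> \<E>" shows "\<exists>F. finite F \<and> sym_on (- F) \<subseteq> E"
proof -
  obtain E1 where E1: "E1 \<in> \<E>" "\<And>p q r. p \<in> E1 \<Longrightarrow> q \<in> E1 \<Longrightarrow> r \<in> E1 \<Longrightarrow> p \<circ> q \<circ> r \<in> E"
    using comp3[OF E] by blast
  obtain E2 where E2: "E2 \<in> \<E>" "E2 \<subseteq> E1" "\<And>p q r. p \<in> E2 \<Longrightarrow> q \<in> E2 \<Longrightarrow> r \<in> E2 \<Longrightarrow> p \<circ> q \<circ> r \<in> E1"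
    using comp3[OF E1(1)] by blast
  obtain D where D: "infinite D" "sym_on D \<subseteq> E2" using sym_on_infinite[OF E2(1)] by blast
  show ?thesis
  proof (cases "finite (- D)")
    case True
    have "sym_on D \<subseteq> E"
    proof
      fix p assume "p \<in> sym_on D"
      then have "p \<in> E1" using D E2 by blast
      then show "p \<in> E" using E1(2)[of p id id] id[OF E1(1)] by simp
    qed
    then show ?thesis using True by (intro exI[of _ "- D"]) simp
  next
    case False
    obtain Y :: "(nat \<Rightarrow> bool) \<Rightarrow> nat set" where Y: "\<And>a. infinite (Y a)" "\<And>a b. a \<noteq> b \<Longrightarrow> finite (Y a \<inter> Y b)"
      using almost_disjoint_family by blast
    \<comment> \<open>A third set of the family meets \<open>Y a\<close> and \<open>Y b\<close> in
      finite sets only, so almost all of it lies in this complement.\<close>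
    have coY: "infinite (- (Y a \<union> Y b))" for a b
    proof
      assume fin: "finite (- (Y a \<union> Y b))"
      have "infinite (UNIV :: (nat \<Rightarrow> bool) set)" using uncountable_infinite uncountable_nat_bool by blast
      then obtain c where c: "c \<notin> {a, b}" by (metis finite.emptyI finite_insert ex_new_if_finite)
      have "Y c \<subseteq> - (Y a \<union> Y b) \<union> (Y c \<inter> Y a) \<union> (Y c \<inter> Y b)" by blast
      moreover have "finite (- (Y a \<union> Y b) \<union> (Y c \<inter> Y a) \<union> (Y c \<inter> Y b))" using fin Y(2) c by auto
      ultimately show False using Y(1) finite_subset by blast
    qed
    have "\<exists>k. bij k \<and> k ` Y a = - D" for a
    proof -
      obtain h where h: "bij_betw h (Y a) (- D)" using bij_betw_infinite_nat Y(1) False by blast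
      have "infinite (- Y a)" "infinite (- (- D))" using coY[of a a] D(1) by auto
      then show ?thesis using bij_extend[OF h] by blast
    qed
    then obtain k where k: "\<And>a. bij (k a)" "\<And>a. k a ` Y a = - D" by metis
    obtain C :: "(nat \<Rightarrow> nat) set set" where C: "countable C" "\<And>p. bij p \<Longrightarrow> p \<in> \<Union>C" "\<And>c p q. c \<in> C \<Longrightarrow> p \<in> c \<Longrightarrow> q \<in> c \<Longrightarrow> q \<circ> inv p \<in> E2"
      by (rule coverE[OF E2(1)], rule that, assumption+)
    have "k a \<in> \<Union>C" for a using C(2)[OF k(1)] .
    then obtain a b c where abc: "a \<noteq> b" "c \<in> C" "k a \<in> c" "k b \<in> c"
      using countable_cover_pigeonhole[OF C(1), of k] by metis
    \<comment> \<open>\<open>k a\<close> maps \<open>Y a\<close> onto the complement of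
      \<open>D\<close>, so \<open>g\<close> moves this complement to the image of \<open>Y a\<close>
      under \<open>k b\<close>, whereas the complement of \<open>D\<close> is also the image of
      \<open>Y b\<close> under \<open>k b\<close>. Almost disjointness thus makes the set missed by
      both \<open>D\<close> and \<open>D'\<close> finite.\<close>
    define g where "g = k b \<circ> inv (k a)"
    have gE: "g \<in> E2" unfolding g_def using C(3) abc by blast
    have bg: "bij g" using bij[OF E2(1) gE] .
    define D' where "D' = g ` D"
    have "inv (k a) ` (- D) = Y a" using k by (metis bij_is_inj image_inv_f_f)
    then have gD: "- D' = k b ` Y a" unfolding D'_def g_def
      using bg by (metis bij_image_Compl_eq g_def image_comp)
    have F: "- (D \<union> D') = k b ` (Y b \<inter> Y a)"
    proof -
      have "- (D \<union> D') = k b ` Y b \<inter> k b ` Y a" using gD k(2)[of b] by blast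
      then show ?thesis using k(1)[of b] by (simp add: image_Int bij_is_inj)
    qed
    have DD': "D \<inter> D' = k b ` (- (Y b \<union> Y a))"
    proof -
      have "D \<inter> D' = - (k b ` (Y b \<union> Y a))" using gD k(2)[of b] by blast
      then show ?thesis using bij_image_Compl_eq[OF k(1)[of b], of "Y b \<union> Y a"] by simp
    qed
    have "infinite (D \<inter> D')" unfolding DD' using coY k(1) by (metis bij_is_inj finite_image_iff inj_on_subset subset_UNIV)
    have S1: "sym_on D \<subseteq> E1" using D(2) E2(2) by blast
    have S2: "sym_on D' \<subseteq> E1"
    proof
      fix p assume p: "p \<in> sym_on D'"
      define q where "q = inv g \<circ> p \<circ> g"
      have "q \<in> sym_on D" unfolding sym_on_def
      proof (intro CollectI conjI allI impI)
        show "bij q" unfolding q_def using bg sym_on_bij[OF p] by (intro bij_comp bij_imp_bij_inv)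
        fix x assume "x \<notin> D"
        then have "g x \<notin> D'" unfolding D'_def using bg by (meson bij_is_inj inj_image_mem_iff)
        then have "p (g x) = g x" using sym_on_outside[OF p] by blast
        then show "q x = x" using bg by (simp add: q_def bij_is_inj)
      qed
      then have "g \<circ> q \<circ> inv g \<in> E1" using E2(3) gE inv[OF E2(1) gE] D(2) by blast
      moreover have "g \<circ> q \<circ> inv g = p"
        using bg by (auto simp: q_def fun_eq_iff bij_is_surj surj_f_inv_f)
      ultimately show "p \<in> E1" by simp
    qed
    have "sym_on (- (k b ` (Y b \<inter> Y a))) \<subseteq> E"
    proof
      fix p assume "p \<in> sym_on (- (k b ` (Y b \<inter> Y a)))"
      then have "p \<in> sym_on (D \<union> D')" using F by (metis double_complement)
      then obtain u v w where "u \<in> sym_on D \<union> sym_on D'" "v \<in> sym_on D \<union> sym_on D'" "w \<in> sym_on D \<union> sym_on D'"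
          "p = u \<circ> v \<circ> w"
        using sym_on_product[OF _ \<open>infinite (D \<inter> D')\<close>] by blast
      then show "p \<in> E" using E1(2) S1 S2 by blast
    qed
    moreover have "finite (k b ` (Y b \<inter> Y a))" using finite_imageI[OF Y(2)[OF abc(1)[symmetric]]] .
    ultimately show ?thesis by (intro exI[of _ "k b ` (Y b \<inter> Y a)"] conjI)
  qed
qed

end

section \<open>Second countable topologies are contained in \<open>\<T>\<^sub>0\<close>\<close>

lemma sg_topspace: "semigroup_topology T \<Longrightarrow> topspace T = \<I>"
  by (simp add: semigroup_topology_def)

lemma sg_open_sub: "semigroup_topology T \<Longrightarrow> openin T U \<Longrightarrow> U \<subseteq> \<I>"
  using openin_subset sg_topspace by metis

lemma sg_mult:
  assumes "semigroup_topology T" "openin T U" "f \<in> \<I>" "g \<in> \<I>" "f O g \<in> U"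
  obtains A B where "openin T A" "openin T B" "f \<in> A" "g \<in> B" "\<And>a b. a \<in> A \<Longrightarrow> b \<in> B \<Longrightarrow> a O b \<in> U"
  using assms unfolding semigroup_topology_iff by metis

lemma openin_subopenI:
  assumes "\<And>x. x \<in> S \<Longrightarrow> \<exists>W. openin X W \<and> x \<in> W \<and> W \<subseteq> S" shows "openin X S"
  using assms openin_subopen[of X S] by metis

lemma openin_translate:
  assumes T: "semigroup_topology T" and U: "openin T U" and a: "a \<in> \<I>" and b: "b \<in> \<I>"
  shows "openin T {g \<in> \<I>. a O g O b \<in> U}"
proof -
  let ?V = "{g \<in> \<I>. a O g O b \<in> U}"
  have "\<exists>W. openin T W \<and> g \<in> W \<and> W \<subseteq> ?V" if "g \<in> ?V" for g
  proof -
    have g: "g \<in> \<I>" "a O (g O b) \<in> U" using that by auto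
    obtain A B where AB: "openin T A" "openin T B" "a \<in> A" "g O b \<in> B" "\<And>x y. x \<in> A \<Longrightarrow> y \<in> B \<Longrightarrow> x O y \<in> U"
      using sg_mult[OF T U a sim_comp[OF g(1) b] g(2)] by metis
    obtain C D where CD: "openin T C" "openin T D" "g \<in> C" "b \<in> D" "\<And>x y. x \<in> C \<Longrightarrow> y \<in> D \<Longrightarrow> x O y \<in> B"
      using sg_mult[OF T AB(2) g(1) b AB(4)] by metis
    have "C \<subseteq> ?V"
    proof
      fix x assume x: "x \<in> C"
      have "a O (x O b) \<in> U" using AB(5)[OF AB(3) CD(5)[OF x CD(4)]] .
      then show "x \<in> ?V" using x sg_open_sub[OF T CD(1)] by auto
    qed
    then show ?thesis using CD(1,3) by (intro exI[of _ C] conjI)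
  qed
  then show ?thesis by (rule openin_subopenI)
qed

section \<open>Permutations near the identity\<close>

definition gr :: "(nat \<Rightarrow> nat) \<Rightarrow> (nat \<times> nat) set"
  where "gr p = {(x, y). y = p x}"

lemma gr_comp: "gr p O gr q = gr (q \<circ> p)"
  by (auto simp: gr_def)

lemma gr_id: "gr id = Id"
  by (auto simp: gr_def)

lemma gr_sim: "inj p \<Longrightarrow> gr p \<in> \<I>"
  by (rule simI) (auto simp: gr_def dest: injD)

text \<open>\<open>\<N> V\<close> asks for both \<open>p\<close> and its inverse, which makes these
  sets closed under inversion whatever \<open>T\<close> does. The cover is indexed by pairs
  \<open>(B, B')\<close> of basic sets whose products, \<open>B'\<close> first, lie in
  \<open>V\<close>; two permutations with the same index have both of their quotients in
  \<open>V\<close>.\<close>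

lemma open_contains_stabilizer:
  assumes T: "semigroup_topology T" and sc: "second_countable T" and V: "openin T V" "Id \<in> V"
  shows "\<exists>F. finite F \<and> (\<forall>p\<in>sym_on (- F). gr p \<in> V)"
proof -
  define \<N> where "\<N> V = {p. bij p \<and> gr p \<in> V \<and> gr (inv p) \<in> V}" for V
  have binv: "inv (inv p) = p" if "bij p" for p :: "nat \<Rightarrow> nat" using that by (simp add: inv_inv_eq)
  have icomp: "inv (p \<circ> q) = inv q \<circ> inv p" if "bij p" "bij q" for p q :: "nat \<Rightarrow> nat"
    using that by (simp add: o_inv_distrib)
  obtain \<B> where \<B>: "countable \<B>" "\<And>B. B \<in> \<B> \<Longrightarrow> openin T B"
      "\<And>U x. openin T U \<Longrightarrow> x \<in> U \<Longrightarrow> \<exists>B\<in>\<B>. x \<in> B \<and> B \<subseteq> U"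
    using sc unfolding second_countable_def by metis
  interpret small_symmetric_sets "\<N> ` {V. openin T V \<and> Id \<in> V}"
  proof
    fix E p assume E: "E \<in> \<N> ` {V. openin T V \<and> Id \<in> V}"
    then obtain V where V: "E = \<N> V" "openin T V" "Id \<in> V" by blast
    show "id \<in> E" using V by (simp add: \<N>_def gr_id)
    show "\<exists>E'\<in>\<N> ` {V. openin T V \<and> Id \<in> V}. \<forall>p\<in>E'. \<forall>q\<in>E'. p \<circ> q \<in> E"
    proof -
      obtain A B where AB: "openin T A" "openin T B" "Id \<in> A" "Id \<in> B" "\<And>a b. a \<in> A \<Longrightarrow> b \<in> B \<Longrightarrow> a O b \<in> V"
        using sg_mult[OF T V(2) sim_Id sim_Id] V(3) by auto
      have "p \<circ> q \<in> E" if p: "p \<in> \<N> (A \<inter> B)" and q: "q \<in> \<N> (A \<inter> B)" for p q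
      proof -
        have "gr (p \<circ> q) \<in> V" using AB(5)[of "gr q" "gr p"] p q by (simp add: \<N>_def gr_comp)
        moreover have "gr (inv (p \<circ> q)) \<in> V"
          using AB(5)[of "gr (inv p)" "gr (inv q)"] p q by (simp add: \<N>_def gr_comp icomp)
        ultimately show ?thesis using p q V(1) by (simp add: \<N>_def bij_comp)
      qed
      moreover have "\<N> (A \<inter> B) \<in> \<N> ` {V. openin T V \<and> Id \<in> V}" using AB by blast
      ultimately show ?thesis by blast
    qed
    show "\<exists>C :: (nat \<Rightarrow> nat) set set. countable C \<and> (\<forall>p. bij p \<longrightarrow> p \<in> \<Union>C) \<and>
      (\<forall>c\<in>C. \<forall>p\<in>c. bij p) \<and> (\<forall>c\<in>C. \<forall>p\<in>c. \<forall>q\<in>c. q \<circ> inv p \<in> E)"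
    proof -
      define c where "c = (\<lambda>(B, B'). {p :: nat \<Rightarrow> nat. bij p \<and> gr p \<in> B \<and> gr (inv p) \<in> B'})"
      define P where "P = {(B, B'). B \<in> \<B> \<and> B' \<in> \<B> \<and> (\<forall>b\<in>B. \<forall>b'\<in>B'. b' O b \<in> V)}"
      have "P \<subseteq> \<B> \<times> \<B>" by (auto simp: P_def)
      then have "countable P" by (rule countable_subset) (simp add: \<B>(1) countable_SIGMA)
      then have "countable (c ` P)" by blast
      moreover have "p \<in> \<Union>(c ` P)" if p: "bij p" for p
      proof -
        have "gr (inv p) O gr p = Id"
          using p by (simp add: gr_comp gr_id[symmetric] surj_iff[THEN iffD1, OF bij_is_surj])
        then obtain A A' where AB: "openin T A'" "openin T A" "gr (inv p) \<in> A'" "gr p \<in> A"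
            "\<And>a b. a \<in> A' \<Longrightarrow> b \<in> A \<Longrightarrow> a O b \<in> V"
          using sg_mult[OF T V(2), of "gr (inv p)" "gr p"] V(3) gr_sim p
          by (metis bij_imp_bij_inv bij_is_inj)
        obtain B where B: "B \<in> \<B>" "gr p \<in> B" "B \<subseteq> A" using \<B>(3)[OF AB(2,4)] by blast
        obtain B' where B': "B' \<in> \<B>" "gr (inv p) \<in> B'" "B' \<subseteq> A'" using \<B>(3)[OF AB(1,3)] by blast
        have "(B, B') \<in> P" using B B' AB(5) by (auto simp: P_def)
        moreover have "p \<in> c (B, B')" using p B B' by (simp add: c_def)
        ultimately show ?thesis by blast
      qed
      moreover have "bij p" if "d \<in> c ` P" "p \<in> d" for d p using that by (auto simp: c_def)
      moreover have "q \<circ> inv p \<in> E" if d: "d \<in> c ` P" "p \<in> d" "q \<in> d" for d p q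
      proof -
        obtain B B' where B: "d = c (B, B')" "\<And>b b'. b \<in> B \<Longrightarrow> b' \<in> B' \<Longrightarrow> b' O b \<in> V"
          using d(1) by (auto simp: P_def)
        have p: "bij p" "gr p \<in> B" "gr (inv p) \<in> B'" and q: "bij q" "gr q \<in> B" "gr (inv q) \<in> B'"
          using d(2,3) by (auto simp: B(1) c_def)
        have "gr (q \<circ> inv p) \<in> V" using B(2)[OF q(2) p(3)] by (simp add: gr_comp)
        moreover have "gr (inv (q \<circ> inv p)) \<in> V"
          using B(2)[OF p(2) q(3)] p q by (simp add: gr_comp icomp binv bij_imp_bij_inv)
        ultimately show ?thesis using p q V(1) by (simp add: \<N>_def bij_comp bij_imp_bij_inv)
      qed
      ultimately show ?thesis by (intro exI[of _ "c ` P"]) blast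
    qed
    assume p: "p \<in> E"
    show "bij p" using p V by (simp add: \<N>_def)
    show "inv p \<in> E" using p V by (simp add: \<N>_def binv bij_imp_bij_inv)
  qed
  have "\<N> V \<in> \<N> ` {V. openin T V \<and> Id \<in> V}" using V by blast
  then obtain F where "finite F" "sym_on (- F) \<subseteq> \<N> V" using contains_stabilizer by blast
  then show ?thesis by (auto simp: \<N>_def)
qed

text \<open>
  As in the unitary dilation of a contraction, the block matrix with entries \<open>s\<close>, the defect
  idempotents of \<open>s\<close>, and \<open>s\<inverse>\<close> is a permutation of two copies of \<open>\<nat>\<close>, here the even and the odd numbers.
  It depends continuously on \<open>s\<close>, and \<open>s\<close> is its compression to the even numbers.
\<close>
definition dilation :: "(nat \<times> nat) set \<Rightarrow> nat \<Rightarrow> nat"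
  where "dilation s n = (if even n
    then (if n div 2 \<in> Domain s then 2 * (THE y. (n div 2, y) \<in> s) else n + 1)
    else (if n div 2 \<in> Range s then 2 * (THE x. (x, n div 2) \<in> s) + 1 else n - 1))"

context
  fixes s assumes s: "s \<in> \<I>"
begin

lemma dilation_even: "(x, y) \<in> s \<Longrightarrow> dilation s (2 * x) = 2 * y"
proof -
  assume xy: "(x, y) \<in> s"
  then have "(THE y. (x, y) \<in> s) = y" using simD1[OF s] by blast
  then show ?thesis using xy by (auto simp: dilation_def)
qed

lemma dilation_odd: "(x, y) \<in> s \<Longrightarrow> dilation s (2 * y + 1) = 2 * x + 1"
proof -
  assume xy: "(x, y) \<in> s"
  then have "(THE x. (x, y) \<in> s) = x" using simD2[OF s] by blast
  then show ?thesis using xy by (auto simp: dilation_def)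
qed

end

lemma dilation_even_undef: "x \<notin> Domain s \<Longrightarrow> dilation s (2 * x) = 2 * x + 1"
  by (simp add: dilation_def)

lemma dilation_odd_undef: "y \<notin> Range s \<Longrightarrow> dilation s (2 * y + 1) = 2 * y"
  by (simp add: dilation_def)

lemma dilation_converse:
  assumes s: "s \<in> \<I>" shows "dilation (s\<inverse>) (dilation s n) = n"
proof -
  have c: "s\<inverse> \<in> \<I>" using sim_converse[OF s] .
  consider x y where "n = 2 * x" "(x, y) \<in> s" | x where "n = 2 * x" "x \<notin> Domain s"
    | x y where "n = 2 * y + 1" "(x, y) \<in> s" | y where "n = 2 * y + 1" "y \<notin> Range s"
    by (metis DomainE RangeE oddE evenE)
  then show ?thesis
  proof cases
    case 1
    then show ?thesis using dilation_even[OF s 1(2)] dilation_even[OF c, of y x] by simp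
  next
    case 2
    then show ?thesis using dilation_even_undef[OF 2(2)] dilation_odd_undef[of x "s\<inverse>"] by simp
  next
    case 3
    then show ?thesis using dilation_odd[OF s 3(2)] dilation_odd[OF c, of y x] by simp
  next
    case 4
    then show ?thesis using dilation_odd_undef[OF 4(2)] dilation_even_undef[of y "s\<inverse>"] by simp
  qed
qed

lemma bij_dilation:
  assumes "s \<in> \<I>" shows "bij (dilation s)"
  by (rule bij_betw_byWitness[where f' = "dilation (s\<inverse>)"])
    (use dilation_converse[OF assms] dilation_converse[OF sim_converse[OF assms]] in auto)

lemma dilation_compress:
  assumes "s \<in> \<I>" shows "gr (\<lambda>x. 2 * x) O gr (dilation s) O (gr (\<lambda>x. 2 * x))\<inverse> = s"
proof -
  have "dilation s (2 * x) = 2 * y \<longleftrightarrow> (x, y) \<in> s" for x y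
  proof (cases "x \<in> Domain s")
    case True
    then obtain z where z: "(x, z) \<in> s" by blast
    have "dilation s (2 * x) = 2 * y \<longleftrightarrow> z = y" using dilation_even[OF assms z] by simp
    also have "\<dots> \<longleftrightarrow> (x, y) \<in> s" using z simD1[OF assms z, of y] by metis
    finally show ?thesis .
  next
    case False
    have "2 * x + 1 \<noteq> 2 * y" by presburger
    then show ?thesis using dilation_even_undef[OF False] False by auto
  qed
  then have "(x, y) \<in> gr (\<lambda>x. 2 * x) O gr (dilation s) O (gr (\<lambda>x. 2 * x))\<inverse> \<longleftrightarrow> (x, y) \<in> s" for x y
    unfolding gr_def by (auto simp: relcomp_unfold)
  then show ?thesis by auto
qed

text \<open>If \<open>s'\<close> is close to \<open>s\<close>, the permutation \<open>p\<close> that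
  takes the dilation of \<open>s\<close> to that of \<open>s'\<close> fixes the finite set
  \<open>F\<close>, hence is near the identity. Compression turns this closeness of the dilations
  into \<open>s' \<in> U\<close>.\<close>

lemma second_countable_coarser:
  assumes T: "semigroup_topology T" and sc: "second_countable T" and U: "openin T U" and s: "s \<in> U"
  shows "\<exists>k. nbhd (\<lambda>_. 0) s k \<subseteq> U"
proof -
  have sI: "s \<in> \<I>" using sg_open_sub[OF T U] s by blast
  let ?e = "gr (\<lambda>x. 2 * x)" and ?t = "dilation s"
  have e: "?e \<in> \<I>" "?e\<inverse> \<in> \<I>" and t: "gr ?t \<in> \<I>"
    using gr_sim[of "\<lambda>x. 2 * x"] gr_sim[OF bij_is_inj[OF bij_dilation[OF sI]]] sim_converse by (auto simp: inj_def)
  have bt: "bij ?t" using bij_dilation[OF sI] .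
  define W where "W = {g \<in> \<I>. ?e O g O ?e\<inverse> \<in> U}"
  have "openin T W" unfolding W_def by (rule openin_translate[OF T U e])
  moreover have "gr ?t O Id \<in> W" using t dilation_compress[OF sI] s by (simp add: W_def)
  ultimately obtain A V where V: "openin T A" "openin T V" "gr ?t \<in> A" "Id \<in> V" "\<And>a b. a \<in> A \<Longrightarrow> b \<in> V \<Longrightarrow> a O b \<in> W"
    using sg_mult[OF T _ t sim_Id] by metis
  obtain F where F: "finite F" "\<And>p. p \<in> sym_on (- F) \<Longrightarrow> gr p \<in> V"
    using open_contains_stabilizer[OF T sc V(2,4)] by blast
  define F' where "F' = (\<lambda>n. n div 2) ` inv ?t ` F"
  \<comment> \<open>At odd arguments the dilation reads preimages, so \<open>k\<close> has to bound
    the preimages of \<open>F'\<close> too. Points of \<open>F'\<close> missed by \<open>s\<close>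
    are missed by \<open>s'\<close> because the bound on new image points is zero.\<close>
  have "finite (F' \<union> s\<inverse> `` F')" using F(1) finite_preimage_sim[OF sI] by (simp add: F'_def)
  then obtain k where k: "F' \<union> s\<inverse> `` F' \<subseteq> {..<k}" using finite_nat_iff_bounded by metis
  have "s' \<in> U" if s': "s' \<in> nbhd (\<lambda>_. 0) s k" for s'
  proof -
    have ag: "s' \<in> agree s k" and s'I: "s' \<in> \<I>" using s' by (auto simp: nbhd_def agree_def)
    have "card ({..<k} \<inter> Range s' - Range s) = 0" using s' by (simp add: nbhd_def zero_enat_def)
    then have R: "{..<k} \<inter> Range s' \<subseteq> Range s" by auto
    have eq: "dilation s' n = ?t n" if n: "n div 2 \<in> F'" for n
    proof -
      have k1: "n div 2 < k" and k2: "(x, n div 2) \<in> s \<Longrightarrow> x < k" for x using n k by blast+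
      consider x y where "n = 2 * x" "(x, y) \<in> s" | x where "n = 2 * x" "x \<notin> Domain s"
        | x y where "n = 2 * y + 1" "(x, y) \<in> s" | y where "n = 2 * y + 1" "y \<notin> Range s"
        by (metis DomainE RangeE oddE evenE)
      then show ?thesis
      proof cases
        case 1
        then have "(x, y) \<in> s'" using agree_iff[OF ag] k1 by simp
        then show ?thesis using 1 dilation_even[OF sI] dilation_even[OF s'I] by simp
      next
        case 2
        then have "x \<notin> Domain s'" using agree_iff[OF ag, of x] k1 by auto
        then show ?thesis using 2 dilation_even_undef by simp
      next
        case 3
        then have "(x, y) \<in> s'" using agree_iff[OF ag] k2[of x] by simp
        then show ?thesis using 3 dilation_odd[OF sI] dilation_odd[OF s'I] by simp
      next
        case 4
        then have "y \<notin> Range s'" using R k1 by auto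
        then show ?thesis using 4 dilation_odd_undef by simp
      qed
    qed
    define p where "p = dilation s' \<circ> inv ?t"
    have bs': "bij (dilation s')" using bij_dilation[OF s'I] .
    have "p \<in> sym_on (- F)" unfolding sym_on_def
    proof (intro CollectI conjI allI impI)
      show "bij p" unfolding p_def using bs' bt bij_comp bij_imp_bij_inv by blast
      fix x assume "x \<notin> - F"
      then have "inv ?t x div 2 \<in> F'" by (simp add: F'_def)
      then show "p x = x" using eq bt by (simp add: p_def bij_is_surj surj_f_inv_f)
    qed
    then have "gr ?t O gr p \<in> W" using V(3,5) F(2) by blast
    moreover have "p \<circ> ?t = dilation s'" using bt by (auto simp: p_def fun_eq_iff bij_is_inj)
    ultimately have "?e O gr (dilation s') O ?e\<inverse> \<in> U" by (simp add: gr_comp W_def)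
    then show ?thesis using dilation_compress[OF s'I] by simp
  qed
  then show ?thesis by blast
qed

section \<open>\<open>T\<^sub>1\<close> semigroup topologies contain \<open>\<I>\<^sub>2\<close> or its inverse\<close>

context
  fixes T assumes T: "semigroup_topology T" and t1: "t1_space T"
begin

lemma openin_remove_finite: 
  assumes "openin T U" "finite S" "S \<subseteq> \<I>" shows "openin T (U - S)"
  using assms t1 unfolding t1_space_closedin_finite by (metis T openin_diff sg_topspace)

text \<open>Between the one-point idempotents at \<open>x\<close> and \<open>y\<close> an element
  collapses to \<open>{(x, y)}\<close> or to the empty map, and the empty map is a closed
  point.\<close>

lemma openin_pair: "openin T {h \<in> \<I>. (x, y) \<in> h}"
proof -
  have "openin T (\<I> - {{}})"
    using openin_remove_finite[of \<I> "{{}}"] openin_topspace[of T] sg_topspace[OF T] by simp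
  then have "openin T {h \<in> \<I>. {(x, x)} O h O {(y, y)} \<in> \<I> - {{}}}"
    by (rule openin_translate[OF T]) auto
  moreover have "{(x, x)} O h O {(y, y)} \<in> \<I> - {{}} \<longleftrightarrow> (x, y) \<in> h" if "h \<in> \<I>" for h
    using sim_comp[OF sim_singleton sim_comp[OF that sim_singleton], of x x y y] by auto
  ultimately show ?thesis by (metis (mono_tags, lifting) Collect_cong)
qed

lemma openin_dom_or_ran:
  "(\<forall>x. openin T {h \<in> \<I>. x \<notin> Domain h}) \<or> (\<forall>y. openin T {h \<in> \<I>. y \<notin> Range h})"
proof (rule ccontr)
  assume "\<not> ?thesis"
  then obtain a b where a: "\<not> openin T {h \<in> \<I>. a \<notin> Domain h}" and b: "\<not> openin T {h \<in> \<I>. b \<notin> Range h}"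
    by blast
  obtain h where h: "h \<in> \<I>" "a \<notin> Domain h" "\<And>W. openin T W \<Longrightarrow> h \<in> W \<Longrightarrow> \<not> W \<subseteq> {h \<in> \<I>. a \<notin> Domain h}"
    using a openin_subopenI[of "{h \<in> \<I>. a \<notin> Domain h}" T] by blast
  obtain k where k: "k \<in> \<I>" "b \<notin> Range k" "\<And>W. openin T W \<Longrightarrow> k \<in> W \<Longrightarrow> \<not> W \<subseteq> {h \<in> \<I>. b \<notin> Range h}"
    using b openin_subopenI[of "{h \<in> \<I>. b \<notin> Range h}" T] by blast
  \<comment> \<open>Left multiplication by \<open>{(a, a)}\<close> annihilates \<open>h\<close> and
    turns elements near \<open>h\<close> that are defined at \<open>a\<close> into
    singletons.\<close>
  have out: "\<exists>y. {(a, y)} \<in> U" if U: "openin T U" "{} \<in> U" for U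
  proof -
    let ?W = "{g \<in> \<I>. {(a, a)} O g O Id \<in> U}"
    have "openin T ?W" by (rule openin_translate[OF T U(1)]) auto
    moreover have "{(a, a)} O h O Id = {}" using h(2) by auto
    then have "h \<in> ?W" using h(1) U(2) by simp
    ultimately obtain g where g: "g \<in> ?W" "a \<in> Domain g" using h(3)[of ?W] by blast
    then obtain y where y: "(a, y) \<in> g" by blast
    have "z = y" if "(a, z) \<in> g" for z using y that g(1) simD1 by blast
    then have "{z. (a, z) \<in> g} = {y}" using y by blast
    moreover have "{(a, a)} O g O Id = {a} \<times> {z. (a, z) \<in> g}" by auto
    ultimately have "{(a, a)} O g O Id = {(a, y)}" by simp
    then show ?thesis using g(1) by auto
  qed
  have into: "\<exists>x. {(x, b)} \<in> U" if U: "openin T U" "{} \<in> U" for U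
  proof -
    let ?W = "{g \<in> \<I>. Id O g O {(b, b)} \<in> U}"
    have "openin T ?W" by (rule openin_translate[OF T U(1)]) auto
    moreover have "Id O k O {(b, b)} = {}" using k(2) by auto
    then have "k \<in> ?W" using k(1) U(2) by simp
    ultimately obtain g where g: "g \<in> ?W" "b \<in> Range g" using k(3)[of ?W] by blast
    then obtain x where x: "(x, b) \<in> g" by blast
    have "z = x" if "(z, b) \<in> g" for z using x that g(1) simD2 by blast
    then have "{z. (z, b) \<in> g} = {x}" using x by blast
    moreover have "Id O g O {(b, b)} = {z. (z, b) \<in> g} \<times> {b}" by auto
    ultimately have "Id O g O {(b, b)} = {(x, b)}" by simp
    then show ?thesis using g(1) by auto
  qed
  have "openin T (\<I> - {{(a, b)}})"
    using openin_remove_finite[of \<I> "{{(a, b)}}"] openin_topspace[of T] sg_topspace[OF T] by simp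
  moreover have "{} O {} \<in> \<I> - {{(a, b)}}" by simp
  ultimately obtain U V where UV: "openin T U" "openin T V" "{} \<in> U" "{} \<in> V"
      "\<And>u v. u \<in> U \<Longrightarrow> v \<in> V \<Longrightarrow> u O v \<in> \<I> - {{(a, b)}}"
    using sg_mult[OF T _ sim_empty sim_empty] by metis
  define X where "X = {x. {(x, b)} \<in> V}"
  \<comment> \<open>Removing finitely many singletons from \<open>V\<close> leaves a neighbourhood
    of the empty map, which must again contain a singleton with value \<open>b\<close>.\<close>
  have "infinite X"
  proof
    assume "finite X"
    then have "openin T (V - (\<lambda>x. {(x, b)}) ` X)"
      using UV(2) by (intro openin_remove_finite) auto
    then have "\<exists>x. {(x, b)} \<in> V - (\<lambda>x. {(x, b)}) ` X" using into UV(4) by blast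
    then show False by (auto simp: X_def)
  qed
  \<comment> \<open>Right multiplication by \<open>gr e\<close> fixes the empty map, so some
    \<open>y\<close> has \<open>{(a, e y)}\<close> in \<open>U\<close>. All values of
    \<open>e\<close> lie in \<open>X\<close>, so the matching singleton in \<open>V\<close> exists
    whichever \<open>y\<close> occurs.\<close>
  then obtain e :: "nat \<Rightarrow> nat" where e: "inj e" "range e \<subseteq> X" using infinite_inj by blast
  have "openin T {g \<in> \<I>. Id O g O gr e \<in> U}"
    by (rule openin_translate[OF T UV(1)]) (use gr_sim[OF e(1)] in auto)
  moreover have "{} \<in> {g \<in> \<I>. Id O g O gr e \<in> U}" using UV(3) by simp
  ultimately obtain y where "{(a, y)} \<in> {g \<in> \<I>. Id O g O gr e \<in> U}" using out by blast
  moreover have "Id O {(a, y)} O gr e = {(a, e y)}" by (auto simp: gr_def)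
  ultimately have "{(a, e y)} \<in> U" by simp
  moreover have "{(e y, b)} \<in> V" using e(2) by (auto simp: X_def)
  ultimately have "{(a, e y)} O {(e y, b)} \<in> \<I> - {{(a, b)}}" using UV(5) by blast
  moreover have "{(a, e y)} O {(e y, b)} = {(a, b)}" by auto
  ultimately show False by simp
qed

end

section \<open>The inverse topology\<close>

lemma mem_converse_image: "g \<in> converse ` U \<longleftrightarrow> g\<inverse> \<in> U"
  by (metis converse_converse imageE imageI)

lemma openin_inv: "openin (inv_topology T) V \<longleftrightarrow> openin T (converse ` V)"
proof -
  have cc: "converse ` converse ` U = U" for U :: "(nat \<times> nat) set set" by (auto simp: image_iff)
  show ?thesis unfolding openin_inv_topology using cc by metis
qed

lemma inv_inv_topology: "inv_topology (inv_topology T) = T"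
  unfolding topology_eq openin_inv by (simp add: image_image)

lemma topspace_inv_topology:
  assumes "topspace T = \<I>" shows "topspace (inv_topology T) = \<I>"
proof -
  have I: "converse ` \<I> = \<I>"
  proof
    show "\<I> \<subseteq> converse ` \<I>"
    proof
      fix g assume "g \<in> \<I>"
      then have "g\<inverse> \<in> \<I>" by (rule sim_converse)
      then show "g \<in> converse ` \<I>" by (metis converse_converse imageI)
    qed
  qed (auto simp: sim_converse)
  have "openin (inv_topology T) \<I>" unfolding openin_inv I using assms openin_topspace[of T] by simp
  moreover have "topspace (inv_topology T) \<subseteq> \<I>"
  proof
    fix g assume g: "g \<in> topspace (inv_topology T)"
    have "openin T (converse ` topspace (inv_topology T))" unfolding openin_inv[symmetric] by simp
    then have "converse ` topspace (inv_topology T) \<subseteq> \<I>" using assms openin_subset by metis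
    then have "g\<inverse> \<in> \<I>" using g by blast
    then show "g \<in> \<I>" using sim_converse by fastforce
  qed
  ultimately show ?thesis using openin_subset by blast
qed

lemma homeomorphic_inv_topology:
  assumes "topspace T = \<I>" shows "T homeomorphic_space inv_topology T"
proof -
  have c: "continuous_map S (inv_topology S) converse" if S: "topspace S = \<I>" for S
    unfolding continuous_map_def
  proof (intro conjI allI impI)
    show "converse \<in> topspace S \<rightarrow> topspace (inv_topology S)"
      using topspace_inv_topology S sim_converse by auto
    fix U assume "openin (inv_topology S) U"
    then have o: "openin S (converse ` U)" by (simp add: openin_inv)
    have "U \<subseteq> \<I>" using openin_subset[OF \<open>openin (inv_topology S) U\<close>] topspace_inv_topology S by blast
    then have "{x \<in> topspace S. x\<inverse> \<in> U} = converse ` U" using S sim_converse mem_converse_image[of _ U] by auto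
    then show "openin S {x \<in> topspace S. x\<inverse> \<in> U}" using o by simp
  qed
  have "continuous_map (inv_topology T) T converse"
    using c[OF topspace_inv_topology[OF assms]] by (simp add: inv_inv_topology)
  then have "homeomorphic_maps T (inv_topology T) converse converse"
    using c[OF assms] by (simp add: homeomorphic_maps_def)
  then show ?thesis unfolding homeomorphic_space_def by blast
qed

lemma semigroup_inv_topology:
  assumes T: "semigroup_topology T" shows "semigroup_topology (inv_topology T)"
  unfolding semigroup_topology_iff
proof (intro conjI allI impI)
  show "topspace (inv_topology T) = \<I>" using topspace_inv_topology sg_topspace[OF T] by blast
  fix U f g assume U: "openin (inv_topology T) U" and f: "f \<in> \<I>" and g: "g \<in> \<I>" and fg: "f O g \<in> U"
  have "openin T (converse ` U)" using U by (simp add: openin_inv)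
  moreover have "g\<inverse> O f\<inverse> \<in> converse ` U" using fg by (metis converse_relcomp imageI)
  ultimately obtain A B where AB: "openin T A" "openin T B" "g\<inverse> \<in> A" "f\<inverse> \<in> B"
      "\<And>a b. a \<in> A \<Longrightarrow> b \<in> B \<Longrightarrow> a O b \<in> converse ` U"
    using sg_mult[OF T _ sim_converse[OF g] sim_converse[OF f]] by metis
  have "openin (inv_topology T) (converse ` A)" "openin (inv_topology T) (converse ` B)"
    using AB by (simp_all add: openin_inv image_image)
  moreover have "f \<in> converse ` B" "g \<in> converse ` A" using AB by (metis converse_converse imageI)+
  moreover have "\<forall>a\<in>converse ` B. \<forall>b\<in>converse ` A. a O b \<in> U"
  proof (intro ballI)
    fix a b assume "a \<in> converse ` B" "b \<in> converse ` A"
    then have "b\<inverse> O a\<inverse> \<in> converse ` U" using AB(5) by auto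
    then have "(a O b)\<inverse> \<in> converse ` U" by (simp add: converse_relcomp)
    then show "a O b \<in> U" by (metis converse_converse image_iff)
  qed
  ultimately show "\<exists>A B. openin (inv_topology T) A \<and> openin (inv_topology T) B \<and> f \<in> A \<and> g \<in> B \<and> (\<forall>a\<in>A. \<forall>b\<in>B. a O b \<in> U)"
    by meson
qed

section \<open>Semigroup topologies between \<open>\<I>\<^sub>2\<close> and \<open>\<T>\<^sub>0\<close>\<close>

lemma finite_sim: "h \<in> \<I> \<Longrightarrow> finite (Range h) \<Longrightarrow> finite h"
proof -
  assume h: "h \<in> \<I>" "finite (Range h)"
  have "h \<subseteq> h\<inverse> `` Range h \<times> Range h" by auto
  then show "finite h" using finite_preimage_sim[OF h] h(2) finite_subset by blast
qed

lemma extend_to_bij: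
  assumes b: "\<beta> \<in> \<I>" "finite \<beta>" shows "\<exists>p. bij p \<and> \<beta> \<subseteq> gr p"
proof -
  define f where "f x = (THE y. (x, y) \<in> \<beta>)" for x
  have f: "f x = y" if "(x, y) \<in> \<beta>" for x y
    unfolding f_def using that simD1[OF b(1)] by blast
  have "inj_on f (Domain \<beta>)"
  proof (rule inj_onI)
    fix x x' assume x: "x \<in> Domain \<beta>" "x' \<in> Domain \<beta>" and eq: "f x = f x'"
    obtain y y' where y: "(x, y) \<in> \<beta>" "(x', y') \<in> \<beta>" using x by blast
    then have "y = y'" using f eq by metis
    then show "x = x'" using y simD2[OF b(1)] by blast
  qed
  then have "bij_betw f (Domain \<beta>) (f ` Domain \<beta>)" by (rule inj_on_imp_bij_betw)
  moreover have "finite (Domain \<beta>)" using b(2) by (rule finite_Domain)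
  then have "infinite (- Domain \<beta>)" "infinite (- f ` Domain \<beta>)" by (simp_all add: finite_compl)
  ultimately obtain p where p: "bij p" "\<forall>x\<in>Domain \<beta>. p x = f x" using bij_extend by blast
  have "\<beta> \<subseteq> gr p"
  proof (rule subrelI)
    fix x y assume xy: "(x, y) \<in> \<beta>"
    then have "p x = f x" using p(2) by blast
    then show "(x, y) \<in> gr p" using f[OF xy] by (simp add: gr_def)
  qed
  then show ?thesis using p by blast
qed

text \<open>\<open>b\<close> relabels \<open>R2\<close> as \<open>Range h\<close> and
  \<open>L'\<close> as \<open>L\<close> and drops all other image points; \<open>a\<close> is a
  permutation that aligns the domain of \<open>h\<close> with preimages in \<open>h2\<close>. It is
  total because the preimages of \<open>L'\<close> under \<open>g\<close> are not known in advance,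
  and one pair \<open>a\<close>, \<open>b\<close> has to serve all \<open>g\<close>.\<close>

lemma transport_finite_rank:
  assumes h: "h \<in> \<I>" "finite (Range h)" and h2: "h2 \<in> \<I>" and R2: "R2 \<subseteq> Range h2" "finite R2" "card R2 = card (Range h)"
    and L: "finite L" "L \<inter> Range h = {}" and L': "finite L'" "L' \<inter> R2 = {}" "card L' = card L"
  shows "\<exists>a\<in>\<I>. \<exists>b\<in>\<I>.
    (\<forall>g\<in>\<I>. h2 \<subseteq> g \<longrightarrow> L' \<subseteq> Range g \<longrightarrow> h \<subseteq> a O g O b \<and> Range (a O g O b) = Range h \<union> L) \<and>
    (\<forall>g\<in>\<I>. h2 \<subseteq> g \<longrightarrow> Range g \<inter> L' = {} \<longrightarrow> a O g O b = h)"
proof -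
  obtain r where r: "bij_betw r R2 (Range h)" using finite_same_card_bij[OF R2(2) h(2) R2(3)] by blast
  obtain t where t: "bij_betw t L' L" using finite_same_card_bij[OF L'(1) L(1) L'(3)] by blast
  define \<rho> where "\<rho> = {(x, r x) | x. x \<in> R2}"
  define \<tau> where "\<tau> = {(x, t x) | x. x \<in> L'}"
  have \<rho>I: "\<rho> \<in> \<I>" using r by (intro simI) (auto simp: \<rho>_def bij_betw_def dest: inj_onD)
  have "Range \<rho> = r ` R2" "Domain \<rho> = R2" by (auto simp: \<rho>_def)
  then have R\<rho>: "Range \<rho> = Range h" "Domain \<rho> = R2" using r by (auto simp: bij_betw_def)
  have "Range \<tau> = t ` L'" "Domain \<tau> = L'" by (auto simp: \<tau>_def)
  then have R\<tau>: "Range \<tau> = L" "Domain \<tau> = L'" using t by (auto simp: bij_betw_def)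
  have bI: "\<rho> \<union> \<tau> \<in> \<I>"
  proof (rule simI)
    fix x y z assume "(x, y) \<in> \<rho> \<union> \<tau>" "(x, z) \<in> \<rho> \<union> \<tau>"
    then show "y = z" using L'(2) by (auto simp: \<rho>_def \<tau>_def)
  next
    fix x y z assume *: "(x, z) \<in> \<rho> \<union> \<tau>" "(y, z) \<in> \<rho> \<union> \<tau>"
    have "\<not> ((u, z) \<in> \<rho> \<and> (v, z) \<in> \<tau>)" for u v using R\<rho> R\<tau> L(2) by blast
    then consider "(x, z) \<in> \<rho>" "(y, z) \<in> \<rho>" | "(x, z) \<in> \<tau>" "(y, z) \<in> \<tau>" using * by blast
    then show "x = y"
    proof cases
      case 1
      then show ?thesis using simD2[OF \<rho>I] by blast
    next
      case 2
      then show ?thesis using t by (auto simp: \<tau>_def bij_betw_def dest: inj_onD)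
    qed
  qed
  define \<beta> where "\<beta> = h O \<rho>\<inverse> O h2\<inverse>"
  have \<beta>I: "\<beta> \<in> \<I>" unfolding \<beta>_def using h(1) \<rho>I h2 by (intro sim_comp sim_converse)
  have "finite \<beta>"
  proof (rule finite_subset)
    show "\<beta> \<subseteq> Domain h \<times> (h2\<inverse> `` R2)" using R\<rho> by (auto simp: \<beta>_def)
    show "finite (Domain h \<times> (h2\<inverse> `` R2))"
      using finite_sim[OF h] finite_preimage_sim[OF h2 R2(2)] by (simp add: finite_Domain)
  qed
  then obtain p where p: "bij p" "\<beta> \<subseteq> gr p" using extend_to_bij[OF \<beta>I] by blast
  define a where "a = gr p"
  have aI: "a \<in> \<I>" unfolding a_def using gr_sim p(1) bij_is_inj by blast
  have A: "h \<subseteq> a O g O (\<rho> \<union> \<tau>)" if "h2 \<subseteq> g" for g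
  proof (rule subrelI)
    fix x y assume xy: "(x, y) \<in> h"
    obtain z where z: "(z, y) \<in> \<rho>" using xy R\<rho> by blast
    then obtain w where w: "(w, z) \<in> h2" using R\<rho> R2(1) by blast
    have "(x, w) \<in> \<beta>" using xy z w by (auto simp: \<beta>_def)
    then have "(x, w) \<in> a" using p(2) by (auto simp: a_def)
    then show "(x, y) \<in> a O g O (\<rho> \<union> \<tau>)" using z w that by blast
  qed
  have B: "a O g O \<rho> \<subseteq> h" if g: "g \<in> \<I>" "h2 \<subseteq> g" for g
  proof (rule subrelI)
    fix x y assume "(x, y) \<in> a O g O \<rho>"
    then obtain u z where u: "(x, u) \<in> a" "(u, z) \<in> g" "(z, y) \<in> \<rho>" by blast
    obtain w where w: "(w, z) \<in> h2" using u(3) R\<rho> R2(1) by blast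
    then have "w = u" using g u(2) simD2[OF g(1)] by blast
    obtain x' where x': "(x', y) \<in> h" using u(3) R\<rho> by blast
    then have "(x', u) \<in> \<beta>" using u(3) w \<open>w = u\<close> by (auto simp: \<beta>_def)
    then have "(x', u) \<in> a" using p(2) by (auto simp: a_def)
    then have "x' = x" using u(1) simD2[OF aI] by blast
    then show "(x, y) \<in> h" using x' by simp
  qed
  have "h \<subseteq> a O g O (\<rho> \<union> \<tau>) \<and> Range (a O g O (\<rho> \<union> \<tau>)) = Range h \<union> L"
    if g: "g \<in> \<I>" "h2 \<subseteq> g" "L' \<subseteq> Range g" for g
  proof
    show "h \<subseteq> a O g O (\<rho> \<union> \<tau>)" using A[OF g(2)] .
    have "y \<in> Range (a O g O (\<rho> \<union> \<tau>))" if y: "y \<in> L" for y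
    proof -
      obtain z where z: "(z, y) \<in> \<tau>" using y R\<tau> by blast
      then obtain w where w: "(w, z) \<in> g" using R\<tau> g(3) by blast
      obtain x where "p x = w" using p(1) by (metis bij_pointE)
      then have "(x, w) \<in> a" by (simp add: a_def gr_def)
      then show ?thesis using z w by blast
    qed
    then show "Range (a O g O (\<rho> \<union> \<tau>)) = Range h \<union> L"
      using Range_mono[OF A[OF g(2)]] R\<rho> R\<tau> by blast
  qed
  moreover have "a O g O (\<rho> \<union> \<tau>) = h" if g: "g \<in> \<I>" "h2 \<subseteq> g" "Range g \<inter> L' = {}" for g
  proof
    have "g O \<tau> = {}" using g(3) R\<tau> by blast
    then have "a O g O (\<rho> \<union> \<tau>) = a O g O \<rho>" by (simp add: relcomp_distrib)
    then show "a O g O (\<rho> \<union> \<tau>) \<subseteq> h" using B[OF g(1,2)] by simp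
  qed (rule A[OF g(2)])
  ultimately show ?thesis using aI bI by (intro bexI[of _ a] bexI[of _ "\<rho> \<union> \<tau>"]) auto
qed

lemma large_subset:
  assumes "infinite A \<or> n \<le> card A" shows "\<exists>S\<subseteq>A. finite S \<and> card S = n"
proof (cases "finite A")
  case True
  then show ?thesis using assms obtain_subset_with_card_n[of n A] by metis
next
  case False
  then show ?thesis using infinite_arbitrarily_large[of A n] by blast
qed

text \<open>This is \<open>U_set f n X\<close> in the case \<open>f (enat n) = enat m\<close>.
  Detached from \<open>f\<close>, it can be tested for openness at every pair \<open>n\<close>,
  \<open>m\<close>.\<close>

definition bounded_set :: "nat \<Rightarrow> nat \<Rightarrow> nat set \<Rightarrow> (nat \<times> nat) set set"
  where "bounded_set n m X = {g \<in> \<I>. (infinite (Range g - X) \<or> n \<le> card (Range g - X)) \<and> card (X \<inter> Range g) \<le> m}"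

lemma openin_I2_large: "finite X \<Longrightarrow> openin topology_I2 {g \<in> \<I>. infinite (Range g - X) \<or> n \<le> card (Range g - X)}"
  unfolding openin_I2_iff
proof (intro conjI ballI)
  fix h assume "h \<in> {g \<in> \<I>. infinite (Range g - X) \<or> n \<le> card (Range g - X)}"
  then obtain S where S: "S \<subseteq> Range h - X" "finite S" "card S = n"
    using large_subset[of "Range h - X" n] by blast
  then obtain k where k: "\<And>g. g \<in> agree h k \<Longrightarrow> S \<subseteq> Range g" using agree_Range[of S h] by blast
  have "g \<in> {g \<in> \<I>. infinite (Range g - X) \<or> n \<le> card (Range g - X)}" if g: "g \<in> agree h k" for g
  proof -
    have "S \<subseteq> Range g - X" using k[OF g] S by blast
    then show ?thesis using S card_mono agree_sim[OF g] by blast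
  qed
  then show "\<exists>k. agree h k \<subseteq> {g \<in> \<I>. infinite (Range g - X) \<or> n \<le> card (Range g - X)}" by blast
qed blast

lemma openin_I2_hits: "openin topology_I2 {g \<in> \<I>. z \<in> Range g}"
  unfolding openin_I2_iff
proof (intro conjI ballI)
  fix h assume "h \<in> {g \<in> \<I>. z \<in> Range g}"
  then obtain k where "\<forall>g\<in>agree h k. {z} \<subseteq> Range g" using agree_Range[of "{z}" h] by blast
  then show "\<exists>k. agree h k \<subseteq> {g \<in> \<I>. z \<in> Range g}" using agree_sim by blast
qed blast

text \<open>Adding to \<open>X\<close> one image point \<open>z\<close> from outside lowers the
  outside count by one and raises the inside count by one.\<close>

lemma bounded_set_Suc:
  assumes "finite X"
  shows "bounded_set (Suc n) m X = (\<Union>z\<in>-X. bounded_set n (Suc m) (insert z X) \<inter> {g \<in> \<I>. z \<in> Range g})"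
proof (intro equalityI subsetI)
  fix g assume g: "g \<in> bounded_set (Suc n) m X"
  then have "Range g - X \<noteq> {}" by (metis (no_types, lifting) bounded_set_def card.empty finite.emptyI mem_Collect_eq not_less_eq_eq zero_le)
  then obtain z where z: "z \<in> Range g" "z \<notin> X" by blast
  have e: "Range g - insert z X = (Range g - X) - {z}" "insert z X \<inter> Range g = insert z (X \<inter> Range g)"
    using z by auto
  have "infinite (Range g - insert z X) \<or> n \<le> card (Range g - insert z X)"
    using g z unfolding e by (auto simp: bounded_set_def)
  moreover have "card (insert z X \<inter> Range g) \<le> Suc m"
    using g z assms unfolding e by (simp add: bounded_set_def)
  ultimately show "g \<in> (\<Union>z\<in>-X. bounded_set n (Suc m) (insert z X) \<inter> {g \<in> \<I>. z \<in> Range g})"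
    using g z by (intro UN_I[of z]) (auto simp: bounded_set_def)
next
  fix g assume "g \<in> (\<Union>z\<in>-X. bounded_set n (Suc m) (insert z X) \<inter> {g \<in> \<I>. z \<in> Range g})"
  then obtain z where z: "z \<notin> X" "z \<in> Range g" and g: "g \<in> bounded_set n (Suc m) (insert z X)" by blast
  have e: "Range g - X = insert z (Range g - insert z X)" "insert z X \<inter> Range g = insert z (X \<inter> Range g)"
    using z by auto
  have "infinite (Range g - X) \<or> Suc n \<le> card (Range g - X)"
    using g unfolding e(1) by (auto simp: bounded_set_def)
  moreover have "card (X \<inter> Range g) \<le> m"
    using g z assms unfolding bounded_set_def e(2) by simp
  ultimately show "g \<in> bounded_set (Suc n) m X" using g by (auto simp: bounded_set_def)
qed

section \<open>The waning function of a given topology\<close>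

context
  fixes T
  assumes T: "semigroup_topology T"
    and pair: "\<And>x y. openin T {h \<in> \<I>. (x, y) \<in> h}"
    and dom: "\<And>x. openin T {h \<in> \<I>. x \<notin> Domain h}"
    and coarse: "\<And>U s. openin T U \<Longrightarrow> s \<in> U \<Longrightarrow> \<exists>k. nbhd (\<lambda>_. 0) s k \<subseteq> U"
begin

lemma openin_T_agree: "h \<in> \<I> \<Longrightarrow> openin T (agree h k)"
  by (rule openin_agree[OF pair dom _ sg_topspace[OF T]])

lemma openin_T_I2: "openin topology_I2 V \<Longrightarrow> openin T V"
  by (rule openin_subopenI) (meson agree_refl openin_I2_iff openin_T_agree subsetD)

definition all_open :: "nat \<Rightarrow> nat \<Rightarrow> bool"
  where "all_open n m \<longleftrightarrow> (\<forall>X. finite X \<longrightarrow> openin T (bounded_set n m X))"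

lemma all_open_mono: "all_open n' m \<Longrightarrow> n' \<le> n \<Longrightarrow> all_open n m"
  unfolding all_open_def
proof (intro allI impI)
  fix X :: "nat set" assume *: "\<forall>X. finite X \<longrightarrow> openin T (bounded_set n' m X)" "n' \<le> n" "finite X"
  have "bounded_set n m X = bounded_set n' m X \<inter> {g \<in> \<I>. infinite (Range g - X) \<or> n \<le> card (Range g - X)}"
    using *(2) by (auto simp: bounded_set_def)
  then show "openin T (bounded_set n m X)"
    using * openin_T_I2[OF openin_I2_large[OF *(3)]] by (simp add: openin_Int)
qed

text \<open>This trade of one point of \<open>X\<close> for one point outside is what makes \<open>fT\<close> waning.\<close>
lemma all_open_Suc: "all_open n (Suc m) \<Longrightarrow> all_open (Suc n) m"
  unfolding all_open_def using openin_T_I2[OF openin_I2_hits]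
  by (auto simp: bounded_set_Suc intro!: openin_Int openin_Union)

text \<open>The infimum over all \<open>n\<close> up to \<open>e\<close> makes antitonicity
  immediate and gives the right value at infinity; over the empty set it is
  \<open>\<infinity>\<close>. At finite \<open>e\<close> it is the least \<open>m\<close> that is
  open for \<open>n = e\<close>, by \<open>all_open_mono\<close>.\<close>

definition fT :: "enat \<Rightarrow> enat"
  where "fT e = Inf {enat m | m n. enat n \<le> e \<and> all_open n m}"

lemma fT_le: "enat n \<le> e \<Longrightarrow> all_open n m \<Longrightarrow> fT e \<le> enat m"
  unfolding fT_def by (rule Inf_lower) blast

lemma fT_eq:
  assumes "fT e = enat m" shows "\<exists>n. enat n \<le> e \<and> all_open n m"
proof -
  let ?S = "{enat m | m n. enat n \<le> e \<and> all_open n m}"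
  have "?S \<noteq> {}" using assms unfolding fT_def by (metis Inf_empty enat.distinct(1) top_enat_def)
  then obtain x where "x \<in> ?S" by blast
  then have "Inf ?S \<in> ?S" by (rule wellorder_InfI)
  then show ?thesis using assms unfolding fT_def by auto
qed

lemma fT_eq_nat: "fT (enat n) = enat m \<Longrightarrow> all_open n m"
  using fT_eq[of "enat n" m] all_open_mono by auto

lemma waning_fT: "waning fT"
  unfolding waning_def
proof (intro conjI)
  show "antimono fT"
    unfolding fT_def by (intro antimonoI Inf_superset_mono) (auto intro: order_trans)
  show "fT = (\<lambda>_. \<infinity>) \<or> (\<exists>i. fT (enat i) \<noteq> \<infinity>) \<and>
      (\<forall>j. fT (enat j) \<noteq> 0 \<and> fT (enat j) \<noteq> \<infinity> \<longrightarrow> fT (enat (j + 1)) < fT (enat j))"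
  proof (cases "\<exists>i. fT (enat i) \<noteq> \<infinity>")
    case True
    have "fT (enat (j + 1)) < fT (enat j)" if j: "fT (enat j) \<noteq> 0" "fT (enat j) \<noteq> \<infinity>" for j
    proof -
      obtain m where m: "fT (enat j) = enat m" using j(2) by auto
      then obtain m' where m': "m = Suc m'" using j(1) by (cases m) (auto simp: zero_enat_def)
      have "all_open (j + 1) m'" using all_open_Suc fT_eq_nat[OF m] m' by simp
      then have "fT (enat (j + 1)) \<le> enat m'" using fT_le by blast
      also have "\<dots> < enat m" using m' by simp
      finally show ?thesis using m by simp
    qed
    then show ?thesis using True by blast
  next
    case False
    have "fT e = \<infinity>" for e
    proof (rule ccontr)
      assume "fT e \<noteq> \<infinity>"
      then obtain m where "fT e = enat m" by auto
      then obtain n where "all_open n m" using fT_eq by blast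
      then have "fT (enat n) \<le> enat m" using fT_le by blast
      then show False using False by auto
    qed
    then show ?thesis by auto
  qed
qed

lemma topology_fT_coarser: "openin (topology_f fT) V \<Longrightarrow> openin T V"
proof -
  assume "openin (topology_f fT) V"
  then have "generate_topology_on ({U. openin topology_I2 U} \<union> {U_set fT n X |n X. finite X}) V"
    by (simp add: topology_f_def openin_topology_generated_by_iff)
  then show "openin T V"
  proof induction
    case (Basis s)
    then consider "openin topology_I2 s" | n X where "s = U_set fT n X" "finite X" by blast
    then show ?case
    proof cases
      case 1
      then show ?thesis by (rule openin_T_I2)
    next
      case (2 n X)
      show ?thesis
      proof (cases "fT (enat n)")
        case (enat m)
        then have "U_set fT n X = bounded_set n m X" by (auto simp: U_set_def bounded_set_def)
        then show ?thesis using fT_eq_nat[OF enat] 2 by (simp add: all_open_def)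
      next
        case infinity
        then have "U_set fT n X = {g \<in> \<I>. infinite (Range g - X) \<or> n \<le> card (Range g - X)}"
          by (auto simp: U_set_def)
        then show ?thesis using openin_T_I2[OF openin_I2_large] 2 by simp
      qed
    qed
  qed auto
qed

text \<open>Quantifying over all \<open>h\<close> of rank \<open>r\<close> and all \<open>L\<close>
  of size \<open>d\<close> builds in homogeneity. Asking for true extensions of \<open>h\<close>
  with exactly the prescribed image allows jumps to be composed.\<close>

definition rank_jump :: "nat \<Rightarrow> nat \<Rightarrow> bool"
  where "rank_jump r d \<longleftrightarrow> (\<forall>h L U. h \<in> \<I> \<longrightarrow> finite (Range h) \<longrightarrow> card (Range h) = r \<longrightarrow>
    finite L \<longrightarrow> card L = d \<longrightarrow> L \<inter> Range h = {} \<longrightarrow> openin T U \<longrightarrow> h \<in> U \<longrightarrow>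
    (\<exists>g\<in>U. h \<subseteq> g \<and> Range g = Range h \<union> L))"

lemma rank_jumpD:
  assumes "rank_jump r d" "h \<in> \<I>" "finite (Range h)" "card (Range h) = r" "finite L" "card L = d" "L \<inter> Range h = {}"
    "openin T U" "h \<in> U"
  obtains g where "g \<in> U" "h \<subseteq> g" "Range g = Range h \<union> L"
  using assms unfolding rank_jump_def by metis

lemma rank_jump_0: "rank_jump r 0"
  unfolding rank_jump_def by auto

text \<open>The first jump ends inside the open set \<open>U\<close> again, at rank
  \<open>r + d\<close>, so the second one can start there with the same \<open>U\<close>.\<close>

lemma rank_jump_trans:
  assumes 1: "rank_jump r d" and 2: "rank_jump (r + d) e" shows "rank_jump r (d + e)"
  unfolding rank_jump_def
proof (intro allI impI)
  fix h L U
  assume h: "h \<in> \<I>" "finite (Range h)" "card (Range h) = r" and L: "finite L" "card L = d + e" "L \<inter> Range h = {}"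
    and U: "openin T U" "h \<in> U"
  obtain L1 where L1: "L1 \<subseteq> L" "card L1 = d" "finite L1"
    using L(2) obtain_subset_with_card_n[of d L] by auto
  obtain g1 where g1: "g1 \<in> U" "h \<subseteq> g1" "Range g1 = Range h \<union> L1"
    using L1 L h U by (elim rank_jumpD[OF 1, of h L1 U]) auto
  have "card (Range g1) = r + d" unfolding g1(3) using h L L1 by (subst card_Un_disjoint) auto
  moreover have "card (L - L1) = e" using L L1 by (simp add: card_Diff_subset)
  moreover have "g1 \<in> \<I>" using sg_open_sub[OF T U(1)] g1(1) by blast
  ultimately obtain g where "g \<in> U" "g1 \<subseteq> g" "Range g = Range g1 \<union> (L - L1)"
    using g1 L1 L h U by (elim rank_jumpD[OF 2, of g1 "L - L1" U]) auto
  then show "\<exists>g\<in>U. h \<subseteq> g \<and> Range g = Range h \<union> L" using g1 L1 by (intro bexI[of _ g]) auto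
qed

text \<open>
  Some point of the non-open set is a limit of elements with more than \<open>m\<close> image points in \<open>X\<close>.
  Multiplying by suitable finite partial bijections moves this limit to any other place.
\<close>
lemma not_all_open_rank_jump:
  assumes no: "\<not> all_open r m"
  shows "\<exists>k\<le>m. \<forall>a d. a \<le> r + k \<longrightarrow> d \<le> Suc m - k \<longrightarrow> rank_jump a d"
proof -
  obtain X where X: "finite X" "\<not> openin T (bounded_set r m X)" using no unfolding all_open_def by blast
  obtain h1 where h1: "h1 \<in> bounded_set r m X" "\<And>W. openin T W \<Longrightarrow> h1 \<in> W \<Longrightarrow> \<not> W \<subseteq> bounded_set r m X"
    using X(2) openin_subopenI[of "bounded_set r m X" T] by blast
  have h1I: "h1 \<in> \<I>" using h1(1) by (simp add: bounded_set_def)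
  define K where "K = X \<inter> Range h1"
  have K: "finite K" "card K \<le> m" using X(1) h1(1) by (auto simp: K_def bounded_set_def)
  obtain R where R: "R \<subseteq> Range h1 - X" "finite R" "card R = r"
    using h1(1) large_subset[of "Range h1 - X" r] unfolding bounded_set_def by blast
  define h2 where "h2 = {(x, y) \<in> h1. y \<in> R \<union> K}"
  have h2: "h2 \<subseteq> h1" "Range h2 = R \<union> K" using R by (auto simp: h2_def K_def)
  have h2I: "h2 \<in> \<I>" using sim_subset[OF h1I h2(1)] .
  have cRK: "card (R \<union> K) = r + card K" using R K by (subst card_Un_disjoint) (auto simp: K_def)
  have "finite (Domain h2)" using finite_sim[OF h2I] h2(2) R K by (simp add: finite_Domain)
  then obtain k0 where k0: "Domain h2 \<subseteq> {..<k0}" using finite_nat_iff_bounded by blast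
  have agr: "h2 \<subseteq> g" if "g \<in> agree h1 k0" for g
  proof (rule subrelI)
    fix x y assume xy: "(x, y) \<in> h2"
    then have "x < k0" using k0 by blast
    then show "(x, y) \<in> g" using agree_iff[OF that] xy h2(1) by blast
  qed
  have "rank_jump a d" if a: "a \<le> r + card K" and d: "d \<le> Suc m - card K" for a d
    unfolding rank_jump_def
  proof (intro allI impI)
    fix h L U
    assume h: "h \<in> \<I>" "finite (Range h)" "card (Range h) = a" and L: "finite L" "card L = d" "L \<inter> Range h = {}"
      and U: "openin T U" "h \<in> U"
    obtain R2 where R2: "R2 \<subseteq> R \<union> K" "card R2 = a" "finite R2"
      using a cRK obtain_subset_with_card_n[of a "R \<union> K"] by auto
    \<comment> \<open>Which \<open>d\<close> points of \<open>X - K\<close> an element near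
      \<open>h1\<close> gains is not known beforehand. There are finitely many candidates, each with
      its own pair of multipliers, and \<open>W\<close> provides for all of them.\<close>
    define \<L> where "\<L> = {L'. L' \<subseteq> X - K \<and> card L' = d}"
    have "\<L> \<subseteq> Pow X" by (auto simp: \<L>_def)
    then have fin: "finite \<L>" using X(1) finite_subset by blast
    define P where "P L' a b \<longleftrightarrow> a \<in> \<I> \<and> b \<in> \<I> \<and>
      (\<forall>g\<in>\<I>. h2 \<subseteq> g \<longrightarrow> L' \<subseteq> Range g \<longrightarrow> h \<subseteq> a O g O b \<and> Range (a O g O b) = Range h \<union> L) \<and>
      (\<forall>g\<in>\<I>. h2 \<subseteq> g \<longrightarrow> Range g \<inter> L' = {} \<longrightarrow> a O g O b = h)" for L' a b
    have "\<exists>a b. P L' a b" if L': "L' \<in> \<L>" for L'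
    proof -
      have "finite L'" "L' \<inter> R2 = {}" "card L' = card L"
        using L' X(1) L(2) R2(1) R(1) by (auto simp: \<L>_def intro: finite_subset)
      then show ?thesis
        using transport_finite_rank[OF h(1,2) h2I, of R2 L L'] R2 h2(2) h(3) L unfolding P_def by auto
    qed
    then obtain lm rh where lmrh: "\<And>L'. L' \<in> \<L> \<Longrightarrow> P L' (lm L') (rh L')" by metis
    have multI: "lm L' \<in> \<I>" "rh L' \<in> \<I>" if "L' \<in> \<L>" for L'
      using lmrh[OF that] by (simp_all add: P_def)
    have hit: "h \<subseteq> lm L' O g O rh L' \<and> Range (lm L' O g O rh L') = Range h \<union> L"
      if "L' \<in> \<L>" "g \<in> \<I>" "h2 \<subseteq> g" "L' \<subseteq> Range g" for L' g
      using lmrh[OF that(1), unfolded P_def, THEN conjunct2, THEN conjunct2, THEN conjunct1, rule_format, OF that(2-4)] .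
    have miss: "lm L' O g O rh L' = h"
      if "L' \<in> \<L>" "g \<in> \<I>" "h2 \<subseteq> g" "Range g \<inter> L' = {}" for L' g
      using lmrh[OF that(1), unfolded P_def, THEN conjunct2, THEN conjunct2, THEN conjunct2, rule_format, OF that(2-4)] .
    define W where "W = \<Inter>(insert (agree h1 k0) ((\<lambda>L'. {g \<in> \<I>. lm L' O g O rh L' \<in> U}) ` \<L>))"
    have "openin T W" unfolding W_def
      using fin openin_T_agree[OF h1I] openin_translate[OF T U(1)] multI by (intro openin_Inter) auto
    moreover have "h1 \<in> W"
    proof -
      have "lm L' O h1 O rh L' = h" if "L' \<in> \<L>" for L'
        using that by (intro miss[OF that h1I h2(1)]) (auto simp: \<L>_def K_def)
      then show ?thesis using h1I agree_refl[OF h1I] U(2) by (auto simp: W_def)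
    qed
    ultimately obtain g where g: "g \<in> W" "g \<notin> bounded_set r m X" using h1(2) by blast
    have ga: "g \<in> agree h1 k0" and gU: "\<And>L'. L' \<in> \<L> \<Longrightarrow> lm L' O g O rh L' \<in> U"
      using g(1) by (auto simp: W_def)
    have gI: "g \<in> \<I>" and hg: "h2 \<subseteq> g" using agr[OF ga] agree_sim[OF ga] by auto
    have RK: "R \<union> K \<subseteq> Range g" using Range_mono[OF hg] h2(2) by simp
    \<comment> \<open>Elements of \<open>W\<close> keep the \<open>r\<close> image points
      \<open>R\<close> outside \<open>X\<close>, so \<open>g\<close> can leave
      \<open>bounded_set r m X\<close> only by hitting more than \<open>m\<close> points of
      \<open>X\<close>.\<close>
    then have "R \<subseteq> Range g - X" using R by blast
    then have "infinite (Range g - X) \<or> r \<le> card (Range g - X)" using R card_mono by blast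
    then have "m < card (X \<inter> Range g)" using g(2) gI by (auto simp: bounded_set_def)
    moreover have "K \<subseteq> X \<inter> Range g" using RK by (auto simp: K_def)
    ultimately have "d \<le> card (X \<inter> Range g - K)" using K d by (subst card_Diff_subset) auto
    then obtain L' where L': "L' \<subseteq> X \<inter> Range g - K" "card L' = d" using obtain_subset_with_card_n by metis
    then have "L' \<in> \<L>" by (auto simp: \<L>_def)
    then show "\<exists>g\<in>U. h \<subseteq> g \<and> Range g = Range h \<union> L"
      using hit[OF _ gI hg] gU L' by (meson Diff_subset Int_subset_iff order_trans)
  qed
  then show ?thesis using K(2) by blast
qed

text \<open>For an unknown \<open>k \<le> m\<close>, jumps of up to \<open>Suc m - k\<close> points
  are available from every rank up to \<open>r + k\<close>. Single steps are always among them: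
  \<open>k\<close> of these lead to rank \<open>r + k\<close>, and one last jump supplies the
  remaining \<open>Suc m - k\<close> points.\<close>

lemma rank_jump_fT:
  assumes "enat d \<le> fT (enat r)" shows "rank_jump r d"
proof (cases d)
  case (Suc m)
  have "\<not> all_open r m"
  proof
    assume "all_open r m"
    then have "fT (enat r) \<le> enat m" using fT_le by blast
    then have "enat d \<le> enat m" using assms by order
    then show False using Suc by simp
  qed
  then obtain k where k: "k \<le> m" "\<And>a d. a \<le> r + k \<Longrightarrow> d \<le> Suc m - k \<Longrightarrow> rank_jump a d"
    using not_all_open_rank_jump by blast
  have "rank_jump r j" if "j \<le> k" for j
    using that
  proof (induction j)
    case (Suc j)
    have "rank_jump (r + j) 1" using k(1) Suc(2) by (intro k(2)) auto
    then have "rank_jump r (j + 1)" using Suc by (intro rank_jump_trans) auto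
    then show ?case by simp
  qed (rule rank_jump_0)
  then have "rank_jump r k" by simp
  moreover have "rank_jump (r + k) (Suc m - k)" by (rule k(2)) auto
  ultimately have "rank_jump r (k + (Suc m - k))" by (rule rank_jump_trans)
  then show ?thesis using Suc k(1) by simp
qed (simp add: rank_jump_0)

text \<open>The identity has full image, so its neighbourhoods in \<open>\<T>\<^sub>0\<close> put no
  condition on image points.\<close>

lemma Id_nbhd:
  assumes "openin T W" "Id \<in> W"
  shows "\<exists>k. \<forall>w\<in>\<I>. (\<forall>x<k. (x, x) \<in> w) \<longrightarrow> w \<in> W"
proof -
  obtain k where k: "nbhd (\<lambda>_. 0) Id k \<subseteq> W" using coarse assms by blast
  have "w \<in> nbhd (\<lambda>_. 0) Id k" if w: "w \<in> \<I>" "\<forall>x<k. (x, x) \<in> w" for w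
  proof -
    have "w \<in> agree Id k"
    proof (rule agreeI[OF w(1)])
      fix x y assume "x < k"
      then show "(x, y) \<in> w \<longleftrightarrow> (x, y) \<in> Id" using w simD1[OF w(1)] by blast
    qed
    moreover have "{..<k} \<inter> Range w - Range Id = {}" by auto
    ultimately show ?thesis by (simp add: nbhd_def flip: zero_enat_def)
  qed
  then show ?thesis using k by blast
qed

text \<open>
  Near \<open>h\<close> there is some \<open>g'\<close> with the same new image points \<open>L\<close> below \<open>k\<close> as \<open>g\<close>, though with other
  preimages. As \<open>T\<close> is contained in \<open>\<T>\<^sub>0\<close>, all other pairs of \<open>g\<close> can be added to \<open>g'\<close> far from the origin;
  factors \<open>w1\<close>, \<open>w2\<close> close to the identity then bring all pairs to their places: \<open>g = w1 g'' w2\<close>.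
\<close>
lemma nbhd_fT_finite:
  assumes U: "openin T U" "h \<in> U" and fin: "finite (Range h)"
  shows "\<exists>k. nbhd fT h k \<subseteq> U"
proof -
  have hI: "h \<in> \<I>" using sg_open_sub[OF T U(1)] U(2) by blast
  have hI': "h O Id \<in> \<I>" and U2: "Id O (h O Id) \<in> U" using hI U(2) by auto
  obtain W1 B where WB: "openin T W1" "openin T B" "Id \<in> W1" "h O Id \<in> B"
      "\<And>a b. a \<in> W1 \<Longrightarrow> b \<in> B \<Longrightarrow> a O b \<in> U"
    using sg_mult[OF T U(1) sim_Id hI' U2] by metis
  obtain U' W2 where UW: "openin T U'" "openin T W2" "h \<in> U'" "Id \<in> W2"
      "\<And>a b. a \<in> U' \<Longrightarrow> b \<in> W2 \<Longrightarrow> a O b \<in> B"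
    using sg_mult[OF T WB(2) hI sim_Id WB(4)] by metis
  obtain k1 where k1: "\<forall>w\<in>\<I>. (\<forall>x<k1. (x, x) \<in> w) \<longrightarrow> w \<in> W1" using Id_nbhd[OF WB(1,3)] by blast
  obtain k2 where k2: "\<forall>w\<in>\<I>. (\<forall>x<k2. (x, x) \<in> w) \<longrightarrow> w \<in> W2" using Id_nbhd[OF UW(2,4)] by blast
  have "finite (Domain h \<union> Range h)" using finite_sim[OF hI fin] fin by (simp add: finite_Domain)
  then obtain k3 where k3: "Domain h \<union> Range h \<subseteq> {..<k3}" using finite_nat_iff_bounded by blast
  define k where "k = max (max k1 k2) k3"
  have hk: "x < k \<and> y < k" if "(x, y) \<in> h" for x y
    using k3 that by (force simp: k_def)
  have "g \<in> U" if g: "g \<in> nbhd fT h k" for g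
  proof -
    have ga: "g \<in> agree h k" and gI: "g \<in> \<I>" using g by (auto simp: nbhd_def agree_def)
    define L where "L = {..<k} \<inter> Range g - Range h"
    have "enat (card L) \<le> fT (enat (card (Range h)))" using g fin by (simp add: nbhd_def L_def rank_def)
    then have "rank_jump (card (Range h)) (card L)" by (rule rank_jump_fT)
    moreover have "openin T (U' \<inter> agree h k)" using UW(1) openin_T_agree[OF hI] by blast
    moreover have "h \<in> U' \<inter> agree h k" using UW(3) agree_refl[OF hI] by blast
    moreover have "finite L" "L \<inter> Range h = {}" by (auto simp: L_def)
    ultimately obtain g' where g': "g' \<in> U' \<inter> agree h k" "h \<subseteq> g'" "Range g' = Range h \<union> L"
      using hI fin by (elim rank_jumpD[of _ _ h L "U' \<inter> agree h k"]) auto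
    have g'I: "g' \<in> \<I>" and g'a: "g' \<in> agree h k" using g'(1) agree_sim by blast+
    obtain k0 where k0: "nbhd (\<lambda>_. 0) g' k0 \<subseteq> U'" using coarse[OF UW(1)] g'(1) by blast
    have "finite (Domain g')" using finite_sim[OF g'I] g'(3) fin by (simp add: finite_Domain L_def)
    then obtain k4 where k4: "Domain g' \<subseteq> {..<k4}" using finite_nat_iff_bounded by blast
    define k' where "k' = max (max k0 k4) k"
    have kk': "k0 \<le> k'" "k4 \<le> k'" "k \<le> k'" by (auto simp: k'_def)
    have g'k: "x < k' \<and> y < k" if "(x, y) \<in> g'" for x y
    proof -
      have "x < k4" using k4 that by blast
      moreover have "y \<in> Range h \<union> L" using that g'(3) by blast
      then have "y < k" using hk by (auto simp: L_def)
      ultimately show ?thesis using kk' by simp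
    qed
    have F1: "(x, y) \<in> h" if "(x, y) \<in> g" "x < k" for x y using agree_iff[OF ga] that by blast
    have F1': "(x, y) \<in> h" if "(x, y) \<in> g'" "x < k" for x y using agree_iff[OF g'a] that by blast
    have hg: "(x, y) \<in> g" if "(x, y) \<in> h" for x y using agree_iff[OF ga] that hk by blast
    have F2: "k \<le> x" if "(x, l) \<in> g" "l \<in> L" for x l
      using F1[OF that(1)] that(2) unfolding L_def by (meson DiffD2 RangeI not_le)
    have F4: "k \<le> x" if "(x, l) \<in> g'" "l \<in> L" for x l
      using F1'[OF that(1)] that(2) unfolding L_def by (meson DiffD2 RangeI not_le)
    have F3: "k \<le> x" if "(x, y) \<in> g" "k \<le> y" for x y
      using F1[OF that(1)] hk that(2) by (meson not_le)
    have Lk: "l < k" if "l \<in> L" for l using that by (simp add: L_def)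
    \<comment> \<open>\<open>w1\<close> treats \<open>x\<close> by its value under \<open>g\<close>:
      if this lies in \<open>L\<close>, \<open>x\<close> goes to the preimage that \<open>g'\<close>
      uses; if it is at least \<open>k\<close>, \<open>x\<close> is parked at \<open>k' + x\<close>.
      Both kinds of \<open>x\<close> are at least \<open>k\<close>, so there is no clash with the
      identity below \<open>k\<close>.\<close>
    define w1 where "w1 = Id_on {..<k} \<union> {(x, z). \<exists>l\<in>L. (x, l) \<in> g \<and> (z, l) \<in> g'} \<union> {(x, k' + x) | x y. (x, y) \<in> g \<and> k \<le> y}"
    \<comment> \<open>The added pairs are shifted by \<open>k'\<close> on both sides: in the domain
      so as not to disturb \<open>g'\<close> near the origin, in the image because a neighbourhood
      of \<open>g'\<close> in \<open>\<T>\<^sub>0\<close> forbids new image points below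
      \<open>k0\<close>. \<open>w2\<close> undoes the shift of the image.\<close>
    define g'' where "g'' = g' \<union> {(k' + x, k' + y) | x y. (x, y) \<in> g \<and> k \<le> y}"
    define w2 where "w2 = Id_on {..<k} \<union> {(k' + y, y) | y. k \<le> y}"
    have w1: "(x, z) \<in> w1 \<longleftrightarrow> (x < k \<and> z = x) \<or> (\<exists>l\<in>L. (x, l) \<in> g \<and> (z, l) \<in> g') \<or> (z = k' + x \<and> (\<exists>y\<ge>k. (x, y) \<in> g))" for x z
      by (auto simp: w1_def)
    have g'': "(x, y) \<in> g'' \<longleftrightarrow> (x, y) \<in> g' \<or> (\<exists>u v. x = k' + u \<and> y = k' + v \<and> (u, v) \<in> g \<and> k \<le> v)" for x y
      by (auto simp: g''_def)
    have w2: "(x, y) \<in> w2 \<longleftrightarrow> (x < k \<and> y = x) \<or> (x = k' + y \<and> k \<le> y)" for x y by (auto simp: w2_def)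
    have "w1 \<in> \<I>"
    proof (rule simI)
      fix x y z assume xy: "(x, y) \<in> w1" and xz: "(x, z) \<in> w1"
      consider "x < k" | "k \<le> x" by linarith
      then show "y = z"
      proof cases
        case 1
        have "y = x" if "(x, y) \<in> w1" for y using that 1 F2 F3 unfolding w1 by (meson not_le)
        then show ?thesis using xy xz by blast
      next
        case 2
        have c: "(\<exists>l\<in>L. (x, l) \<in> g \<and> (z, l) \<in> g') \<or> (z = k' + x \<and> (\<exists>y\<ge>k. (x, y) \<in> g))"
          if "(x, z) \<in> w1" for z using that 2 unfolding w1 by (meson not_le)
        have "\<not> (l \<in> L \<and> (x, l) \<in> g \<and> k \<le> v \<and> (x, v) \<in> g)" for l v
          using simD1[OF gI, of x l v] Lk by (metis not_le)
        then show ?thesis using c[OF xy] c[OF xz] simD1[OF gI] simD2[OF g'I] by metis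
      qed
    next
      fix x y z assume xz: "(x, z) \<in> w1" and yz: "(y, z) \<in> w1"
      consider "z < k" | "k \<le> z" "z < k'" | "k' \<le> z" by linarith
      then show "x = y"
      proof cases
        case 1
        have "x = z" if "(x, z) \<in> w1" for x
        proof -
          have "z \<noteq> k' + x" using 1 kk' by linarith
          moreover have "\<not> (l \<in> L \<and> (z, l) \<in> g')" for l using F4[of z l] 1 by linarith
          ultimately show ?thesis using that unfolding w1 by blast
        qed
        then show ?thesis using xz yz by blast
      next
        case 2
        have "\<exists>l\<in>L. (x, l) \<in> g \<and> (z, l) \<in> g'" if "(x, z) \<in> w1" for x
          using that 2 unfolding w1 by auto
        then show ?thesis using xz yz simD1[OF g'I] simD2[OF gI] by metis
      next
        case 3
        have "z = k' + x" if "(x, z) \<in> w1" for x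
          using that 3 g'k kk' unfolding w1 by (meson le_trans not_le)
        from this[OF xz] this[OF yz] show ?thesis by simp
      qed
    qed
    moreover have "\<forall>x<k1. (x, x) \<in> w1" by (auto simp: w1 k_def)
    ultimately have w1W: "w1 \<in> W1" using k1 by blast
    have "w2 \<in> \<I>" by (rule simI) (use kk' in \<open>auto simp: w2\<close>)
    moreover have "\<forall>x<k2. (x, x) \<in> w2" by (auto simp: w2 k_def)
    ultimately have w2W: "w2 \<in> W2" using k2 by blast
    have "g'' \<in> \<I>"
    proof (rule simI)
      fix x y z assume "(x, y) \<in> g''" "(x, z) \<in> g''"
      then show "y = z" unfolding g'' using g'k simD1[OF g'I] simD1[OF gI]
        by (metis add_left_cancel le_add1 not_le)
    next
      fix x y z assume "(x, z) \<in> g''" "(y, z) \<in> g''"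
      moreover have "\<not> ((u, z) \<in> g' \<and> z = k' + w)" for u w
        using g'k[of u z] kk' by linarith
      ultimately show "x = y" unfolding g'' using simD2[OF g'I, of x z y] simD2[OF gI]
        by (metis add_left_cancel)
    qed
    then have "g'' \<in> agree g' k0"
    proof (rule agreeI)
      fix x y assume "x < k0"
      then show "(x, y) \<in> g'' \<longleftrightarrow> (x, y) \<in> g'" unfolding g'' using kk' by auto
    qed
    moreover have "{..<k0} \<inter> Range g'' - Range g' = {}" using kk' by (auto simp: g'')
    then have "enat (card ({..<k0} \<inter> Range g'' - Range g')) \<le> 0"
      by (simp only: card.empty zero_enat_def[symmetric])
    ultimately have "g'' \<in> U'" using k0 by (auto simp: nbhd_def)
    then have inU: "w1 O (g'' O w2) \<in> U" using WB(5) UW(5) w1W w2W by blast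
    have "w1 O (g'' O w2) = g"
    proof (rule equalityI; rule subrelI)
      fix x y assume "(x, y) \<in> w1 O (g'' O w2)"
      then obtain a b where ab: "(x, a) \<in> w1" "(a, b) \<in> g''" "(b, y) \<in> w2" by blast
      have small: "y = b" if "b < k" using ab(3) that kk' unfolding w2 by auto
      from ab(1) consider "x < k" "a = x" | l where "l \<in> L" "(x, l) \<in> g" "(a, l) \<in> g'"
        | v where "a = k' + x" "k \<le> v" "(x, v) \<in> g" unfolding w1 by blast
      then show "(x, y) \<in> g"
      proof cases
        case 1
        then have "(a, b) \<in> g'" using ab(2) kk' unfolding g'' by auto
        then have "(a, b) \<in> h" using F1' 1 by blast
        then show ?thesis using small hk hg 1 by blast
      next
        case 2
        have "a < k'" using g'k 2 by blast
        then have "(a, b) \<in> g'" using ab(2) unfolding g'' by auto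
        then have "b = l" using 2 simD1[OF g'I] by blast
        then show ?thesis using small Lk 2 by blast
      next
        case 3
        have "(a, b) \<notin> g'" using g'k 3 by (meson le_add1 not_le)
        then obtain v' where v': "b = k' + v'" "(x, v') \<in> g" "k \<le> v'" using ab(2) 3 unfolding g'' by auto
        then have "y = v'" using ab(3) kk' unfolding w2 by auto
        then show ?thesis using v' by blast
      qed
    next
      fix x y assume xy: "(x, y) \<in> g"
      consider "k \<le> y" | "y \<in> Range h" | "y \<in> L" using xy by (force simp: L_def)
      then show "(x, y) \<in> w1 O (g'' O w2)"
      proof cases
        case 1
        then have "(x, k' + x) \<in> w1" "(k' + x, k' + y) \<in> g''" "(k' + y, y) \<in> w2"
          using xy unfolding w1 g'' w2 by blast+
        then show ?thesis by blast
      next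
        case 2
        then obtain x' where x': "(x', y) \<in> h" by blast
        then have "x' = x" using hg xy simD2[OF gI] by blast
        then have "(x, x) \<in> w1" "(x, y) \<in> g''" "(y, y) \<in> w2"
          using x' hk g'(2) unfolding w1 g'' w2 by blast+
        then show ?thesis by blast
      next
        case 3
        then obtain z where z: "(z, y) \<in> g'" using g'(3) by blast
        then have "(x, z) \<in> w1" "(z, y) \<in> g''" "(y, y) \<in> w2"
          using xy 3 Lk unfolding w1 g'' w2 by blast+
        then show ?thesis by blast
      qed
    qed
    then show ?thesis using inU by simp
  qed
  then show ?thesis by blast
qed

text \<open>This settles points of infinite rank. A long cut \<open>h0\<close> of \<open>h\<close>
  is near \<open>h\<close> in \<open>\<T>\<^sub>0\<close> and has finite rank, so the finite case
  applies to it, with no bound on new image points. The rest of \<open>g\<close> is appended to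
  \<open>h0\<close> with its domain moved far away, and the factor \<open>w\<close> near the
  identity moves it back.\<close>

lemma nbhd_fT_const:
  assumes U: "openin T U" "h \<in> U" and const: "fT = (\<lambda>_. \<infinity>)"
  shows "\<exists>k. agree h k \<subseteq> U"
proof -
  have hI: "h \<in> \<I>" using sg_open_sub[OF T U(1)] U(2) by blast
  have U2: "Id O h \<in> U" using U(2) by simp
  obtain W B where WB: "openin T W" "openin T B" "Id \<in> W" "h \<in> B" "\<And>a b. a \<in> W \<Longrightarrow> b \<in> B \<Longrightarrow> a O b \<in> U"
    using sg_mult[OF T U(1) sim_Id hI U2] by metis
  obtain k1 where k1: "\<forall>w\<in>\<I>. (\<forall>x<k1. (x, x) \<in> w) \<longrightarrow> w \<in> W" using Id_nbhd[OF WB(1,3)] by blast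
  obtain k2 where k2: "nbhd (\<lambda>_. 0) h k2 \<subseteq> B" using coarse WB by blast
  define s where "s = max k1 k2"
  define h0 where "h0 = cut h s"
  have h0I: "h0 \<in> \<I>" unfolding h0_def using sim_subset[OF hI cut_subset] .
  have "h0 \<in> agree h k2" using h0I by (intro agreeI) (auto simp: h0_def cut_def s_def)
  moreover have "{..<k2} \<inter> Range h0 - Range h = {}" using Range_mono[OF cut_subset[of h s]] by (auto simp: h0_def)
  then have "enat (card ({..<k2} \<inter> Range h0 - Range h)) \<le> 0"
    by (simp only: card.empty zero_enat_def[symmetric])
  ultimately have "h0 \<in> B" using k2 by (auto simp: nbhd_def)
  moreover have "finite (Range h0)" unfolding h0_def by (rule finite_cut[OF hI])
  ultimately obtain k3 where k3: "nbhd fT h0 k3 \<subseteq> B" using nbhd_fT_finite[OF WB(2)] by blast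
  define s' where "s' = max s k3"
  have "g \<in> U" if g: "g \<in> agree h s" for g
  proof -
    have gI: "g \<in> \<I>" using agree_sim[OF g] .
    have h0g: "(x, y) \<in> h0 \<longleftrightarrow> x < s \<and> (x, y) \<in> g" for x y
      using agree_iff[OF g, of x y] by (auto simp: h0_def cut_def)
    define w where "w = Id_on {..<s} \<union> {(x, s' + x) | x. s \<le> x}"
    define g' where "g' = h0 \<union> {(s' + x, y) | x y. (x, y) \<in> g \<and> s \<le> x}"
    have w: "(x, z) \<in> w \<longleftrightarrow> (x < s \<and> z = x) \<or> (s \<le> x \<and> z = s' + x)" for x z by (auto simp: w_def)
    have g': "(z, y) \<in> g' \<longleftrightarrow> (z < s \<and> (z, y) \<in> g) \<or> (\<exists>x\<ge>s. z = s' + x \<and> (x, y) \<in> g)" for z y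
      by (auto simp: g'_def h0g)
    have ss: "s \<le> s'" "k3 \<le> s'" "k1 \<le> s" by (auto simp: s'_def s_def)
    have "w \<in> \<I>" by (rule simI) (use ss in \<open>auto simp: w\<close>)
    then have wW: "w \<in> W" using k1 ss by (auto simp: w)
    have "g' \<in> \<I>"
    proof (rule simI)
      fix x y z assume "(x, y) \<in> g'" "(x, z) \<in> g'"
      then show "y = z" unfolding g' using ss simD1[OF gI] by (metis add_left_cancel le_add1 not_le order_trans)
    next
      fix x y z assume "(x, z) \<in> g'" "(y, z) \<in> g'"
      then show "x = y" unfolding g' using simD2[OF gI] by (metis not_le)
    qed
    then have "g' \<in> agree h0 k3"
    proof (rule agreeI)
      fix x y assume "x < k3"
      then show "(x, y) \<in> g' \<longleftrightarrow> (x, y) \<in> h0" unfolding g' h0g using ss by auto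
    qed
    then have "g' \<in> B" using k3 const by (auto simp: nbhd_def)
    then have inU: "w O g' \<in> U" using WB(5) wW by blast
    have "(x, y) \<in> w O g' \<longleftrightarrow> (x, y) \<in> g" for x y
    proof -
      have "(x, y) \<in> w O g' \<longleftrightarrow> (x < s \<and> (x, y) \<in> g') \<or> (s \<le> x \<and> (s' + x, y) \<in> g')"
        unfolding relcomp_unfold by (auto simp: w)
      also have "\<dots> \<longleftrightarrow> (x, y) \<in> g" unfolding g' using ss by (cases "x < s") auto
      finally show ?thesis .
    qed
    then have "w O g' = g" by auto
    then show ?thesis using inU by simp
  qed
  then show ?thesis by blast
qed

lemma eq_topology_fT: "T = topology_f fT"
  unfolding topology_eq
proof (intro allI iffI)
  fix U assume U: "openin T U"
  have "\<exists>k. nbhd fT h k \<subseteq> U" if h: "h \<in> U" for h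
  proof (cases "finite (Range h)")
    case True
    then show ?thesis using nbhd_fT_finite U h by blast
  next
    case False
    then have r: "rank h = \<infinity>" by (simp add: rank_def)
    show ?thesis
    proof (cases "fT = (\<lambda>_. \<infinity>)")
      case True
      then show ?thesis using nbhd_fT_const[OF U h True] nbhd_subset_agree by blast
    next
      case nc: False
      \<comment> \<open>At infinite rank the bound is zero, so the neighbourhoods coincide with
        those of \<open>\<T>\<^sub>0\<close>, and \<open>coarse\<close> applies directly.\<close>
      then have "fT \<infinity> = 0" using waning_infinity[OF waning_fT] by blast
      then have "nbhd fT h k = nbhd (\<lambda>_. 0) h k" for k using r by (simp add: nbhd_def)
      then show ?thesis using coarse[OF U h] by simp
    qed
  qed
  then show "openin (topology_f fT) U" using openin_topology_f[OF waning_fT] sg_open_sub[OF T U] by blast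
qed (rule topology_fT_coarser)

end

lemma I2_finer_classification:
  assumes T: "semigroup_topology T" and t1: "t1_space T" and sc: "second_countable T"
    and dom: "\<And>x. openin T {h \<in> \<I>. x \<notin> Domain h}"
  shows "\<exists>f. waning f \<and> T = topology_f f"
proof -
  note hyps = T openin_pair[OF T t1] dom second_countable_coarser[OF T sc]
  show ?thesis using waning_fT[OF hyps] eq_topology_fT[OF hyps] by blast
qed

theorem theorem2p3:
  shows "(\<forall>T :: (nat \<times> nat) set topology.
            semigroup_topology T \<and> t1_space T \<and> second_countable T \<longrightarrow>
            (\<exists>f :: enat \<Rightarrow> enat. waning f \<and> (T = topology_f f \<or> inv_topology T = topology_f f))) \<and>
         (\<forall>f g :: enat \<Rightarrow> enat. waning f \<and> waning g \<and> f \<noteq> g \<longrightarrow>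
            topology_f f \<noteq> topology_f g \<and>
            polish_semigroup_topology (topology_f f) \<and>
            polish_semigroup_topology (topology_f g))"
proof (intro conjI allI impI)
  fix T :: "(nat \<times> nat) set topology"
  assume "semigroup_topology T \<and> t1_space T \<and> second_countable T"
  then have T: "semigroup_topology T" and t1: "t1_space T" and sc: "second_countable T" by auto
  from openin_dom_or_ran[OF T t1]
  show "\<exists>f. waning f \<and> (T = topology_f f \<or> inv_topology T = topology_f f)"
  proof
    assume "\<forall>x. openin T {h \<in> \<I>. x \<notin> Domain h}"
    then show ?thesis using I2_finer_classification[OF T t1 sc] by blast
  next
    assume ran: "\<forall>y. openin T {h \<in> \<I>. y \<notin> Range h}"
    have "openin (inv_topology T) {h \<in> \<I>. x \<notin> Domain h}" for x
    proof -
      have "converse ` {h \<in> \<I>. x \<notin> Domain h} = {h \<in> \<I>. x \<notin> Range h}"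
        using sim_converse by (auto simp: mem_converse_image)
      then show ?thesis using ran by (simp add: openin_inv)
    qed
    moreover note hom = homeomorphic_inv_topology[OF sg_topspace[OF T]]
    have "t1_space (inv_topology T)" using homeomorphic_t1_space[OF hom] t1 by blast
    moreover have "second_countable (inv_topology T)"
      using homeomorphic_space_second_countability[OF hom] sc by blast
    ultimately show ?thesis using I2_finer_classification[OF semigroup_inv_topology[OF T]] by blast
  qed
next
  fix f g :: "enat \<Rightarrow> enat" assume "waning f \<and> waning g \<and> f \<noteq> g"
  then show "topology_f f \<noteq> topology_f g" "polish_semigroup_topology (topology_f f)"
      "polish_semigroup_topology (topology_f g)"
    using topology_f_inj polish_topology_f by auto
qed

end
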